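(* Let $(\mathfrak g,\pi,\omega)$ be a Lie-Yamaguti algebra over a field $\mathbb K$ of characteristic $0$ with binary bracket $\pi=[\cdot,\cdot]$ and ternary bracket $\omega=[\![\cdot,\cdot,\cdot]\!]$, and let $(V;\rho,\mu)$ be a representation of it. Let $\Delta=\Pi+\Theta=(\pi+\rho,\omega+\mu)\in\mathfrak C^1(\mathfrak g\oplus V,\mathfrak g\oplus V)$ be the element $$\Delta_{\rm I}(x+u,y+v)=[x,y]+\rho(x)v-\rho(y)u,\quad \Delta_{\rm II}(x+u,y+v,z+w)=[\![x,y,z]\!]+D(x,y)w+\mu(y,z)u-\mu(x,z)v,$$ and define, for $P\in C^p(V,\mathfrak g)$, $Q\in C^q(V,\mathfrak g)$, $R\in C^r(V,\mathfrak g)$ ($p,q,r\ge0$), $$l_2(P,Q)=\mathrm{pr}_{\mathfrak g}[[\Delta,P]_{\mathsf{LieY}},Q]_{\mathsf{LieY}}\in C^{p+q+1}(V,\mathfrak g),\qquad l_3(P,Q,R)=\mathrm{pr}_{\mathfrak g}[[[\Delta,P]_{\mathsf{LieY}},Q]_{\mathsf{LieY}},R]_{\mathsf{LieY}}\in C^{p+q+r+1}(V,\mathfrak g).$$ Then $(C^*(V,\mathfrak g),l_2,l_3)$ (with all other $l_k=0$) is an $L_\infty$-algebra. Moreover, its strict Maurer-Cartan elements are precisely the relative Rota-Baxter operators on the Lie-Yamaguti algebra $(\mathfrak g,\pi,\omega)$ with respect to the representation $(V;\rho,\mu)$.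
   Context: Lie-Yamaguti algebra: a vector space $\mathfrak g$ with a bilinear bracket $[\cdot,\cdot]:\wedge^2\mathfrak g\to\mathfrak g$ and a trilinear bracket $[\![\cdot,\cdot,\cdot]\!]:\wedge^2\mathfrak g\otimes\mathfrak g\to\mathfrak g$ such that for all $x,y,z,w,t\in\mathfrak g$: (1) $[[x,y],z]+[[y,z],x]+[[z,x],y]+[\![x,y,z]\!]+[\![y,z,x]\!]+[\![z,x,y]\!]=0$; (2) $[\![[x,y],z,w]\!]+[\![[y,z],x,w]\!]+[\![[z,x],y,w]\!]=0$; (3) $[\![x,y,[z,w]]\!]=[[\![x,y,z]\!],w]+[z,[\![x,y,w]\!]]$; (4) $[\![x,y,[\![z,w,t]\!]]\!]=[\![[\![x,y,z]\!],w,t]\!]+[\![z,[\![x,y,w]\!],t]\!]+[\![z,w,[\![x,y,t]\!]]\!]$. Representation $(V;\rho,\mu)$: a vector space $V$ with linear maps $\rho:\mathfrak g\to\mathfrak{gl}(V)$, $\mu:\otimes^2\mathfrak g\to\mathfrak{gl}(V)$ such that, with $D(x,y)=D_{\rho,\mu}(x,y):=\mu(y,x)-\mu(x,y)+[\rho(x),\rho(y)]-\rho([x,y])$, for all $x,y,z,w\in\mathfrak g$: $\mu([x,y],z)-\mu(x,z)\rho(y)+\mu(y,z)\rho(x)=0$; $\mu(x,[y,z])-\rho(y)\mu(x,z)+\rho(z)\mu(x,y)=0$; $\rho([\![x,y,z]\!])=[D(x,y),\rho(z)]$; $\mu(z,w)\mu(x,y)-\mu(y,w)\mu(x,z)-\mu(x,[\![y,z,w]\!])+D(y,z)\mu(x,w)=0$;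 $\mu([\![x,y,z]\!],w)+\mu(z,[\![x,y,w]\!])=[D(x,y),\mu(z,w)]$. Relative Rota-Baxter operator on $\mathfrak g$ with respect to $(V;\rho,\mu)$: a linear map $T:V\to\mathfrak g$ with, for all $u,v,w\in V$, $[Tu,Tv]=T(\rho(Tu)v-\rho(Tv)u)$ and $[\![Tu,Tv,Tw]\!]=T(D(Tu,Tv)w+\mu(Tv,Tw)u-\mu(Tu,Tw)v)$. Shuffles: $\mathbb S_{(i,n-i)}$ is the set of $\sigma\in S_n$ with $\sigma(1)<\cdots<\sigma(i)$ and $\sigma(i+1)<\cdots<\sigma(n)$ (only the identity if $i=0$ or $i=n$). The graded Lie algebra $(\mathfrak C^\bullet(E,E),[\cdot,\cdot]_{\mathsf{LieY}})$ for a vector space $E$ (here $E=\mathfrak g\oplus V$): $\mathfrak C^0(E,E)=\mathrm{Hom}(E,E)$ and, for $p\ge1$, $\mathfrak C^p(E,E)=\mathrm{Hom}((\wedge^2E)^{\otimes p},E)\oplus\mathrm{Hom}((\wedge^2E)^{\otimes p}\otimes E,E)$, in degree $p$; elements are written $P=(P_{\rm I},P_{\rm II})$. Below $\mathfrak X_i=x_i\wedge y_i\in\wedge^2E$ and $x\in E$. For $P\in\mathfrak C^p$, $Q\in\mathfrak C^q$ with $p,q\ge1$, $P\circ Q\in\mathfrak C^{p+q}$ is given by $$(P\circ Q)_{\rm I}(\mathfrak X_1,\dots,\mathfrak X_{p+q})=\sum_{\sigma\in\mathbb S_{(p,q)},\,\sigma(p+q)=p+q}(-1)^{pq}\mathrm{sign}(\sigma)P_{\rm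 II}(\mathfrak X_{\sigma(1)},\dots,\mathfrak X_{\sigma(p)},Q_{\rm I}(\mathfrak X_{\sigma(p+1)},\dots,\mathfrak X_{\sigma(p+q)}))$$ $$+\sum_{k=1}^p(-1)^{(k-1)q}\sum_{\sigma\in\mathbb S_{(k-1,q)}}\mathrm{sign}(\sigma)P_{\rm I}(\mathfrak X_{\sigma(1)},\dots,\mathfrak X_{\sigma(k-1)},x_{k+q}\wedge Q_{\rm II}(\mathfrak X_{\sigma(k)},\dots,\mathfrak X_{\sigma(k+q-1)},y_{k+q}),\mathfrak X_{k+q+1},\dots,\mathfrak X_{p+q})$$ $$+\sum_{k=1}^p(-1)^{(k-1)q}\sum_{\sigma\in\mathbb S_{(k-1,q)}}\mathrm{sign}(\sigma)P_{\rm I}(\mathfrak X_{\sigma(1)},\dots,\mathfrak X_{\sigma(k-1)},Q_{\rm II}(\mathfrak X_{\sigma(k)},\dots,\mathfrak X_{\sigma(k+q-1)},x_{k+q})\wedge y_{k+q},\mathfrak X_{k+q+1},\dots,\mathfrak X_{p+q}),$$ and $$(P\circ Q)_{\rm II}(\mathfrak X_1,\dots,\mathfrak X_{p+q},x)=\sum_{\sigma\in\mathbb S_{(p,q)}}(-1)^{pq}\mathrm{sign}(\sigma)P_{\rm II}(\mathfrak X_{\sigma(1)},\dots,\mathfrak X_{\sigma(p)},Q_{\rm II}(\mathfrak X_{\sigma(p+1)},\dots,\mathfrak X_{\sigma(p+q)},x))$$ $$+\sum_{k=1}^p(-1)^{(k-1)q}\sum_{\sigma\in\mathbb S_{(k-1,q)}}\mathrm{sign}(\sigma)P_{\rm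 II}(\mathfrak X_{\sigma(1)},\dots,\mathfrak X_{\sigma(k-1)},x_{k+q}\wedge Q_{\rm II}(\mathfrak X_{\sigma(k)},\dots,\mathfrak X_{\sigma(k+q-1)},y_{k+q}),\mathfrak X_{k+q+1},\dots,\mathfrak X_{p+q},x)$$ $$+\sum_{k=1}^p(-1)^{(k-1)q}\sum_{\sigma\in\mathbb S_{(k-1,q)}}\mathrm{sign}(\sigma)P_{\rm II}(\mathfrak X_{\sigma(1)},\dots,\mathfrak X_{\sigma(k-1)},Q_{\rm II}(\mathfrak X_{\sigma(k)},\dots,\mathfrak X_{\sigma(k+q-1)},x_{k+q})\wedge y_{k+q},\mathfrak X_{k+q+1},\dots,\mathfrak X_{p+q},x).$$ For $f,g\in\mathfrak C^0$ and $P\in\mathfrak C^p$ ($p\ge1$): $f\circ g$ is composition; $(f\circ P)_{\rm I}=f\circ P_{\rm I}$, $(f\circ P)_{\rm II}=f\circ P_{\rm II}$ (compositions); $(P\circ f)_{\rm I}(\mathfrak X_1,\dots,\mathfrak X_p)=\sum_{k=1}^pP_{\rm I}(\mathfrak X_1,\dots,\mathfrak X_{k-1},x_k\wedge f(y_k)+f(x_k)\wedge y_k,\mathfrak X_{k+1},\dots,\mathfrak X_p)$; $(P\circ f)_{\rm II}(\mathfrak X_1,\dots,\mathfrak X_p,x)=\sum_{k=1}^pP_{\rm II}(\mathfrak X_1,\dots,\mathfrak X_{k-1},x_k\wedge f(y_k)+f(x_k)\wedge y_k,\mathfrak X_{k+1},\dots,\mathfrak X_p,x)+P_{\rm II}(\mathfrak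 X_1,\dots,\mathfrak X_p,f(x))$. The bracket is $[P,Q]_{\mathsf{LieY}}=P\circ Q-(-1)^{pq}Q\circ P$. The subspace $C^*(V,\mathfrak g)=\bigoplus_{p\ge0}C^p(V,\mathfrak g)$: $C^0(V,\mathfrak g)=\mathrm{Hom}(V,\mathfrak g)$ and, for $p\ge1$, $C^p(V,\mathfrak g)=\mathrm{Hom}((\wedge^2V)^{\otimes p},\mathfrak g)\oplus\mathrm{Hom}((\wedge^2V)^{\otimes p}\otimes V,\mathfrak g)$ (degree $p$), regarded as a subspace of $\mathfrak C^p(\mathfrak g\oplus V,\mathfrak g\oplus V)$ by precomposing with the projection $\mathfrak g\oplus V\to V$ in every argument. The projection $\mathrm{pr}_{\mathfrak g}:\mathfrak C^\bullet(\mathfrak g\oplus V,\mathfrak g\oplus V)\to C^*(V,\mathfrak g)$ restricts both components of a cochain to arguments in $V$ and projects the value to $\mathfrak g$. $L_\infty$-algebra: a $\mathbb Z$-graded vector space $L=\bigoplus_kL_k$ with multilinear maps $l_k:\otimes^kL\to L$ ($k\ge1$) of degree $1$ such that for homogeneous $x_1,\dots,x_n$: (i) $l_n(x_{\sigma(1)},\dots,x_{\sigma(n)})=\varepsilon(\sigma)l_n(x_1,\dots,x_n)$ for all $\sigma\in S_n$; (ii) $\sum_{i=1}^n\sum_{\sigma\in\mathbb S_{(i,n-i)}}\varepsilon(\sigma)l_{n-i+1}(l_i(x_{\sigma(1)},\dots,x_{\sigma(i)}),x_{\sigma(i+1)},\dots,x_{\sigma(n)})=0$ for all $n\ge1$;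 here $\varepsilon(\sigma)$ is the Koszul sign (an exchange of adjacent $x_i,x_{i+1}$ contributes $(-1)^{|x_i||x_{i+1}|}$). A Maurer-Cartan element is $\alpha\in L_0$ with $\sum_{k\ge1}\frac1{k!}l_k(\alpha,\dots,\alpha)=0$; it is strict if $l_k(\alpha,\dots,\alpha)=0$ for every $k\ge1$. *)

theory Defs
  imports
    "HOL-Analysis.Product_Vector"
    "HOL-Library.Function_Algebras"
    "HOL-Combinatorics.Permutations"
begin

section \<open>Lie-Yamaguti algebras, representations, relative Rota-Baxter operators\<close>

text \<open>A linear map on \<open>\<And>\<^sup>2 \<gg>\<close> is given as an alternating bilinear map.\<close>

locale lie_yamaguti_algebra = vector_space scale
  for scale :: "'k::field \<Rightarrow> 'g::ab_group_add \<Rightarrow> 'g" +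
  fixes br :: "'g \<Rightarrow> 'g \<Rightarrow> 'g"
    and tri :: "'g \<Rightarrow> 'g \<Rightarrow> 'g \<Rightarrow> 'g"
  assumes br_linear1: "Vector_Spaces.linear scale scale (\<lambda>x. br x y)"
    and br_linear2: "Vector_Spaces.linear scale scale (\<lambda>y. br x y)"
    and br_alt: "br x x = 0"
    and tri_linear1: "Vector_Spaces.linear scale scale (\<lambda>x. tri x y z)"
    and tri_linear2: "Vector_Spaces.linear scale scale (\<lambda>y. tri x y z)"
    and tri_linear3: "Vector_Spaces.linear scale scale (\<lambda>z. tri x y z)"
    and tri_alt: "tri x x z = 0"
    and LY1: "br (br x y) z + br (br y z) x + br (br z x) y
              + tri x y z + tri y z x + tri z x y = 0"
    and LY2: "tri (br x y) z w + tri (br y z) x w + tri (br z x) y w = 0"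
    and LY3: "tri x y (br z w) = br (tri x y z) w + br z (tri x y w)"
    and LY4: "tri x y (tri z w t) = tri (tri x y z) w t + tri z (tri x y w) t + tri z w (tri x y t)"

definition LY_D ::
  "('g \<Rightarrow> 'g \<Rightarrow> 'g) \<Rightarrow> ('g \<Rightarrow> 'v \<Rightarrow> 'v::ab_group_add) \<Rightarrow> ('g \<Rightarrow> 'g \<Rightarrow> 'v \<Rightarrow> 'v) \<Rightarrow> 'g \<Rightarrow> 'g \<Rightarrow> 'v \<Rightarrow> 'v"
  where "LY_D br \<rho> \<mu> x y u = \<mu> y x u - \<mu> x y u + (\<rho> x (\<rho> y u) - \<rho> y (\<rho> x u)) - \<rho> (br x y) u"

text \<open>Identities in \<open>\<gg>\<ll>(V)\<close> are written as identities of values at an arbitrary vector \<open>u\<close>.\<close>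

locale lie_yamaguti_representation =
  lie_yamaguti_algebra scale br tri + V: vector_space scaleV
  for scale :: "'k::field \<Rightarrow> 'g::ab_group_add \<Rightarrow> 'g" and br tri
    and scaleV :: "'k \<Rightarrow> 'v::ab_group_add \<Rightarrow> 'v" +
  fixes \<rho> :: "'g \<Rightarrow> 'v \<Rightarrow> 'v"
    and \<mu> :: "'g \<Rightarrow> 'g \<Rightarrow> 'v \<Rightarrow> 'v"
  assumes rho_linear1: "Vector_Spaces.linear scale scaleV (\<lambda>x. \<rho> x u)"
    and rho_linear2: "Vector_Spaces.linear scaleV scaleV (\<lambda>u. \<rho> x u)"
    and mu_linear1: "Vector_Spaces.linear scale scaleV (\<lambda>x. \<mu> x y u)"
    and mu_linear2: "Vector_Spaces.linear scale scaleV (\<lambda>y. \<mu> x y u)"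
    and mu_linear3: "Vector_Spaces.linear scaleV scaleV (\<lambda>u. \<mu> x y u)"
    and rep1: "\<mu> (br x y) z u - \<mu> x z (\<rho> y u) + \<mu> y z (\<rho> x u) = 0"
    and rep2: "\<mu> x (br y z) u - \<rho> y (\<mu> x z u) + \<rho> z (\<mu> x y u) = 0"
    and rep3: "\<rho> (tri x y z) u = LY_D br \<rho> \<mu> x y (\<rho> z u) - \<rho> z (LY_D br \<rho> \<mu> x y u)"
    and rep4: "\<mu> z w (\<mu> x y u) - \<mu> y w (\<mu> x z u) - \<mu> x (tri y z w) u
               + LY_D br \<rho> \<mu> y z (\<mu> x w u) = 0"
    and rep5: "\<mu> (tri x y z) w u + \<mu> z (tri x y w) u
               = LY_D br \<rho> \<mu> x y (\<mu> z w u) - \<mu> z w (LY_D br \<rho> \<mu> x y u)"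

definition relative_rota_baxter ::
  "('k::field \<Rightarrow> 'g::ab_group_add \<Rightarrow> 'g) \<Rightarrow> ('k \<Rightarrow> 'v::ab_group_add \<Rightarrow> 'v)
   \<Rightarrow> ('g \<Rightarrow> 'g \<Rightarrow> 'g) \<Rightarrow> ('g \<Rightarrow> 'g \<Rightarrow> 'g \<Rightarrow> 'g) \<Rightarrow> ('g \<Rightarrow> 'v \<Rightarrow> 'v) \<Rightarrow> ('g \<Rightarrow> 'g \<Rightarrow> 'v \<Rightarrow> 'v)
   \<Rightarrow> ('v \<Rightarrow> 'g) \<Rightarrow> bool"
  where "relative_rota_baxter sg sv br tri \<rho> \<mu> T \<longleftrightarrow>
    Vector_Spaces.linear sv sg T \<and>
    (\<forall>u v. br (T u) (T v) = T (\<rho> (T u) v - \<rho> (T v) u)) \<and>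
    (\<forall>u v w. tri (T u) (T v) (T w)
             = T (LY_D br \<rho> \<mu> (T u) (T v) w + \<mu> (T v) (T w) u - \<mu> (T u) (T w) v))"


section \<open>Shuffles and Koszul signs\<close>

text \<open>
  All indices are shifted by one: permutations act on \<open>{0,\<dots>,n-1}\<close>, and the first entry of a
  list \<open>xs\<close> is \<open>xs ! 0\<close>.
\<close>

definition shuffle_perms :: "nat \<Rightarrow> nat \<Rightarrow> (nat \<Rightarrow> nat) set"
  where "shuffle_perms i j =
    {\<sigma>. \<sigma> permutes {..<i + j} \<and> strict_mono_on {..<i} \<sigma> \<and> strict_mono_on {i..<i + j} \<sigma>}"

text \<open>The list \<open>[xs\<^sub>\<sigma>\<^sub>(\<^sub>i\<^sub>), \<dots>, xs\<^sub>\<sigma>\<^sub>(\<^sub>j\<^sub>-\<^sub>1\<^sub>)]\<close>:\<close>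

definition pick :: "(nat \<Rightarrow> nat) \<Rightarrow> nat \<Rightarrow> nat \<Rightarrow> 'a list \<Rightarrow> 'a list"
  where "pick \<sigma> i j xs = map (\<lambda>m. xs ! \<sigma> m) [i..<j]"

lemma length_pick: "length (pick \<sigma> i j xs) = j - i"
  by (simp add: pick_def)

text \<open>
  The Koszul sign of the passage from \<open>x\<^sub>0, \<dots>, x\<^sub>n\<^sub>-\<^sub>1\<close> to
  \<open>x\<^sub>\<sigma>\<^sub>(\<^sub>0\<^sub>), \<dots>, x\<^sub>\<sigma>\<^sub>(\<^sub>n\<^sub>-\<^sub>1\<^sub>)\<close>, where \<open>x\<^sub>i\<close> has degree \<open>ds ! i\<close>: every pair that changes
  its order contributes \<open>(-1)\<^bsup>|x||y|\<^esup>\<close>.  The two lemmas below say that this is the sign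
  generated by exchanges of adjacent elements.
\<close>

definition koszul_sign :: "int list \<Rightarrow> (nat \<Rightarrow> nat) \<Rightarrow> int"
  where "koszul_sign ds \<sigma> =
    (\<Prod>(i, j) \<in> {(i, j). i < j \<and> j < length ds \<and> \<sigma> j < \<sigma> i}.
       if odd (ds ! \<sigma> i * ds ! \<sigma> j) then - 1 else 1)"

lemma koszul_sign_id: "koszul_sign ds id = 1"
  unfolding koszul_sign_def by (intro prod.neutral) auto

lemma koszul_sign_adjacent:
  assumes "\<sigma> permutes {..<length ds}" and "Suc i < length ds"
  shows "koszul_sign ds (\<sigma> \<circ> transpose i (Suc i)) =
    (if odd (ds ! \<sigma> i * ds ! \<sigma> (Suc i)) then - 1 else 1) * koszul_sign ds \<sigma>"
proof -
  let ?t = "transpose i (Suc i)"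
  define S where "S = (\<lambda>\<tau>::nat \<Rightarrow> nat. {(a, b). a < b \<and> b < length ds \<and> \<tau> b < \<tau> a})"
  define w where "w = (\<lambda>a b. if odd (ds ! a * ds ! b) then - 1 else (1::int))"
  let ?p = "(i, Suc i)" and ?c = "w (\<sigma> i) (\<sigma> (Suc i))"
  have K: "koszul_sign ds \<tau> = (\<Prod>(a, b) \<in> S \<tau>. w (\<tau> a) (\<tau> b))" for \<tau>
    unfolding koszul_sign_def S_def w_def by (rule refl)
  have fin: "finite (S \<tau>)" for \<tau>
    by (rule finite_subset[of _ "{..<length ds} \<times> {..<length ds}"]) (auto simp: S_def)
  have t_less: "?t a < ?t b" if "a < b" "(a, b) \<noteq> ?p" for a b
    using that by (auto simp: transpose_def)
  have t_len: "?t b < length ds \<longleftrightarrow> b < length ds" for b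
    using assms(2) by (auto simp: transpose_def)
  have t_p: "(?t a, ?t b) = ?p \<longleftrightarrow> (a, b) = (Suc i, i)" for a b
    by (auto simp: transpose_def split: if_splits)
  have rest: "(\<Prod>(a, b) \<in> S (\<sigma> \<circ> ?t) - {?p}. w ((\<sigma> \<circ> ?t) a) ((\<sigma> \<circ> ?t) b))
      = (\<Prod>(a, b) \<in> S \<sigma> - {?p}. w (\<sigma> a) (\<sigma> b))"
  proof (rule prod.reindex_bij_witness[of _ "map_prod ?t ?t" "map_prod ?t ?t"], goal_cases)
    case (2 x)
    obtain a b where x: "x = (a, b)" by (cases x)
    with 2 have "a < b" "(a, b) \<noteq> ?p" "b < length ds" "\<sigma> (?t b) < \<sigma> (?t a)" by (auto simp: S_def)
    then show ?case using t_less[of a b] t_len[of b] t_p[of a b] x by (auto simp: S_def)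
  next
    case (4 x)
    obtain a b where x: "x = (a, b)" by (cases x)
    with 4 have "a < b" "(a, b) \<noteq> ?p" "b < length ds" "\<sigma> b < \<sigma> a" by (auto simp: S_def)
    then show ?case using t_less[of a b] t_len[of b] t_p[of a b] x by (auto simp: S_def)
  qed auto
  have mem: "?p \<in> S (\<sigma> \<circ> ?t) \<longleftrightarrow> ?p \<notin> S \<sigma>"
  proof -
    have "\<sigma> i \<noteq> \<sigma> (Suc i)"
      using permutes_inj[OF assms(1)] by (metis injD n_not_Suc_n)
    then show ?thesis using assms(2) by (auto simp: S_def)
  qed
  have c: "?c * ?c = 1" "w (\<sigma> (Suc i)) (\<sigma> i) = ?c"
    by (auto simp: w_def mult.commute)
  have split: "(\<Prod>(a, b) \<in> S \<tau>. w (\<tau> a) (\<tau> b)) =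
      (if ?p \<in> S \<tau> then w (\<tau> i) (\<tau> (Suc i)) else 1) * (\<Prod>(a, b) \<in> S \<tau> - {?p}. w (\<tau> a) (\<tau> b))" for \<tau>
    using prod.remove[OF fin, of ?p \<tau> "\<lambda>(a, b). w (\<tau> a) (\<tau> b)"] by auto
  define B where "B = (\<Prod>(a, b) \<in> S \<sigma> - {?p}. w (\<sigma> a) (\<sigma> b))"
  have "koszul_sign ds \<sigma> = (if ?p \<in> S \<sigma> then ?c else 1) * B"
    unfolding K B_def by (rule split)
  moreover have "koszul_sign ds (\<sigma> \<circ> ?t) = (if ?p \<in> S \<sigma> then 1 else ?c) * B"
    unfolding K split[of "\<sigma> \<circ> ?t"] rest B_def[symmetric] mem by (simp add: c(2))
  ultimately have "koszul_sign ds (\<sigma> \<circ> ?t) = ?c * koszul_sign ds \<sigma>"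
    by (simp add: c(1) flip: mult.assoc)
  then show ?thesis by (simp add: w_def)
qed


section \<open>\<open>L\<^sub>\<infinity>\<close>-algebras\<close>

text \<open>
  A graded vector space is a family of subspaces of an ambient vector space whose sum is direct.
\<close>

locale graded_vector_space = vector_space scale
  for scale :: "'k::field \<Rightarrow> 'a::ab_group_add \<Rightarrow> 'a" +
  fixes L :: "int \<Rightarrow> 'a set"
  assumes subspace_component: "subspace (L i)"
    and independent_components:
      "finite I \<Longrightarrow> (\<And>j. j \<in> I \<Longrightarrow> x j \<in> L j) \<Longrightarrow> (\<Sum>j\<in>I. x j) = 0 \<Longrightarrow> i \<in> I \<Longrightarrow> x i = 0"
begin

definition total :: "'a set"
  where "total = span (\<Union>i. L i)"

end

text \<open>
  The map \<open>l\<^sub>k\<close> is given as a function \<open>l k\<close> on lists, of which only the values on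
  lists of length \<open>k\<close> with entries in the total space matter.
\<close>

locale L_infinity_algebra = graded_vector_space scale L
  for scale :: "'k::field \<Rightarrow> 'a::ab_group_add \<Rightarrow> 'a" and L +
  fixes l :: "nat \<Rightarrow> 'a list \<Rightarrow> 'a"
  assumes multilinear_add:
      "k \<ge> 1 \<Longrightarrow> length xs = k \<Longrightarrow> set xs \<subseteq> total \<Longrightarrow> i < k \<Longrightarrow> x \<in> total \<Longrightarrow> y \<in> total \<Longrightarrow>
       l k (xs[i := x + y]) = l k (xs[i := x]) + l k (xs[i := y])"
    and multilinear_scale:
      "k \<ge> 1 \<Longrightarrow> length xs = k \<Longrightarrow> set xs \<subseteq> total \<Longrightarrow> i < k \<Longrightarrow> x \<in> total \<Longrightarrow>
       l k (xs[i := scale c x]) = scale c (l k (xs[i := x]))"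
    and degree_one:
      "k \<ge> 1 \<Longrightarrow> length xs = k \<Longrightarrow> length ds = k \<Longrightarrow> (\<And>i. i < k \<Longrightarrow> xs ! i \<in> L (ds ! i)) \<Longrightarrow>
       l k xs \<in> L (sum_list ds + 1)"
    and graded_symmetric:
      "n \<ge> 1 \<Longrightarrow> length xs = n \<Longrightarrow> length ds = n \<Longrightarrow> (\<And>i. i < n \<Longrightarrow> xs ! i \<in> L (ds ! i)) \<Longrightarrow>
       \<sigma> permutes {..<n} \<Longrightarrow>
       l n (pick \<sigma> 0 n xs) = scale (of_int (koszul_sign ds \<sigma>)) (l n xs)"
    and generalized_jacobi:
      "n \<ge> 1 \<Longrightarrow> length xs = n \<Longrightarrow> length ds = n \<Longrightarrow> (\<And>i. i < n \<Longrightarrow> xs ! i \<in> L (ds ! i)) \<Longrightarrow>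
       (\<Sum>i = 1..n. \<Sum>\<sigma> \<in> shuffle_perms i (n - i).
          scale (of_int (koszul_sign ds \<sigma>)) (l (n - i + 1) (l i (pick \<sigma> 0 i xs) # pick \<sigma> i n xs))) = 0"

text \<open>
  The Maurer-Cartan equation is an infinite sum; it is understood to have only finitely many
  nonzero terms, which is automatic for strict Maurer-Cartan elements.
\<close>

definition maurer_cartan ::
  "('k::field_char_0 \<Rightarrow> 'a::ab_group_add \<Rightarrow> 'a) \<Rightarrow> (int \<Rightarrow> 'a set) \<Rightarrow> (nat \<Rightarrow> 'a list \<Rightarrow> 'a) \<Rightarrow> 'a \<Rightarrow> bool"
  where "maurer_cartan s L l \<alpha> \<longleftrightarrow>
    \<alpha> \<in> L 0 \<and> finite {k. k \<ge> 1 \<and> l k (replicate k \<alpha>) \<noteq> 0} \<and>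
    (\<Sum>k \<in> {k. k \<ge> 1 \<and> l k (replicate k \<alpha>) \<noteq> 0}. s (1 / fact k) (l k (replicate k \<alpha>))) = 0"

definition strict_maurer_cartan ::
  "('k::field_char_0 \<Rightarrow> 'a::ab_group_add \<Rightarrow> 'a) \<Rightarrow> (int \<Rightarrow> 'a set) \<Rightarrow> (nat \<Rightarrow> 'a list \<Rightarrow> 'a) \<Rightarrow> 'a \<Rightarrow> bool"
  where "strict_maurer_cartan s L l \<alpha> \<longleftrightarrow>
    maurer_cartan s L l \<alpha> \<and> (\<forall>k\<ge>1. l k (replicate k \<alpha>) = 0)"


section \<open>Cochains\<close>

text \<open>
  A cochain is the pair \<open>(P\<^sub>I, P\<^sub>I\<^sub>I) = (fst P, snd P)\<close>.  The arguments
  \<open>\<XX>\<^sub>1, \<dots>, \<XX>\<^sub>p\<close> with \<open>\<XX>\<^sub>i = x\<^sub>i \<and> y\<^sub>i\<close> are the list of the pairs \<open>(x\<^sub>i, y\<^sub>i)\<close>, and a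
  linear map on \<open>(\<And>\<^sup>2 E)\<^sup>\<otimes>\<^sup>p\<close> is a function on lists of length \<open>p\<close> that is bilinear and
  alternating in each pair.  A cochain of degree \<open>p\<close> vanishes on lists of other lengths, so
  that the direct sum over all degrees sits in the single type below (addition and zero are
  pointwise).  A linear map \<open>f\<close> in degree 0 is the pair with \<open>P\<^sub>I = 0\<close> and \<open>P\<^sub>I\<^sub>I [] = f\<close>.
\<close>

type_synonym ('e, 'f) cochain = "(('e \<times> 'e) list \<Rightarrow> 'f) \<times> (('e \<times> 'e) list \<Rightarrow> 'e \<Rightarrow> 'f)"

definition cochain_scale :: "('k \<Rightarrow> 'f \<Rightarrow> 'f) \<Rightarrow> 'k \<Rightarrow> ('e, 'f) cochain \<Rightarrow> ('e, 'f) cochain"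
  where "cochain_scale s a P = (\<lambda>Xs. s a (fst P Xs), \<lambda>Xs x. s a (snd P Xs x))"

definition wedge_multilinear ::
  "('k::field \<Rightarrow> 'e::ab_group_add \<Rightarrow> 'e) \<Rightarrow> ('k \<Rightarrow> 'f::ab_group_add \<Rightarrow> 'f) \<Rightarrow> nat
   \<Rightarrow> (('e \<times> 'e) list \<Rightarrow> 'f) \<Rightarrow> bool"
  where "wedge_multilinear s t p F \<longleftrightarrow>
    (\<forall>Xs i. length Xs = p \<longrightarrow> i < p \<longrightarrow>
       (\<forall>y. Vector_Spaces.linear s t (\<lambda>x. F (Xs[i := (x, y)]))) \<and>
       (\<forall>x. Vector_Spaces.linear s t (\<lambda>y. F (Xs[i := (x, y)]))) \<and>
       (\<forall>x. F (Xs[i := (x, x)]) = 0))"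

definition hom_part :: "nat \<Rightarrow> ('e, 'f::zero) cochain \<Rightarrow> ('e, 'f) cochain"
  where "hom_part p P =
    (\<lambda>Xs. if length Xs = p then fst P Xs else 0,
     \<lambda>Xs x. if length Xs = p then snd P Xs x else 0)"

text \<open>The space of cochains of degree \<open>p\<close> on \<open>E\<close> (scalars \<open>s\<close>) with values in \<open>F\<close> (scalars \<open>t\<close>):\<close>

definition cochains ::
  "('k::field \<Rightarrow> 'e::ab_group_add \<Rightarrow> 'e) \<Rightarrow> ('k \<Rightarrow> 'f::ab_group_add \<Rightarrow> 'f) \<Rightarrow> nat
   \<Rightarrow> ('e, 'f) cochain set"
  where "cochains s t p = {P.
    hom_part p P = P \<and>
    (if p = 0 then fst P = 0 else wedge_multilinear s t p (fst P)) \<and>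
    (\<forall>x. wedge_multilinear s t p (\<lambda>Xs. snd P Xs x)) \<and>
    (\<forall>Xs. length Xs = p \<longrightarrow> Vector_Spaces.linear s t (snd P Xs))}"

definition cochain_of_map :: "('e \<Rightarrow> 'f::zero) \<Rightarrow> ('e, 'f) cochain"
  where "cochain_of_map f = (0, \<lambda>Xs x. if Xs = [] then f x else 0)"


section \<open>The graded Lie bracket on cochains\<close>

text \<open>
  \<open>F(As, x \<and> d(y), Bs) + F(As, d(x) \<and> y, Bs)\<close> for \<open>X = x \<and> y\<close>:
\<close>

definition deriv_slot ::
  "(('e \<times> 'e) list \<Rightarrow> 'f::plus) \<Rightarrow> ('e \<times> 'e) list \<Rightarrow> ('e \<Rightarrow> 'e) \<Rightarrow> 'e \<times> 'e \<Rightarrow> ('e \<times> 'e) list \<Rightarrow> 'f"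
  where "deriv_slot F As d X Bs =
    F (As @ (fst X, d (snd X)) # Bs) + F (As @ (d (fst X), snd X) # Bs)"

text \<open>
  The last two sums in both components of \<open>P \<circ> Q\<close>; here \<open>k\<close> runs from \<open>0\<close>, so it is the
  \<open>k - 1\<close> of the usual formula.
\<close>

definition insertion_sum ::
  "('k::field \<Rightarrow> 'e::ab_group_add \<Rightarrow> 'e) \<Rightarrow> nat \<Rightarrow> nat \<Rightarrow> (('e \<times> 'e) list \<Rightarrow> 'e)
   \<Rightarrow> (('e \<times> 'e) list \<Rightarrow> 'e \<Rightarrow> 'e) \<Rightarrow> ('e \<times> 'e) list \<Rightarrow> 'e"
  where "insertion_sum s p q F G Xs =
    (\<Sum>k<p. \<Sum>\<sigma> \<in> shuffle_perms k q.
       s (of_int ((- 1) ^ (k * q) * sign \<sigma>))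
         (deriv_slot F (pick \<sigma> 0 k Xs) (G (pick \<sigma> k (k + q) Xs)) (Xs ! (k + q))
            (drop (k + q + 1) Xs)))"

text \<open>
  \<open>P \<circ> Q\<close> for \<open>P\<close> of degree \<open>p\<close> and \<open>Q\<close> of degree \<open>q\<close>.  The first case covers
  \<open>f \<circ> P\<close> and \<open>f \<circ> g\<close>, the second \<open>P \<circ> f\<close>.
\<close>

definition circ ::
  "('k::field \<Rightarrow> 'e::ab_group_add \<Rightarrow> 'e) \<Rightarrow> nat \<Rightarrow> nat \<Rightarrow> ('e, 'e) cochain \<Rightarrow> ('e, 'e) cochain
   \<Rightarrow> ('e, 'e) cochain"
  where "circ s p q P Q = hom_part (p + q)
    (if p = 0 then
       (\<lambda>Xs. snd P [] (fst Q Xs),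
        \<lambda>Xs x. snd P [] (snd Q Xs x))
     else if q = 0 then
       (\<lambda>Xs. \<Sum>k<p. deriv_slot (fst P) (take k Xs) (snd Q []) (Xs ! k) (drop (k + 1) Xs),
        \<lambda>Xs x. (\<Sum>k<p. deriv_slot (\<lambda>Ys. snd P Ys x) (take k Xs) (snd Q []) (Xs ! k)
                         (drop (k + 1) Xs))
               + snd P Xs (snd Q [] x))
     else
       (\<lambda>Xs. (\<Sum>\<sigma> \<in> {\<sigma> \<in> shuffle_perms p q. \<sigma> (p + q - 1) = p + q - 1}.
                s (of_int ((- 1) ^ (p * q) * sign \<sigma>))
                  (snd P (pick \<sigma> 0 p Xs) (fst Q (pick \<sigma> p (p + q) Xs))))
             + insertion_sum s p q (fst P) (snd Q) Xs,
        \<lambda>Xs x. (\<Sum>\<sigma> \<in> shuffle_perms p q.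
                s (of_int ((- 1) ^ (p * q) * sign \<sigma>))
                  (snd P (pick \<sigma> 0 p Xs) (snd Q (pick \<sigma> p (p + q) Xs) x)))
             + insertion_sum s p q (\<lambda>Ys. snd P Ys x) (snd Q) Xs))"

definition LieY_hom ::
  "('k::field \<Rightarrow> 'e::ab_group_add \<Rightarrow> 'e) \<Rightarrow> nat \<Rightarrow> nat \<Rightarrow> ('e, 'e) cochain \<Rightarrow> ('e, 'e) cochain
   \<Rightarrow> ('e, 'e) cochain"
  where "LieY_hom s p q P Q =
    circ s p q P Q - cochain_scale s ((- 1) ^ (p * q)) (circ s q p Q P)"

text \<open>
  The bilinear extension to inhomogeneous cochains, \<open>[P, Q] = \<Sum>p q. [P\<^sub>p, Q\<^sub>q]\<close>: the
  component of degree \<open>n\<close> is the sum over \<open>p + q = n\<close>.  On homogeneous cochains it is \<open>LieY_hom\<close>,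
  see \<open>LieY_homogeneous\<close> below.
\<close>

definition LieY ::
  "('k::field \<Rightarrow> 'e::ab_group_add \<Rightarrow> 'e) \<Rightarrow> ('e, 'e) cochain \<Rightarrow> ('e, 'e) cochain \<Rightarrow> ('e, 'e) cochain"
  where "LieY s P Q =
    (let B = (\<lambda>n. \<Sum>p\<le>n. LieY_hom s p (n - p) (hom_part p P) (hom_part (n - p) Q))
     in (\<lambda>Xs. fst (B (length Xs)) Xs, \<lambda>Xs x. snd (B (length Xs)) Xs x))"

lemma hom_part_hom_part: "hom_part p (hom_part q P) = (if p = q then hom_part p P else 0)"
  by (auto simp: hom_part_def fun_eq_iff zero_prod_def)

lemma wedge_multilinear_zero:
  assumes "wedge_multilinear s t p F" and "length Xs = p" and "i < p" and "fst (Xs ! i) = 0 \<or> snd (Xs ! i) = 0"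
  shows "F Xs = 0"
proof -
  have 1: "Vector_Spaces.linear s t (\<lambda>x. F (Xs[i := (x, snd (Xs ! i))]))"
    and 2: "Vector_Spaces.linear s t (\<lambda>x. F (Xs[i := (fst (Xs ! i), x)]))"
    using assms unfolding wedge_multilinear_def by blast+
  have z: "f 0 = 0" if "Vector_Spaces.linear s t f" for f
    using that Vector_Spaces.linear.axioms(3) module_hom.zero by metis
  from z[OF 1] z[OF 2] assms(4) show ?thesis
    by (metis list_update_id prod.collapse)
qed

lemma circ_zero_left:
  assumes "vector_space s"
  shows "circ s p q 0 Q = 0"
proof -
  have "s a 0 = 0" for a
    using assms module.scale_zero_right module_iff_vector_space by metis
  then show ?thesis
    by (auto simp: circ_def hom_part_def insertion_sum_def deriv_slot_def fun_eq_iff zero_prod_def)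
qed

lemma circ_zero_right:
  assumes "vector_space s" and "P \<in> cochains s s p"
  shows "circ s p q P 0 = 0"
proof -
  have s: "s a 0 = 0" for a
    using assms module.scale_zero_right module_iff_vector_space by metis
  have z: "f 0 = 0" if "Vector_Spaces.linear s s f" for f
    using that Vector_Spaces.linear.axioms(3) module_hom.zero by metis
  have P: "p \<noteq> 0 \<Longrightarrow> wedge_multilinear s s p (fst P)"
    "\<And>x. wedge_multilinear s s p (\<lambda>Xs. snd P Xs x)"
    "\<And>Xs. length Xs = p \<Longrightarrow> Vector_Spaces.linear s s (snd P Xs)"
    using assms(2) by (auto simp: cochains_def split: if_splits)
  have d: "deriv_slot F As (\<lambda>x. 0) X Bs = 0"
    if "wedge_multilinear s s p F" "length As + length Bs + 1 = p" for F As X Bs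
    using wedge_multilinear_zero[OF that(1), of "As @ (fst X, 0) # Bs" "length As"]
      wedge_multilinear_zero[OF that(1), of "As @ (0, snd X) # Bs" "length As"] that(2)
    by (auto simp: deriv_slot_def)
  have ins: "insertion_sum s p q F 0 Xs = 0"
    if "wedge_multilinear s s p F" "length Xs = p + q" for F Xs
    unfolding insertion_sum_def zero_fun_def
    using that by (intro sum.neutral ballI) (simp add: s pick_def d)
  have sum0: "(\<Sum>k<p. deriv_slot F (take k Xs) 0 (Xs ! k) (drop (k + 1) Xs)) = 0"
    if "wedge_multilinear s s p F" "length Xs = p" for F Xs
    using that unfolding zero_fun_def by (intro sum.neutral ballI d[OF that(1)]) auto
  have P0: "snd P Ys 0 = 0" if "length Ys = p" for Ys
    using z[OF P(3)[OF that]] .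
  have "fst (circ s p q P 0) Xs = 0" for Xs
    using ins[OF P(1), of Xs] sum0[OF P(1), of Xs]
    by (simp add: circ_def hom_part_def P0 length_pick s)
  moreover have "snd (circ s p q P 0) Xs x = 0" for Xs x
    using ins[OF P(2), of Xs x] sum0[OF P(2), of Xs x]
    by (simp add: circ_def hom_part_def P0 length_pick s)
  ultimately show ?thesis
    by (auto simp: prod_eq_iff fun_eq_iff)
qed

lemma LieY_homogeneous:
  assumes "vector_space s" and "P \<in> cochains s s p" and "Q \<in> cochains s s q"
  shows "LieY s P Q = LieY_hom s p q P Q"
proof -
  have s: "s a 0 = 0" for a
    using assms module.scale_zero_right module_iff_vector_space by metis
  have hP: "hom_part m P = (if m = p then P else 0)" for m
    using assms(2) hom_part_hom_part[of m p P] by (auto simp: cochains_def)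
  have hQ: "hom_part m Q = (if m = q then Q else 0)" for m
    using assms(3) hom_part_hom_part[of m q Q] by (auto simp: cochains_def)
  have sc0: "cochain_scale s a 0 = 0" for a
    by (auto simp: cochain_scale_def s zero_prod_def fun_eq_iff)
  have term_eq: "LieY_hom s m (n - m) (hom_part m P) (hom_part (n - m) Q) =
      (if m = p \<and> n - m = q then LieY_hom s p q P Q else 0)" for m n
    using circ_zero_left[OF assms(1)] circ_zero_right[OF assms(1)] assms(2,3)
    by (auto simp: LieY_hom_def hP hQ sc0)
  have sum_eq: "(\<Sum>m\<le>n. LieY_hom s m (n - m) (hom_part m P) (hom_part (n - m) Q)) =
      (if n = p + q then LieY_hom s p q P Q else 0)" for n
  proof -
    have "(\<Sum>m\<le>n. LieY_hom s m (n - m) (hom_part m P) (hom_part (n - m) Q)) =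
        (\<Sum>m\<le>n. if m = p then (if n = p + q then LieY_hom s p q P Q else 0) else 0)"
      by (intro sum.cong) (auto simp: term_eq)
    then show ?thesis by auto
  qed
  have "fst (LieY_hom s p q P Q) Xs = 0 \<and> snd (LieY_hom s p q P Q) Xs x = 0"
    if "length Xs \<noteq> p + q" for Xs x
    using that by (simp add: LieY_hom_def circ_def hom_part_def cochain_scale_def s add.commute[of q p])
  then show ?thesis
    unfolding LieY_def sum_eq by (auto simp: prod_eq_iff fun_eq_iff)
qed


section \<open>The \<open>L\<^sub>\<infinity>\<close>-structure of relative Rota-Baxter operators\<close>

text \<open>\<open>\<gg> \<oplus> V\<close> is the product type, with scalar multiplication \<open>module_prod.scale sg sv\<close>.\<close>

definition C_star ::
  "('k::field \<Rightarrow> 'v::ab_group_add \<Rightarrow> 'v) \<Rightarrow> ('k \<Rightarrow> 'g::ab_group_add \<Rightarrow> 'g) \<Rightarrow> int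
   \<Rightarrow> ('v, 'g) cochain set"
  where "C_star sv sg k = (if k < 0 then {0} else cochains sv sg (nat k))"

definition embed_V :: "('v, 'g) cochain \<Rightarrow> ('g \<times> 'v, 'g \<times> 'v::zero) cochain"
  where "embed_V P =
    (\<lambda>Xs. (fst P (map (map_prod snd snd) Xs), 0),
     \<lambda>Xs x. (snd P (map (map_prod snd snd) Xs) (snd x), 0))"

definition pr_g :: "('g::zero \<times> 'v, 'g \<times> 'v) cochain \<Rightarrow> ('v, 'g) cochain"
  where "pr_g P =
    (\<lambda>Xs. fst (fst P (map (map_prod (Pair 0) (Pair 0)) Xs)),
     \<lambda>Xs x. fst (snd P (map (map_prod (Pair 0) (Pair 0)) Xs) (0, x)))"

definition Delta ::
  "('g::ab_group_add \<Rightarrow> 'g \<Rightarrow> 'g) \<Rightarrow> ('g \<Rightarrow> 'g \<Rightarrow> 'g \<Rightarrow> 'g)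
   \<Rightarrow> ('g \<Rightarrow> 'v::ab_group_add \<Rightarrow> 'v) \<Rightarrow> ('g \<Rightarrow> 'g \<Rightarrow> 'v \<Rightarrow> 'v) \<Rightarrow> ('g \<times> 'v, 'g \<times> 'v) cochain"
  where "Delta br tri \<rho> \<mu> =
    (\<lambda>Xs. case Xs of [((x, u), (y, v))] \<Rightarrow> (br x y, \<rho> x v - \<rho> y u) | _ \<Rightarrow> 0,
     \<lambda>Xs (z, w). case Xs of
        [((x, u), (y, v))] \<Rightarrow> (tri x y z, LY_D br \<rho> \<mu> x y w + \<mu> y z u - \<mu> x z v)
      | _ \<Rightarrow> 0)"

definition l2 ::
  "('k::field \<Rightarrow> 'g::ab_group_add \<Rightarrow> 'g) \<Rightarrow> ('k \<Rightarrow> 'v::ab_group_add \<Rightarrow> 'v)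
   \<Rightarrow> ('g \<Rightarrow> 'g \<Rightarrow> 'g) \<Rightarrow> ('g \<Rightarrow> 'g \<Rightarrow> 'g \<Rightarrow> 'g) \<Rightarrow> ('g \<Rightarrow> 'v \<Rightarrow> 'v) \<Rightarrow> ('g \<Rightarrow> 'g \<Rightarrow> 'v \<Rightarrow> 'v)
   \<Rightarrow> ('v, 'g) cochain \<Rightarrow> ('v, 'g) cochain \<Rightarrow> ('v, 'g) cochain"
  where "l2 sg sv br tri \<rho> \<mu> P Q =
    (let s = module_prod.scale sg sv
     in pr_g (LieY s (LieY s (Delta br tri \<rho> \<mu>) (embed_V P)) (embed_V Q)))"

definition l3 ::
  "('k::field \<Rightarrow> 'g::ab_group_add \<Rightarrow> 'g) \<Rightarrow> ('k \<Rightarrow> 'v::ab_group_add \<Rightarrow> 'v)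
   \<Rightarrow> ('g \<Rightarrow> 'g \<Rightarrow> 'g) \<Rightarrow> ('g \<Rightarrow> 'g \<Rightarrow> 'g \<Rightarrow> 'g) \<Rightarrow> ('g \<Rightarrow> 'v \<Rightarrow> 'v) \<Rightarrow> ('g \<Rightarrow> 'g \<Rightarrow> 'v \<Rightarrow> 'v)
   \<Rightarrow> ('v, 'g) cochain \<Rightarrow> ('v, 'g) cochain \<Rightarrow> ('v, 'g) cochain \<Rightarrow> ('v, 'g) cochain"
  where "l3 sg sv br tri \<rho> \<mu> P Q R =
    (let s = module_prod.scale sg sv
     in pr_g (LieY s (LieY s (LieY s (Delta br tri \<rho> \<mu>) (embed_V P)) (embed_V Q)) (embed_V R)))"

definition rrb_brackets ::
  "('k::field \<Rightarrow> 'g::ab_group_add \<Rightarrow> 'g) \<Rightarrow> ('k \<Rightarrow> 'v::ab_group_add \<Rightarrow> 'v)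
   \<Rightarrow> ('g \<Rightarrow> 'g \<Rightarrow> 'g) \<Rightarrow> ('g \<Rightarrow> 'g \<Rightarrow> 'g \<Rightarrow> 'g) \<Rightarrow> ('g \<Rightarrow> 'v \<Rightarrow> 'v) \<Rightarrow> ('g \<Rightarrow> 'g \<Rightarrow> 'v \<Rightarrow> 'v)
   \<Rightarrow> nat \<Rightarrow> ('v, 'g) cochain list \<Rightarrow> ('v, 'g) cochain"
  where "rrb_brackets sg sv br tri \<rho> \<mu> k Ps =
    (if k = 2 then l2 sg sv br tri \<rho> \<mu> (Ps ! 0) (Ps ! 1)
     else if k = 3 then l3 sg sv br tri \<rho> \<mu> (Ps ! 0) (Ps ! 1) (Ps ! 2)
     else 0)"

end

theory Submission
  imports Defs
begin

text \<open>
  The composition of cochains is rewritten without permutations: the first argument of \<open>P \<circ> Q\<close>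
  is an argument of \<open>Q\<close>, or the slot of \<open>P\<close> hit by \<open>Q\<close>, or it stays an argument of \<open>P\<close>.
  In this form \<open>\<circ>\<close> is seen, by induction on the number of arguments, to be graded right pre-Lie,
  so its commutator satisfies the graded Jacobi identity.  The axioms (3) and (4) of the
  semidirect product \<open>\<gg> \<ltimes> V\<close> say \<open>\<Delta> \<circ> \<Delta> = 0\<close>, and \<open>C\<^sup>*(V, \<gg>)\<close> is an abelian subalgebra
  with complement the kernel of \<open>pr\<close>, which is again a subalgebra.  Voronov's derived brackets
  \<open>pr [\<dots>[\<Delta>, P\<^sub>1], \<dots>, P\<^sub>k]\<close> therefore form an \<open>L\<^sub>\<infinity>\<close>-algebra.  They vanish for
  \<open>k \<noteq> 2, 3\<close>: giving \<open>\<gg>\<close> weight \<open>1\<close> and \<open>V\<close> weight \<open>0\<close>, the components of \<open>\<Delta>\<close> have weights \<open>1\<close>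
  and \<open>2\<close>, every bracket with an element of \<open>C\<^sup>*(V, \<gg>)\<close> lowers the weight by \<open>1\<close>, and \<open>pr\<close> only
  sees weight \<open>-1\<close>.  On a linear map \<open>T\<close> the brackets \<open>l\<^sub>2\<close> and \<open>l\<^sub>3\<close> are \<open>2\<close> and \<open>6\<close> times the two
  defects in the definition of a relative Rota-Baxter operator.
\<close>

section \<open>Insertion and shuffle operators\<close>

text \<open>Iterated sums over shuffles are hard to compare: in (P o Q) o R the permutations of one
  sum act on lists already permuted by the other. Peeling off the first argument removes the
  problem. Fixing that argument in P, Q or R gives functions of the same kind with one argument
  fewer, so an identity only has to be matched for one entry of the list, and the rest is the
  induction hypothesis. This forces hypotheses that survive currying: concentration on lists of
  length p becomes a parity condition, and multilinearity in p slots becomes additivity in every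
  slot of every list. Signs depend on parities alone, so they are Booleans, and each identity
  becomes a case split over Booleans followed by arithmetic in an abelian group; scalars enter
  later. The condition that Q receive the last pair in the first component is a flag of the
  recursion, so both components of P o Q obey the same lemmas. The price is paid once, in the
  translation of signed sums over shuffle permutations into the recursive form.\<close>

definition signed :: "bool \<Rightarrow> 'a::ab_group_add \<Rightarrow> 'a"
  where "signed b x = (if b then - x else x)"

lemma signed_simps [simp]: "signed False x = x" "signed True x = - x"
  by (simp_all add: signed_def)

lemma signed_0 [simp]: "signed b 0 = 0"
  by (simp add: signed_def)

definition slot_additive :: "(('e::ab_group_add \<times> 'e) list \<Rightarrow> 'a::ab_group_add) \<Rightarrow> bool"
  where "slot_additive \<phi> \<longleftrightarrow> (\<forall>As Bs x y z.
    \<phi> (As @ (x + y, z) # Bs) = \<phi> (As @ (x, z) # Bs) + \<phi> (As @ (y, z) # Bs) \<and>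
    \<phi> (As @ (z, x + y) # Bs) = \<phi> (As @ (z, x) # Bs) + \<phi> (As @ (z, y) # Bs))"

text \<open>Stands in for the degree: a cochain of degree \<open>q\<close> has flag
  \<open>odd q\<close>, and currying negates the flag. It ties the Boolean carried by
  \<open>insert_into\<close> and \<open>shuffle\<close> to the number of arguments that are really
  left.\<close>

definition parity_of :: "bool \<Rightarrow> ('x list \<Rightarrow> 'a::zero) \<Rightarrow> bool"
  where "parity_of b F \<longleftrightarrow> (\<forall>Xs. odd (length Xs) \<noteq> b \<longrightarrow> F Xs = 0)"

text \<open>
  The flag \<open>b\<close> is the parity of the number of arguments that \<open>G\<close> still takes, so it flips
  whenever \<open>G\<close> receives one; \<open>signed b\<close> is the sign for moving an argument of \<open>\<phi>\<close> past those of \<open>G\<close>.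
\<close>

primrec insert_into ::
  "bool \<Rightarrow> (('e \<times> 'e) list \<Rightarrow> 'e \<Rightarrow> 'e) \<Rightarrow> (('e \<times> 'e) list \<Rightarrow> 'a) \<Rightarrow> ('e \<times> 'e) list \<Rightarrow> 'a::ab_group_add"
  where
    "insert_into b G \<phi> [] = 0"
  | "insert_into b G \<phi> (X # Xs) = deriv_slot \<phi> [] (G []) X Xs
       + insert_into (\<not> b) (\<lambda>Ys. G (X # Ys)) \<phi> Xs
       + signed b (insert_into b G (\<lambda>Ys. \<phi> (X # Ys)) Xs)"

text \<open>
  If \<open>h\<close> holds, the last entry has to go to \<open>G\<close>: this is the first sum in \<open>(P \<circ> Q)\<^sub>I\<close>, the
  case \<open>\<not> h\<close> is the first sum in \<open>(P \<circ> Q)\<^sub>I\<^sub>I\<close>.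
\<close>

primrec shuffle ::
  "bool \<Rightarrow> bool \<Rightarrow> ('x list \<Rightarrow> 'b) \<Rightarrow> ('x list \<Rightarrow> 'b \<Rightarrow> 'a) \<Rightarrow> 'x list \<Rightarrow> 'a::ab_group_add"
  where
    "shuffle h b G \<phi> [] = (if h then 0 else \<phi> [] (G []))"
  | "shuffle h b G \<phi> (X # Xs) = (if h \<and> Xs = [] then \<phi> [] (G [X]) else 0)
       + shuffle h (\<not> b) (\<lambda>Ys. G (X # Ys)) \<phi> Xs
       + signed b (shuffle h b G (\<lambda>Ys. \<phi> (X # Ys)) Xs)"

section \<open>Additivity of insertion and shuffle product in both arguments\<close>

lemma slot_additive_Cons: "slot_additive \<phi> \<Longrightarrow> slot_additive (\<lambda>Ys. \<phi> (X # Ys))"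
  unfolding slot_additive_def by (metis append_Cons)

lemma slot_additiveD:
  assumes "slot_additive \<phi>"
  shows "\<phi> ((x + y, z) # Bs) = \<phi> ((x, z) # Bs) + \<phi> ((y, z) # Bs)"
    and "\<phi> ((z, x + y) # Bs) = \<phi> ((z, x) # Bs) + \<phi> ((z, y) # Bs)"
    and "\<phi> ((0, z) # Bs) = 0" and "\<phi> ((z, 0) # Bs) = 0"
    and "\<phi> ((- x, z) # Bs) = - \<phi> ((x, z) # Bs)" and "\<phi> ((z, - x) # Bs) = - \<phi> ((z, x) # Bs)"
proof -
  have 1: "\<phi> ((x + y, z) # Bs) = \<phi> ((x, z) # Bs) + \<phi> ((y, z) # Bs)"
    and 2: "\<phi> ((z, x + y) # Bs) = \<phi> ((z, x) # Bs) + \<phi> ((z, y) # Bs)" for x y z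
    using assms unfolding slot_additive_def by (metis append_Nil)+
  show "\<phi> ((x + y, z) # Bs) = \<phi> ((x, z) # Bs) + \<phi> ((y, z) # Bs)"
    "\<phi> ((z, x + y) # Bs) = \<phi> ((z, x) # Bs) + \<phi> ((z, y) # Bs)" by (fact 1 2)+
  show z: "\<phi> ((0, z) # Bs) = 0" "\<phi> ((z, 0) # Bs) = 0" for z
    using 1[of 0 0 z] 2[of z 0 0] by simp_all
  show "\<phi> ((- x, z) # Bs) = - \<phi> ((x, z) # Bs)" "\<phi> ((z, - x) # Bs) = - \<phi> ((z, x) # Bs)"
    using 1[of "- x" x z] 2[of z "- x" x] z by (simp_all add: eq_neg_iff_add_eq_0)
qed

lemma insert_into_add_left:
  "slot_additive \<phi> \<Longrightarrow> insert_into b (\<lambda>Ys y. G Ys y + H Ys y) \<phi> Xs = insert_into b G \<phi> Xs + insert_into b H \<phi> Xs"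
  by (induction Xs arbitrary: b G H \<phi>)
    (auto simp: slot_additive_Cons deriv_slot_def slot_additiveD signed_def)

lemma insert_into_uminus_left:
  "slot_additive \<phi> \<Longrightarrow> insert_into b (\<lambda>Ys y. - G Ys y) \<phi> Xs = - insert_into b G \<phi> Xs"
  by (induction Xs arbitrary: b G \<phi>)
    (auto simp: slot_additive_Cons deriv_slot_def slot_additiveD signed_def)

lemma insert_into_zero_left: "slot_additive \<phi> \<Longrightarrow> insert_into b (\<lambda>Ys y. 0) \<phi> Xs = 0"
  by (induction Xs arbitrary: b \<phi>)
    (auto simp: slot_additive_Cons deriv_slot_def slot_additiveD)

lemma insert_into_add_right:
  "insert_into b G (\<lambda>Ys. \<phi> Ys + \<psi> Ys) Xs = insert_into b G \<phi> Xs + insert_into b G \<psi> Xs"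
  by (induction Xs arbitrary: b G \<phi> \<psi>) (auto simp: deriv_slot_def signed_def)

lemma insert_into_uminus_right: "insert_into b G (\<lambda>Ys. - \<phi> Ys) Xs = - insert_into b G \<phi> Xs"
  by (induction Xs arbitrary: b G \<phi>) (auto simp: deriv_slot_def signed_def)

lemma insert_into_zero_right: "insert_into b G (\<lambda>Ys. 0) Xs = 0"
  by (induction Xs arbitrary: b G) (auto simp: deriv_slot_def)

lemma shuffle_add_right:
  "shuffle h b G (\<lambda>Ys x. \<phi> Ys x + \<psi> Ys x) Xs = shuffle h b G \<phi> Xs + shuffle h b G \<psi> Xs"
  by (induction Xs arbitrary: b G \<phi> \<psi>) (auto simp: signed_def)

lemma shuffle_uminus_right: "shuffle h b G (\<lambda>Ys x. - \<phi> Ys x) Xs = - shuffle h b G \<phi> Xs"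
  by (induction Xs arbitrary: b G \<phi>) (auto simp: signed_def)

definition value_additive :: "('x list \<Rightarrow> 'b::ab_group_add \<Rightarrow> 'a::ab_group_add) \<Rightarrow> bool"
  where "value_additive \<phi> \<longleftrightarrow> (\<forall>Ys x y. \<phi> Ys (x + y) = \<phi> Ys x + \<phi> Ys y)"

lemma value_additive_Cons: "value_additive \<phi> \<Longrightarrow> value_additive (\<lambda>Ys. \<phi> (X # Ys))"
  by (simp add: value_additive_def)

lemma value_additiveD:
  assumes "value_additive \<phi>"
  shows "\<phi> Ys (x + y) = \<phi> Ys x + \<phi> Ys y" and "\<phi> Ys 0 = 0" and "\<phi> Ys (- x) = - \<phi> Ys x"
    and "\<phi> Ys (x - y) = \<phi> Ys x - \<phi> Ys y"
proof -
  have 1: "\<phi> Ys (x + y) = \<phi> Ys x + \<phi> Ys y" for x y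
    using assms by (simp add: value_additive_def)
  show 0: "\<phi> Ys 0 = 0" using 1[of 0 0] by simp
  show 2: "\<phi> Ys (- x) = - \<phi> Ys x" for x using 1[of "- x" x] 0 by (simp add: eq_neg_iff_add_eq_0)
  show "\<phi> Ys (x + y) = \<phi> Ys x + \<phi> Ys y" by (fact 1)
  show "\<phi> Ys (x - y) = \<phi> Ys x - \<phi> Ys y" using 1[of x "- y"] 2 by simp
qed

lemma shuffle_add_left:
  "value_additive \<phi> \<Longrightarrow>
   shuffle h b (\<lambda>Ys. G Ys + H Ys) \<phi> Xs = shuffle h b G \<phi> Xs + shuffle h b H \<phi> Xs"
  by (induction Xs arbitrary: b G H \<phi>) (auto simp: signed_def value_additiveD value_additive_Cons)

lemma shuffle_uminus_left:
  "value_additive \<phi> \<Longrightarrow> shuffle h b (\<lambda>Ys. - G Ys) \<phi> Xs = - shuffle h b G \<phi> Xs"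
  by (induction Xs arbitrary: b G \<phi>) (auto simp: signed_def value_additiveD value_additive_Cons)

lemma shuffle_zero_left: "value_additive \<phi> \<Longrightarrow> shuffle h b (\<lambda>Ys. 0) \<phi> Xs = 0"
  by (induction Xs arbitrary: b \<phi>) (auto simp: signed_def value_additiveD value_additive_Cons)

lemma insert_into_diff_left:
  "slot_additive \<phi> \<Longrightarrow> insert_into b (\<lambda>Ys y. G Ys y - H Ys y) \<phi> Xs = insert_into b G \<phi> Xs - insert_into b H \<phi> Xs"
  using insert_into_add_left[of \<phi> b G "\<lambda>Ys y. - H Ys y" Xs] by (simp add: insert_into_uminus_left)

lemma insert_into_diff_right:
  "insert_into b G (\<lambda>Ys. \<phi> Ys - \<psi> Ys) Xs = insert_into b G \<phi> Xs - insert_into b G \<psi> Xs"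
  using insert_into_add_right[of b G \<phi> "\<lambda>Ys. - \<psi> Ys" Xs] by (simp add: insert_into_uminus_right)

lemma shuffle_diff_right:
  "shuffle h b G (\<lambda>Ys x. \<phi> Ys x - \<psi> Ys x) Xs = shuffle h b G \<phi> Xs - shuffle h b G \<psi> Xs"
  using shuffle_add_right[of h b G \<phi> "\<lambda>Ys x. - \<psi> Ys x" Xs] by (simp add: shuffle_uminus_right)

lemma shuffle_diff_left:
  assumes "value_additive \<phi>"
  shows "shuffle h b (\<lambda>Ys. G Ys - H Ys) \<phi> Xs = shuffle h b G \<phi> Xs - shuffle h b H \<phi> Xs"
  using shuffle_add_left[of \<phi> h b G "\<lambda>Ys. - H Ys" Xs] assms by (simp add: shuffle_uminus_left)

lemma shuffle_zero_right: "shuffle h b G (\<lambda>Ys x. 0) Xs = 0"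
  by (induction Xs arbitrary: b G) auto

text \<open>Insertion evaluates \<open>\<phi>\<close> only on lists that still contain the pair that
  was hit, never on \<open>[]\<close>.\<close>

lemma insert_into_eq_0: "(\<And>Ys. Ys \<noteq> [] \<Longrightarrow> \<phi> Ys = 0) \<Longrightarrow> insert_into b G \<phi> Xs = 0"
  by (induction Xs arbitrary: b G) (auto simp: deriv_slot_def insert_into_zero_right)

lemmas insert_into_linear =
  insert_into_add_left insert_into_uminus_left insert_into_diff_left insert_into_zero_left
  insert_into_add_right insert_into_uminus_right insert_into_diff_right insert_into_zero_right

lemmas shuffle_linear =
  shuffle_add_left shuffle_uminus_left shuffle_diff_left shuffle_zero_left
  shuffle_add_right shuffle_uminus_right shuffle_diff_right shuffle_zero_right

text \<open>With the flag set, the last entry always reaches \<open>G\<close>, so \<open>G\<close>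
  is never evaluated at \<open>[]\<close>. A \<open>G\<close> supported at \<open>[]\<close> arises
  when the boundary term of one shuffle sits inside another.\<close>

lemma half_shuffle_eq_0:
  assumes "value_additive \<phi>" and "\<And>Ys. Ys \<noteq> [] \<Longrightarrow> G Ys = 0"
  shows "shuffle True b G \<phi> Xs = 0"
  using assms
proof (induction Xs arbitrary: b G \<phi>)
  case (Cons X Xs)
  have "shuffle True b G (\<lambda>Ys. \<phi> (X # Ys)) Xs = 0" for b
    using Cons by (simp add: value_additive_Cons)
  moreover have "shuffle True b (\<lambda>Ys. G (X # Ys)) \<phi> Xs = 0" for b
    using shuffle_zero_left[of \<phi> True b Xs] Cons.prems by simp
  ultimately show ?case using Cons.prems by (simp add: value_additiveD)
qed simp

section \<open>Associativity and Leibniz rule for the recursive operators\<close>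

text \<open>Both sides sum over all distributions of \<open>Xs\<close> to R, Q and P, with the sign
  of listing the arguments in the order R, Q, P. The first entry has three possible owners; they
  give the three instances of the induction hypothesis.\<close>

lemma shuffle_assoc:
  fixes P :: "'x list \<Rightarrow> 'b::ab_group_add \<Rightarrow> 'a::ab_group_add"
  assumes "value_additive P"
  shows "shuffle h c R (\<lambda>Ys z. shuffle False b (\<lambda>Zs. Q Zs z) P Ys) Xs
    = shuffle h (b \<noteq> c) (\<lambda>Ys. shuffle h c R Q Ys) P Xs"
  using assms
proof (induction Xs arbitrary: b c P Q R)
  case (Cons X Xs)
  note IH = Cons.IH[OF Cons.prems, where c = "\<not> c" and R = "\<lambda>Ys. R (X # Ys)" and b = b and Q = Q]
    Cons.IH[OF Cons.prems, where c = c and R = R and b = "\<not> b" and Q = "\<lambda>Ys. Q (X # Ys)"]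
    Cons.IH[OF value_additive_Cons[OF Cons.prems, where X = X], where c = c and R = R and b = b and Q = Q]
  \<comment> \<open>Expanding the inner shuffle at \<open>X # Ys\<close> leaves its boundary term, a
    function supported at \<open>Ys = []\<close>; the outer shuffle with the flag set kills
    it.\<close>
  have "shuffle True d (\<lambda>Ys. if Ys = [] then z else 0) P Xs = 0" for d z
    by (rule half_shuffle_eq_0) (use Cons.prems in auto)
  then show ?case
    using IH Cons.prems value_additive_Cons[OF Cons.prems]
    by (cases h; cases b; cases c; cases "Xs = []") (simp_all add: shuffle_linear value_additiveD[OF Cons.prems]
        diff_conv_add_uminus ac_simps del: add_uminus_conv_diff uminus_add_conv_diff)
qed simp

lemma parity_of_Cons: "parity_of b G \<Longrightarrow> parity_of (\<not> b) (\<lambda>Ys. G (X # Ys))"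
  by (auto simp: parity_of_def)

text \<open>Leibniz rule: R hits a slot of Q or a slot of P, and in the second case it is moved past
  Q. Since R absorbs only entries in front of the slot it hits, the last entry keeps its owner and
  the flag \<open>h\<close> is respected.\<close>

lemma insert_into_shuffle:
  fixes P :: "('e::ab_group_add \<times> 'e) list \<Rightarrow> 'b::ab_group_add \<Rightarrow> 'a::ab_group_add"
  assumes "parity_of c R" and "slot_additive Q" and "\<And>x. slot_additive (\<lambda>Ys. P Ys x)"
    and "value_additive P"
  shows "insert_into c R (\<lambda>Ys. shuffle h b Q P Ys) Xs
    = shuffle h (b \<noteq> c) (\<lambda>Ys. insert_into c R Q Ys) P Xs
      + signed (b \<and> c) (shuffle h b Q (\<lambda>Ys x. insert_into c R (\<lambda>Zs. P Zs x) Ys) Xs)"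
  using assms
proof (induction Xs arbitrary: b c P Q R)
  case Nil
  then show ?case by (simp add: value_additiveD)
next
  case (Cons X Xs)
  note c = parity_of_Cons[OF Cons.prems(1), of X] slot_additive_Cons[OF Cons.prems(2), of X]
    slot_additive_Cons[OF Cons.prems(3), where X = X]
    value_additive_Cons[OF Cons.prems(4), where X = X]
  \<comment> \<open>For odd R, the terms in which \<open>R []\<close> hits the first pair put a 0
    into that pair. The equations for \<open>P\<close> with a 0 in front, given below in curried
    form, remove them.\<close>
  have "R [] = 0" if c using Cons.prems(1) that by (simp add: parity_of_def)
  moreover note value_additiveD[OF Cons.prems(4)]
  moreover have "insert_into d R (\<lambda>Ys. if Ys = [] then z else 0) Xs = 0"  for d R and z :: 'a
    by (rule insert_into_eq_0) simp
  moreover have "P ((0, z) # Ys) = (\<lambda>x. 0)" "P ((z, 0) # Ys) = (\<lambda>x. 0)" for z Ys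
    using slot_additiveD(3,4)[OF Cons.prems(3)] by fast+
  moreover note Cons.IH[OF c(1) Cons.prems(2-4), of b] Cons.IH[OF Cons.prems(1) c(2) Cons.prems(3,4), of "\<not> b"]
    Cons.IH[OF Cons.prems(1,2) c(3,4), of b]
  ultimately show ?case
    using Cons.prems c(2-)
    by (cases h; cases b; cases c)
      (simp_all add: insert_into_linear shuffle_linear deriv_slot_def slot_additiveD diff_conv_add_uminus ac_simps
        del: add_uminus_conv_diff uminus_add_conv_diff)
qed

text \<open>The second component of a composition, \<open>b\<close> being the parity of Q. It has
  its own name because only second components are inserted into slots; the first component of Q
  occurs merely as a value fed to the second component of P.\<close>

definition cochain_comp_snd :: "bool \<Rightarrow> (('e \<times> 'e) list \<Rightarrow> 'e \<Rightarrow> 'a) \<Rightarrow> (('e \<times> 'e) list \<Rightarrow> 'e \<Rightarrow> 'e)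
    \<Rightarrow> ('e \<times> 'e) list \<Rightarrow> 'e \<Rightarrow> 'a::ab_group_add"
  where "cochain_comp_snd b P Q Xs x = shuffle False b (\<lambda>Ys. Q Ys x) P Xs + insert_into b Q (\<lambda>Ys. P Ys x) Xs"

text \<open>
  The terms in which \<open>Q\<close> and \<open>R\<close> hit different slots, or different factors of the same \<open>x \<and> y\<close>,
  cancel; what is left is the insertion of one into the other.
\<close>

lemma insert_into_commutator:
  assumes "parity_of b Q" and "parity_of c R" and "slot_additive \<phi>"
    and "\<And>x. slot_additive (\<lambda>Ys. Q Ys x)" and "\<And>x. slot_additive (\<lambda>Ys. R Ys x)"
  shows "insert_into c R (\<lambda>Ys. insert_into b Q \<phi> Ys) Xs
    = signed (b \<and> c) (insert_into b Q (\<lambda>Ys. insert_into c R \<phi> Ys) Xs)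
      + insert_into (b \<noteq> c) (cochain_comp_snd c Q R) \<phi> Xs
      - signed (b \<and> c) (insert_into (b \<noteq> c) (cochain_comp_snd b R Q) \<phi> Xs)"
  using assms
proof (induction Xs arbitrary: b c Q R \<phi>)
  case (Cons X Xs)
  note c = parity_of_Cons[OF Cons.prems(1), of X] parity_of_Cons[OF Cons.prems(2), of X]
    slot_additive_Cons[OF Cons.prems(3)] slot_additive_Cons[OF slot_additive_Cons[OF Cons.prems(3)]]
    slot_additive_Cons[OF Cons.prems(4), where X = X] slot_additive_Cons[OF Cons.prems(5), where X = X]
  have "R [] = 0" if c using Cons.prems(2) that by (simp add: parity_of_def)
  moreover have "Q [] = 0" if b using Cons.prems(1) that by (simp add: parity_of_def)
  moreover have "F ((0, z) # Ys) = (\<lambda>x. 0)" "F ((z, 0) # Ys) = (\<lambda>x. 0)"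
    if "\<And>x. slot_additive (\<lambda>Ys. F Ys x)" for F :: "('a \<times> 'a) list \<Rightarrow> 'a \<Rightarrow> 'a" and z Ys
    using slot_additiveD(3,4)[OF that] by fast+
  note this[of Q, OF Cons.prems(4)] this[of R, OF Cons.prems(5)]
  moreover note Cons.IH[OF c(1) Cons.prems(2,3) c(5) Cons.prems(5)] Cons.IH[OF Cons.prems(1) c(2) Cons.prems(3,4) c(6)]
    Cons.IH[OF Cons.prems(1,2) c(3)[of X] Cons.prems(4,5)]
  ultimately show ?case
    using Cons.prems(3-5) c(3,4)
    by (cases b; cases c)
      (simp_all add: insert_into_linear shuffle_linear deriv_slot_def slot_additiveD cochain_comp_snd_def[abs_def] diff_conv_add_uminus ac_simps
        del: add_uminus_conv_diff uminus_add_conv_diff)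
qed simp

section \<open>The composition as a graded right pre-Lie product\<close>

text \<open>No factor (-1)^(pq) appears: \<open>shuffle\<close> charges an argument of P for every
  argument of Q behind it, which is the sign of listing the arguments of Q first, and exchanging the
  two blocks of the usual formula absorbs the factor.\<close>

definition cochain_comp :: "bool \<Rightarrow> ('e, 'e) cochain \<Rightarrow> ('e, 'e) cochain \<Rightarrow> ('e::ab_group_add, 'e) cochain"
  where "cochain_comp b P Q =
    (\<lambda>Xs. shuffle True b (fst Q) (snd P) Xs + insert_into b (snd Q) (fst P) Xs,
     cochain_comp_snd b (snd P) (snd Q))"

definition additive_cochain :: "bool \<Rightarrow> ('e::ab_group_add, 'e) cochain \<Rightarrow> bool"
  where "additive_cochain b P \<longleftrightarrow> parity_of b (snd P) \<and> slot_additive (fst P) \<and>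
    (\<forall>x. slot_additive (\<lambda>Ys. snd P Ys x)) \<and> value_additive (snd P)"

lemmas cochain_comp_simps = cochain_comp_def cochain_comp_snd_def fun_eq_iff plus_fun_def fun_Compl_def
  insert_into_linear shuffle_linear

lemma cochain_comp_add_left: "cochain_comp b (P + Q) R = cochain_comp b P R + cochain_comp b Q R"
  by (auto simp: cochain_comp_simps)

lemma cochain_comp_uminus_left: "cochain_comp b (- P) R = - cochain_comp b P R"
  by (auto simp: cochain_comp_simps)

lemma cochain_comp_diff_left: "cochain_comp b (P - Q) R = cochain_comp b P R - cochain_comp b Q R"
  using cochain_comp_add_left[of b P "- Q" R] by (simp add: cochain_comp_uminus_left)

lemma cochain_comp_add_right:
  assumes "additive_cochain c P"
  shows "cochain_comp b P (Q + R) = cochain_comp b P Q + cochain_comp b P R"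
  using assms
  by (auto simp: cochain_comp_simps additive_cochain_def)

lemma cochain_comp_uminus_right:
  assumes "additive_cochain c P"
  shows "cochain_comp b P (- Q) = - cochain_comp b P Q"
  using assms
  by (auto simp: cochain_comp_simps additive_cochain_def)

lemma cochain_comp_diff_right:
  assumes "additive_cochain c P"
  shows "cochain_comp b P (Q - R) = cochain_comp b P Q - cochain_comp b P R"
  using cochain_comp_add_right[OF assms, of b Q "- R"] cochain_comp_uminus_right[OF assms, of b R] by simp

text \<open>In (P o Q) o R the terms feeding R into Q, by shuffle or by insertion, cancel against P
  o (Q o R); this is \<open>shuffle_assoc\<close> and \<open>insert_into_shuffle\<close>. What
  remains has Q and R acting on P independently, and this is symmetric in Q and R up to sign; for
  two insertions the symmetry is \<open>insert_into_commutator\<close>.\<close>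

lemma cochain_comp_pre_Lie:
  assumes "additive_cochain a P" and "additive_cochain b Q" and "additive_cochain c R"
  shows "cochain_comp c (cochain_comp b P Q) R - cochain_comp (b \<noteq> c) P (cochain_comp c Q R)
    = signed (b \<and> c) (cochain_comp b (cochain_comp c P R) Q - cochain_comp (b \<noteq> c) P (cochain_comp b R Q))"
proof -
  have Q: "parity_of b (snd Q)" "slot_additive (fst Q)" "slot_additive (\<lambda>Ys. snd Q Ys x)" for x
    using assms(2) by (auto simp: additive_cochain_def)
  have R: "parity_of c (snd R)" "slot_additive (fst R)" "slot_additive (\<lambda>Ys. snd R Ys x)" for x
    using assms(3) by (auto simp: additive_cochain_def)
  have P: "slot_additive (fst P)" "slot_additive (\<lambda>Ys. snd P Ys x)" "value_additive (snd P)" for x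
    using assms(1) by (auto simp: additive_cochain_def)
  note rules =
    shuffle_assoc[OF P(3), where c = c and b = b and Q = "snd Q"]
    shuffle_assoc[OF P(3), where c = b and b = c and Q = "snd R"]
    insert_into_shuffle[OF R(1) Q(2) P(2,3), where b = b and h = True]
    insert_into_shuffle[OF Q(1) R(2) P(2,3), where b = c and h = True]
    insert_into_shuffle[OF R(1) Q(3) P(2,3), where b = b and h = False]
    insert_into_shuffle[OF Q(1) R(3) P(2,3), where b = c and h = False]
    insert_into_commutator[OF Q(1) R(1) P(1) Q(3) R(3)]
    insert_into_commutator[OF Q(1) R(1) P(2) Q(3) R(3)]
  have "fst (cochain_comp c (cochain_comp b P Q) R) Xs - fst (cochain_comp (b \<noteq> c) P (cochain_comp c Q R)) Xs
    = signed (b \<and> c) (fst (cochain_comp b (cochain_comp c P R) Q) Xs - fst (cochain_comp (b \<noteq> c) P (cochain_comp b R Q)) Xs)" for Xs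
    using rules P
    by (cases b; cases c)
      (simp_all add: cochain_comp_def insert_into_linear shuffle_linear
        cochain_comp_snd_def[abs_def] shuffle_linear diff_conv_add_uminus ac_simps
        del: add_uminus_conv_diff uminus_add_conv_diff)
  moreover have "snd (cochain_comp c (cochain_comp b P Q) R) Xs x - snd (cochain_comp (b \<noteq> c) P (cochain_comp c Q R)) Xs x
    = signed (b \<and> c) (snd (cochain_comp b (cochain_comp c P R) Q) Xs x - snd (cochain_comp (b \<noteq> c) P (cochain_comp b R Q)) Xs x)" for Xs x
    using rules P
    by (cases b; cases c)
      (simp_all add: cochain_comp_def insert_into_linear shuffle_linear
        cochain_comp_snd_def[abs_def]
        diff_conv_add_uminus ac_simps
        del: add_uminus_conv_diff uminus_add_conv_diff)
  ultimately show ?thesis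
    by (auto simp: prod_eq_iff fun_eq_iff signed_def)
qed

section \<open>Sums over shuffles\<close>

text \<open>
  All ways to split a list into two subsequences; a sign arises for each odd entry of the
  second part that precedes an odd entry of the first.
\<close>

primrec split_sum ::
  "('z \<Rightarrow> bool) \<Rightarrow> ('z list \<Rightarrow> 'z list \<Rightarrow> 'a) \<Rightarrow> 'z list \<Rightarrow> 'a::ab_group_add"
  where
    "split_sum par F [] = F [] []"
  | "split_sum par F (z # zs) = split_sum par (\<lambda>S T. F (z # S) T) zs
       + split_sum par (\<lambda>S T. signed (par z \<and> odd (length (filter par S))) (F S (z # T))) zs"

lemma signed_add: "signed b (x + y) = signed b x + signed b y"
  by (simp add: signed_def)

lemma signed_signed: "signed b (signed c x) = signed (b \<noteq> c) x"
  by (simp add: signed_def)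

lemma split_sum_cong:
  "(\<And>S T. set S \<subseteq> set zs \<Longrightarrow> set T \<subseteq> set zs \<Longrightarrow> length S + length T = length zs \<Longrightarrow> F S T = G S T)
   \<Longrightarrow> split_sum par F zs = split_sum par G zs"
proof (induction zs arbitrary: F G)
  case (Cons z zs)
  have "split_sum par (\<lambda>S T. F (z # S) T) zs = split_sum par (\<lambda>S T. G (z # S) T) zs"
    by (rule Cons.IH, rule Cons.prems) auto
  moreover have "split_sum par (\<lambda>S T. signed (par z \<and> odd (length (filter par S))) (F S (z # T))) zs
    = split_sum par (\<lambda>S T. signed (par z \<and> odd (length (filter par S))) (G S (z # T))) zs"
    by (rule Cons.IH, rule arg_cong[where f = "signed _"], rule Cons.prems) auto
  ultimately show ?case by simp
qed auto

lemma split_sum_signed: "split_sum par (\<lambda>S T. signed b (F S T)) zs = signed b (split_sum par F zs)"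
proof (induction zs arbitrary: F)
  case (Cons z zs)
  have c: "signed c (signed b x) = signed b (signed c x)" for c and x :: "'c::ab_group_add"
    by (simp add: signed_def)
  show ?case by (simp add: c Cons.IH signed_add)
qed simp

lemma split_sum_add:
  "split_sum par (\<lambda>S T. F S T + G S T) zs = split_sum par F zs + split_sum par G zs"
  by (induction zs arbitrary: F G) (simp_all add: signed_add)

lemma split_sum_0: "split_sum par (\<lambda>S T. 0) zs = 0"
  by (induction zs) simp_all

text \<open>For two odd entries in different parts, exactly one of their two orders is charged.
  Exchanging the parts thus flips the sign once per such pair.\<close>

lemma split_sum_swap:
  "split_sum par (\<lambda>S T. signed (odd (length (filter par S)) \<and> odd (length (filter par T))) (F T S)) zs
    = split_sum par F zs"
proof (induction zs arbitrary: F)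
  case (Cons z zs)
  have "split_sum par (\<lambda>S T. signed (odd (length (filter par (z # S))) \<and> odd (length (filter par T))) (F T (z # S))) zs
    = split_sum par (\<lambda>S T. signed (par z \<and> odd (length (filter par S))) (F S (z # T))) zs"
    unfolding Cons.IH[symmetric, of "\<lambda>S T. signed (par z \<and> odd (length (filter par S))) (F S (z # T))"]
    by (rule split_sum_cong) (auto simp: signed_def)
  moreover have "split_sum par (\<lambda>S T. signed (par z \<and> odd (length (filter par S)))
        (signed (odd (length (filter par S)) \<and> odd (length (filter par (z # T)))) (F (z # T) S))) zs
    = split_sum par (\<lambda>S T. F (z # S) T) zs"
    unfolding Cons.IH[symmetric, of "\<lambda>S T. F (z # S) T"]
    by (rule split_sum_cong) (auto simp: signed_def)
  ultimately show ?case by (simp add: add.commute)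
qed simp

section \<open>Shuffles as subsets of positions\<close>

lemma nths_conv_map: "nths xs A = map ((!) xs) (filter (\<lambda>k. k \<in> A) [0..<length xs])"
proof -
  have "nths [0..<n] A = filter (\<lambda>k. k \<in> A) [0..<n]" for n
    by (induction n) (simp_all add: nths_append)
  then show ?thesis using nths_map[of "(!) xs" "[0..<length xs]" A] by (simp add: map_nth)
qed

text \<open>A shuffle increases on each block, and a sorted list without repetitions is determined
  by its set.\<close>

lemma map_shuffle:
  assumes "\<sigma> \<in> shuffle_perms i j"
  shows "map \<sigma> [0..<i] = filter (\<lambda>k. k \<in> \<sigma> ` {..<i}) [0..<i + j]"
    and "map \<sigma> [i..<i + j] = filter (\<lambda>k. k \<in> - \<sigma> ` {..<i}) [0..<i + j]"
proof -
  have p: "\<sigma> permutes {..<i + j}" and m: "strict_mono_on {..<i} \<sigma>" "strict_mono_on {i..<i + j} \<sigma>"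
    using assms by (auto simp: shuffle_perms_def)
  have inj: "inj \<sigma>" using p by (rule permutes_inj)
  have im: "\<sigma> ` {..<i + j} = {..<i + j}" using p by (rule permutes_image)
  have sorted: "sorted (map \<sigma> [a..<b])" if "strict_mono_on {a..<b} \<sigma>" for a b
    unfolding sorted_wrt_map
    by (rule sorted_wrt_mono_rel[OF _ sorted_wrt_upt]) (use that in \<open>auto simp: strict_mono_on_def less_imp_le\<close>)
  have dist: "distinct (map \<sigma> [a..<b])" for a b
    using inj by (auto simp: distinct_map intro: inj_on_subset)
  have A: "\<sigma> ` {..<i} \<subseteq> {..<i + j}" using im by auto
  have B: "\<sigma> ` {i..<i + j} = {..<i + j} - \<sigma> ` {..<i}"
    by (subst im[symmetric], subst image_set_diff[OF inj, symmetric]) (rule arg_cong[where f = "(`) \<sigma>"], auto)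
  show "map \<sigma> [0..<i] = filter (\<lambda>k. k \<in> \<sigma> ` {..<i}) [0..<i + j]"
    by (rule sorted_distinct_set_unique)
      (use sorted[of 0 i] m A dist in \<open>auto simp: lessThan_atLeast0 sorted_wrt_filter\<close>)
  show "map \<sigma> [i..<i + j] = filter (\<lambda>k. k \<in> - \<sigma> ` {..<i}) [0..<i + j]"
    by (rule sorted_distinct_set_unique)
      (use sorted[of i "i + j"] m B dist in \<open>auto simp: sorted_wrt_filter\<close>)
qed

lemma pick_shuffle:
  assumes "\<sigma> \<in> shuffle_perms i j" and "length xs = i + j"
  shows "pick \<sigma> 0 i xs = nths xs (\<sigma> ` {..<i})" and "pick \<sigma> i (i + j) xs = nths xs (- \<sigma> ` {..<i})"
  unfolding pick_def nths_conv_map assms(2) map_shuffle[OF assms(1), symmetric] by simp_all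

lemma bij_betw_shuffle_perms:
  "bij_betw (\<lambda>\<sigma>. \<sigma> ` {..<i}) (shuffle_perms i j) {A. A \<subseteq> {..<i + j} \<and> card A = i}"
proof (rule bij_betw_imageI)
  show "inj_on (\<lambda>\<sigma>. \<sigma> ` {..<i}) (shuffle_perms i j)"
  proof (rule inj_onI)
    fix \<sigma> \<tau> assume s: "\<sigma> \<in> shuffle_perms i j" and t: "\<tau> \<in> shuffle_perms i j" and e: "\<sigma> ` {..<i} = \<tau> ` {..<i}"
    have "map \<sigma> [0..<i] = map \<tau> [0..<i]" "map \<sigma> [i..<i + j] = map \<tau> [i..<i + j]"
      unfolding map_shuffle[OF s] map_shuffle[OF t] e by (rule refl)+
    then have "\<sigma> m = \<tau> m" if "m < i + j" for m
      using that by (cases "m < i") (auto simp: map_eq_conv)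
    moreover have "\<sigma> m = \<tau> m" if "\<not> m < i + j" for m
      using s t that by (simp add: shuffle_perms_def permutes_def)
    ultimately show "\<sigma> = \<tau>" by blast
  qed
  show "(\<lambda>\<sigma>. \<sigma> ` {..<i}) ` shuffle_perms i j = {A. A \<subseteq> {..<i + j} \<and> card A = i}"
  proof (intro equalityI subsetI)
    fix A assume "A \<in> (\<lambda>\<sigma>. \<sigma> ` {..<i}) ` shuffle_perms i j"
    then obtain \<sigma> where s: "\<sigma> permutes {..<i + j}" and A: "A = \<sigma> ` {..<i}"
      by (auto simp: shuffle_perms_def)
    have "A \<subseteq> {..<i + j}" using permutes_image[OF s] A by auto
    moreover have "card A = i"
      unfolding A using card_image[OF inj_on_subset[OF permutes_inj[OF s] subset_UNIV]] by simp
    ultimately show "A \<in> {A. A \<subseteq> {..<i + j} \<and> card A = i}" by simp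
  next
    fix A assume "A \<in> {A. A \<subseteq> {..<i + j} \<and> card A = i}"
    then have A: "A \<subseteq> {..<i + j}" "card A = i" by auto
    define xs where "xs = filter (\<lambda>k. k \<in> A) [0..<i + j]"
    define ys where "ys = filter (\<lambda>k. k \<notin> A) [0..<i + j]"
    have set: "set xs = A" "set ys = {..<i + j} - A"
      using A by (auto simp: xs_def ys_def)
    have dist: "distinct xs" "distinct ys" by (simp_all add: xs_def ys_def)
    have sorted: "sorted_wrt (<) xs" "sorted_wrt (<) ys" by (simp_all add: xs_def ys_def sorted_wrt_filter)
    have len: "length xs = i" "length ys = j"
      using distinct_card[OF dist(1)] distinct_card[OF dist(2)] set A
      by (simp_all add: card_Diff_subset finite_subset[OF A(1)])
    \<comment> \<open>The preimage of \<open>A\<close> lists \<open>A\<close> increasingly, then its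
      complement, and fixes everything from \<open>i + j\<close> on, as \<open>permutes\<close>
      requires.\<close>
    define \<sigma> where "\<sigma> = (\<lambda>m. if m < i + j then (xs @ ys) ! m else m)"
    have "bij_betw (\<lambda>m. (xs @ ys) ! m) {..<i + j} {..<i + j}"
      by (rule bij_betw_nth) (use dist set len A in auto)
    then have "bij_betw \<sigma> {..<i + j} {..<i + j}"
      by (rule bij_betw_cong[THEN iffD1, rotated]) (simp add: \<sigma>_def)
    then have "\<sigma> permutes {..<i + j}"
      by (rule bij_imp_permutes) (simp add: \<sigma>_def)
    moreover have "strict_mono_on {..<i} \<sigma>" "strict_mono_on {i..<i + j} \<sigma>"
      using sorted len by (auto simp: strict_mono_on_def \<sigma>_def nth_append sorted_wrt_iff_nth_less)
    ultimately have "\<sigma> \<in> shuffle_perms i j" by (simp add: shuffle_perms_def)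
    moreover have "\<sigma> ` {..<i} = A"
    proof -
      have "\<sigma> ` {..<i} = (!) xs ` {..<i}" by (rule image_cong) (simp_all add: \<sigma>_def nth_append len)
      also have "\<dots> = set xs" using len by (auto simp: set_conv_nth)
      finally show ?thesis by (simp add: set)
    qed
    ultimately show "A \<in> (\<lambda>\<sigma>. \<sigma> ` {..<i}) ` shuffle_perms i j" by blast
  qed
qed

text \<open>The index set consists of the inversions of the shuffle whose first block has image
  \<open>A\<close>: a position outside \<open>A\<close> in front of one inside.\<close>

definition subset_sign :: "('z \<Rightarrow> bool) \<Rightarrow> 'z list \<Rightarrow> nat set \<Rightarrow> int"
  where "subset_sign par zs A = (\<Prod>(u, v) \<in> {(u, v). u < length zs \<and> u \<in> A \<and> v < u \<and> v \<notin> A}.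
    if par (zs ! u) \<and> par (zs ! v) then - 1 else 1)"

text \<open>An inversion (a, b) of a shuffle has \<open>a\<close> in the first and \<open>b\<close>
  in the second block, and applying \<sigma> to both carries the inversions bijectively to the pairs
  of \<open>subset_sign\<close>.\<close>

lemma koszul_sign_shuffle:
  assumes "\<sigma> \<in> shuffle_perms i j" and "length zs = i + j"
  shows "koszul_sign (map d zs) \<sigma> = subset_sign (\<lambda>z. odd (d z)) zs (\<sigma> ` {..<i})"
proof -
  have p: "\<sigma> permutes {..<i + j}" and m: "strict_mono_on {..<i} \<sigma>" "strict_mono_on {i..<i + j} \<sigma>"
    using assms by (auto simp: shuffle_perms_def)
  have inj: "inj \<sigma>" using p by (rule permutes_inj)
  have lt: "\<sigma> a < i + j \<longleftrightarrow> a < i + j" for a using permutes_in_image[OF p, of a] by simp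
  have ab: "a < i \<and> i \<le> b" if "a < b" "b < i + j" "\<sigma> b < \<sigma> a" for a b
  proof -
    have "\<not> b < i" using strict_mono_onD[OF m(1), of a b] that by auto
    moreover have "\<not> i \<le> a" using strict_mono_onD[OF m(2), of a b] that by auto
    ultimately show ?thesis by simp
  qed
  have "{(u, v). u < length zs \<and> u \<in> \<sigma> ` {..<i} \<and> v < u \<and> v \<notin> \<sigma> ` {..<i}}
    = map_prod \<sigma> \<sigma> ` {(a, b). a < b \<and> b < length (map d zs) \<and> \<sigma> b < \<sigma> a}" (is "?R = _ ` ?L")
  proof (intro equalityI subsetI)
    fix z assume z: "z \<in> ?R"
    then obtain a v where z': "z = (\<sigma> a, v)" "a < i" "v < \<sigma> a" "\<sigma> a < i + j" "v \<notin> \<sigma> ` {..<i}"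
      using assms(2) by (auto simp: )
    obtain b where b: "v = \<sigma> b" using permutes_surj[OF p] by (metis surj_def)
    have "\<not> b < i" using z' b by auto
    moreover have "b < i + j" using z' b lt[of b] by simp
    ultimately show "z \<in> map_prod \<sigma> \<sigma> ` ?L"
      using z' b assms(2) by (auto intro!: image_eqI[of _ _ "(a, b)"])
  next
    fix z assume "z \<in> map_prod \<sigma> \<sigma> ` ?L"
    then obtain a b where z: "z = (\<sigma> a, \<sigma> b)" "a < b" "b < i + j" "\<sigma> b < \<sigma> a" using assms(2) by auto
    with ab[of a b] show "z \<in> ?R" using lt[of a] assms(2) inj by (auto simp: inj_image_mem_iff)
  qed
  moreover have "inj_on (map_prod \<sigma> \<sigma>) X" for X
    using inj by (auto simp: inj_on_def dest: injD)
  ultimately have "subset_sign (\<lambda>z. odd (d z)) zs (\<sigma> ` {..<i})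
    = (\<Prod>x \<in> {(a, b). a < b \<and> b < length (map d zs) \<and> \<sigma> b < \<sigma> a}.
        case map_prod \<sigma> \<sigma> x of (u, v) \<Rightarrow> if odd (d (zs ! u)) \<and> odd (d (zs ! v)) then - 1 else 1)"
    unfolding subset_sign_def by (simp add: prod.reindex o_def)
  also have "\<dots> = koszul_sign (map d zs) \<sigma>"
    unfolding koszul_sign_def using ab lt assms(2) by (intro prod.cong) auto
  finally show ?thesis by simp
qed

lemma prod_signs: "finite I \<Longrightarrow> (\<Prod>(u, v)\<in>I. if P u v then - 1 else 1) \<in> {1, - 1 :: int}"
  by (induction rule: finite_induct) (auto split: if_splits)

lemma koszul_sign_values: "koszul_sign ds \<sigma> \<in> {1, - 1}"
proof -
  have "finite {(i, j). i < j \<and> j < length ds \<and> \<sigma> j < \<sigma> i}"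
    by (rule finite_subset[of _ "{..<length ds} \<times> {..<length ds}"]) auto
  then show ?thesis
    unfolding koszul_sign_def by (rule prod_signs)
qed

lemma finite_subset_pairs: "finite {(u, v). u < n \<and> u \<in> A \<and> v < u \<and> (v::nat) \<notin> A}"
  by (rule finite_subset[of _ "{..<n} \<times> {..<n}"]) auto

lemma subset_sign_values: "subset_sign par zs A \<in> {1, - 1}"
  unfolding subset_sign_def by (intro prod_signs finite_subset_pairs)

text \<open>Position 0 precedes all others: inside the subset it creates no inversion, outside it
  forms one with each element of the subset. These are the two cases in the recursion of
  \<open>split_sum\<close>.\<close>

lemma subset_sign_Cons:
  "subset_sign par (z # zs) (insert 0 (Suc ` A)) = subset_sign par zs A"
  "subset_sign par (z # zs) (Suc ` A) =
     (if par z \<and> odd (length (filter par (nths zs A))) then - 1 else 1) * subset_sign par zs A"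
proof -
  let ?P = "\<lambda>n A. {(u, v). u < n \<and> u \<in> A \<and> v < u \<and> (v::nat) \<notin> A}"
  let ?f = "\<lambda>zs (u, v). if par (zs ! u) \<and> par (zs ! v) then - 1 else (1::int)"
  have P1: "?P (Suc n) (insert 0 (Suc ` A)) = map_prod Suc Suc ` ?P n A" for n
    by (auto simp: image_iff Bex_def less_Suc_eq_0_disj split: prod.splits) blast
  have P2: "?P (Suc n) (Suc ` A) = map_prod Suc Suc ` ?P n A \<union> (\<lambda>u. (Suc u, 0)) ` {u. u < n \<and> u \<in> A}" for n
    by (auto simp: image_iff Bex_def less_Suc_eq_0_disj split: prod.splits) blast
  have pr: "prod (?f (z # zs)) (map_prod Suc Suc ` ?P n A) = prod (?f zs) (?P n A)" for n
    by (subst prod.reindex) (auto simp: inj_on_def intro!: prod.cong)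
  show "subset_sign par (z # zs) (insert 0 (Suc ` A)) = subset_sign par zs A"
    unfolding subset_sign_def list.size(4) add_0_right add_Suc_right One_nat_def P1 pr ..
  have "subset_sign par (z # zs) (Suc ` A)
    = prod (?f (z # zs)) (map_prod Suc Suc ` ?P (length zs) A)
      * prod (?f (z # zs)) ((\<lambda>u. (Suc u, 0)) ` {u. u < length zs \<and> u \<in> A})"
    unfolding subset_sign_def list.size(4) add_0_right add_Suc_right One_nat_def P2
    by (rule prod.union_disjoint) (use finite_subset_pairs[of "length zs" A] in auto)
  also have "prod (?f (z # zs)) ((\<lambda>u. (Suc u, 0)) ` {u. u < length zs \<and> u \<in> A})
    = (\<Prod>u \<in> {u. u < length zs \<and> u \<in> A}. if par (zs ! u) \<and> par z then - 1 else 1)"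
    by (subst prod.reindex) (auto simp: inj_on_def)
  also have "\<dots> = (\<Prod>u \<in> {u. u < length zs \<and> u \<in> A \<and> par (zs ! u)}. if par z then - 1 else 1)"
    by (rule prod.mono_neutral_cong_right) auto
  also have "{u. u < length zs \<and> u \<in> A \<and> par (zs ! u)}
    = set (filter (\<lambda>u. par (zs ! u)) (filter (\<lambda>k. k \<in> A) [0..<length zs]))" by auto
  also have "(\<Prod>u \<in> set (filter (\<lambda>u. par (zs ! u)) (filter (\<lambda>k. k \<in> A) [0..<length zs])).
      if par z then - 1 else (1::int)) = (if par z \<and> odd (length (filter par (nths zs A))) then - 1 else 1)"
    by (simp add: nths_conv_map filter_map o_def distinct_card del: filter_filter set_filter)
  finally show "subset_sign par (z # zs) (Suc ` A) =
     (if par z \<and> odd (length (filter par (nths zs A))) then - 1 else 1) * subset_sign par zs A"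
    unfolding pr by (simp add: subset_sign_def)
qed

lemma sum_subsets_split_sum:
  "(\<Sum>A\<in>Pow {..<length zs}. signed (subset_sign par zs A < 0) (F (nths zs A) (nths zs (- A))))
     = split_sum par F zs"
proof (induction zs arbitrary: F)
  case Nil
  then show ?case by (simp add: subset_sign_def)
next
  case (Cons z zs)
  let ?n = "length zs"
  let ?t = "\<lambda>A. signed (subset_sign par (z # zs) A < 0) (F (nths (z # zs) A) (nths (z # zs) (- A)))"
  have P: "Pow {..<Suc ?n} = (\<lambda>A. insert 0 (Suc ` A)) ` Pow {..<?n} \<union> (\<lambda>A. Suc ` A) ` Pow {..<?n}"
    unfolding lessThan_Suc_eq_insert_0 Pow_insert by (auto simp: image_Pow_surj[symmetric])
  have inj: "inj_on (\<lambda>A. Suc ` A) X" "inj_on (\<lambda>A. insert 0 (Suc ` A)) X" for X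
    by (auto simp: inj_on_def)
  have "sum ?t (Pow {..<length (z # zs)})
    = sum ?t ((\<lambda>A. insert 0 (Suc ` A)) ` Pow {..<?n}) + sum ?t ((\<lambda>A. Suc ` A) ` Pow {..<?n})"
    unfolding length_Cons P by (rule sum.union_disjoint) auto
  also have "sum ?t ((\<lambda>A. insert 0 (Suc ` A)) ` Pow {..<?n}) = split_sum par (\<lambda>S T. F (z # S) T) zs"
    unfolding Cons.IH[symmetric] sum.reindex[OF inj(2)] o_def
    by (intro sum.cong refl) (simp add: subset_sign_Cons nths_Cons image_iff flip: Compl_eq)
  also have "sum ?t ((\<lambda>A. Suc ` A) ` Pow {..<?n})
    = split_sum par (\<lambda>S T. signed (par z \<and> odd (length (filter par S))) (F S (z # T))) zs"
    unfolding Cons.IH[symmetric] sum.reindex[OF inj(1)] o_def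
  proof (intro sum.cong refl)
    fix A
    show "?t (Suc ` A) = signed (subset_sign par zs A < 0)
      (signed (par z \<and> odd (length (filter par (nths zs A)))) (F (nths zs A) (z # nths zs (- A))))"
      using subset_sign_values[of par zs A]
      by (auto simp: subset_sign_Cons nths_Cons image_iff signed_def simp flip: Compl_eq)
  qed
  finally show ?case by simp
qed

lemma sum_card_subsets_split_sum:
  "(\<Sum>A | A \<subseteq> {..<length zs} \<and> card A = i. signed (subset_sign par zs A < 0) (F (nths zs A) (nths zs (- A))))
    = split_sum par (\<lambda>S T. if length S = i then F S T else 0) zs"
proof -
  have "length (nths zs A) = card A" if "A \<subseteq> {..<length zs}" for A
    unfolding length_nths using that by (intro arg_cong[where f = card]) auto
  then show ?thesis
    unfolding sum_subsets_split_sum[symmetric] by (intro sum.mono_neutral_cong_left) auto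
qed

text \<open>The degrees \<open>d\<close> are a parameter because two sign rules are needed: constant
  1 for the pairs fed to a cochain, where the Koszul sign is the signature, and the degrees of the
  cochains themselves for the L-infinity relations.\<close>

lemma sum_shuffle_perms:
  assumes "length zs = i + j"
  shows "(\<Sum>\<sigma>\<in>shuffle_perms i j. signed (koszul_sign (map d zs) \<sigma> < 0)
      (F (pick \<sigma> 0 i zs) (pick \<sigma> i (i + j) zs)))
    = split_sum (\<lambda>z. odd (d z)) (\<lambda>S T. if length S = i then F S T else 0) zs"
  unfolding sum_card_subsets_split_sum[symmetric] assms
    sum.reindex_bij_betw[OF bij_betw_shuffle_perms, symmetric]
  by (intro sum.cong refl) (simp add: koszul_sign_shuffle pick_shuffle assms)

text \<open>The second block is increasing, so the largest position is fixed iff it is a value of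
  that block, that is, iff it lies outside the image of the first.\<close>

lemma bij_betw_shuffle_perms_last:
  "bij_betw (\<lambda>\<sigma>. \<sigma> ` {..<i}) {\<sigma> \<in> shuffle_perms i (Suc j). \<sigma> (i + j) = i + j}
    {A. A \<subseteq> {..<i + j} \<and> card A = i}"
proof -
  have iff: "\<sigma> (i + j) = i + j \<longleftrightarrow> i + j \<notin> \<sigma> ` {..<i}" if s: "\<sigma> \<in> shuffle_perms i (Suc j)" for \<sigma>
  proof
    have p: "\<sigma> permutes {..<i + Suc j}" and m: "strict_mono_on {i..<i + Suc j} \<sigma>"
      using s by (auto simp: shuffle_perms_def)
    show "i + j \<notin> \<sigma> ` {..<i}" if "\<sigma> (i + j) = i + j"
    proof
      assume "i + j \<in> \<sigma> ` {..<i}"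
      then obtain a where "a < i" "\<sigma> a = \<sigma> (i + j)" using \<open>\<sigma> (i + j) = i + j\<close> by auto
      with permutes_inj[OF p] show False by (auto dest: injD)
    qed
    show "\<sigma> (i + j) = i + j" if "i + j \<notin> \<sigma> ` {..<i}"
    proof -
      obtain b where b: "b < i + Suc j" "\<sigma> b = i + j"
        using permutes_image[OF p] by (metis add_Suc_right image_iff lessI lessThan_iff)
      with that have "i \<le> b" by (metis image_eqI lessThan_iff not_le)
      have "\<not> b < i + j"
      proof
        assume "b < i + j"
        then have "\<sigma> b < \<sigma> (i + j)" using m \<open>i \<le> b\<close> by (auto simp: strict_mono_on_def)
        moreover have "\<sigma> (i + j) < i + Suc j" using permutes_in_image[OF p, of "i + j"] by simp
        ultimately show False using b by simp
      qed
      with b show ?thesis by (metis add_Suc_right not_less_less_Suc_eq)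
    qed
  qed
  have "(\<lambda>\<sigma>. \<sigma> ` {..<i}) ` {\<sigma> \<in> shuffle_perms i (Suc j). \<sigma> (i + j) = i + j}
    = {A \<in> (\<lambda>\<sigma>. \<sigma> ` {..<i}) ` shuffle_perms i (Suc j). i + j \<notin> A}"
    using iff by auto
  also have "\<dots> = {A. A \<subseteq> {..<i + j} \<and> card A = i}"
    unfolding bij_betw_imp_surj_on[OF bij_betw_shuffle_perms]
    by (auto simp: less_Suc_eq subset_iff)
  finally show ?thesis
    by (intro bij_betw_imageI inj_on_subset[OF bij_betw_imp_inj_on[OF bij_betw_shuffle_perms[of i "Suc j"]]]) auto
qed

lemma sum_shuffle_perms_last:
  assumes "length zs = i + j"
  shows "(\<Sum>\<sigma>\<in>{\<sigma> \<in> shuffle_perms i (Suc j). \<sigma> (i + j) = i + j}.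
      signed (koszul_sign (map d (zs @ [z])) \<sigma> < 0)
        (F (pick \<sigma> 0 i (zs @ [z])) (pick \<sigma> i (Suc (i + j)) (zs @ [z]))))
    = split_sum (\<lambda>z. odd (d z)) (\<lambda>S T. if length S = i then F S (T @ [z]) else 0) zs"
  unfolding sum_card_subsets_split_sum[symmetric] assms
    sum.reindex_bij_betw[OF bij_betw_shuffle_perms_last, symmetric]
proof (intro sum.cong refl)
  fix \<sigma> assume s: "\<sigma> \<in> {\<sigma> \<in> shuffle_perms i (Suc j). \<sigma> (i + j) = i + j}"
  then have A: "\<sigma> ` {..<i} \<subseteq> {..<i + j}"
    using bij_betwE[OF bij_betw_shuffle_perms_last] by blast
  have l: "length (zs @ [z]) = i + Suc j" using assms by simp
  have "subset_sign (\<lambda>z. odd (d z)) (zs @ [z]) (\<sigma> ` {..<i}) = subset_sign (\<lambda>z. odd (d z)) zs (\<sigma> ` {..<i})"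
    unfolding subset_sign_def using A assms by (intro prod.cong) (auto simp: nth_append)
  moreover have "nths (zs @ [z]) (\<sigma> ` {..<i}) = nths zs (\<sigma> ` {..<i})"
    "nths (zs @ [z]) (- \<sigma> ` {..<i}) = nths zs (- \<sigma> ` {..<i}) @ [z]"
    using A assms by (auto simp: nths_append)
  ultimately show "signed (koszul_sign (map d (zs @ [z])) \<sigma> < 0)
      (F (pick \<sigma> 0 i (zs @ [z])) (pick \<sigma> i (Suc (i + j)) (zs @ [z])))
    = signed (subset_sign (\<lambda>z. odd (d z)) zs (\<sigma> ` {..<i}) < 0)
      (F (nths zs (\<sigma> ` {..<i})) (nths zs (- \<sigma> ` {..<i}) @ [z]))"
    using koszul_sign_shuffle[OF _ l, of \<sigma> d] pick_shuffle[OF _ l, of \<sigma>] s by simp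
qed

section \<open>Adjacent transpositions and the Koszul sign in odd degrees\<close>

lemma permutes_adjacent_induct [consumes 1, case_names id swap]:
  assumes "\<sigma> permutes {..<n}" and "P id"
    and "\<And>\<sigma> i. \<sigma> permutes {..<n} \<Longrightarrow> Suc i < n \<Longrightarrow> P \<sigma> \<Longrightarrow> P (\<sigma> \<circ> transpose i (Suc i))"
  shows "P \<sigma>"
proof -
  have tr: "P (\<sigma> \<circ> transpose a (Suc (a + k)))" if "\<sigma> permutes {..<n}" "P \<sigma>" "Suc (a + k) < n" for \<sigma> a k
    using that
  proof (induction k arbitrary: \<sigma>)
    case 0
    then show ?case using assms(3)[of \<sigma> a] by (simp only: add_0_right)
  next
    case (Suc k)
    let ?t = "transpose (Suc (a + k)) (Suc (Suc (a + k)))"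
    have t: "?t permutes {..<n}" by (rule permutes_swap_id) (use Suc.prems in auto)
    have 1: "P (\<sigma> \<circ> ?t)" using assms(3)[OF Suc.prems(1) _ Suc.prems(2)] Suc.prems(3) by simp
    have p1: "(\<sigma> \<circ> ?t) permutes {..<n}" using t Suc.prems(1) by (rule permutes_compose)
    have 2: "P (\<sigma> \<circ> ?t \<circ> transpose a (Suc (a + k)))" by (rule Suc.IH[OF p1 1]) (use Suc.prems in simp)
    have "transpose a (Suc (a + k)) permutes {..<n}"
      by (rule permutes_swap_id) (use Suc.prems in auto)
    with p1 have p2: "(\<sigma> \<circ> ?t \<circ> transpose a (Suc (a + k))) permutes {..<n}" by (rule permutes_compose[rotated])
    have "P (\<sigma> \<circ> ?t \<circ> transpose a (Suc (a + k)) \<circ> ?t)"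
      using assms(3)[OF p2 _ 2] Suc.prems(3) by simp
    \<comment> \<open>The transposition at distance k + 2 is the one at distance k + 1 conjugated by
      an adjacent one.\<close>
    moreover have "\<sigma> \<circ> ?t \<circ> transpose a (Suc (a + k)) \<circ> ?t = \<sigma> \<circ> transpose a (Suc (a + Suc k))"
      by (auto simp: fun_eq_iff transpose_def)
    ultimately show ?case by (simp only:)
  qed
  have tr': "P (\<sigma> \<circ> transpose a b)" if "\<sigma> permutes {..<n}" "P \<sigma>" "a < b" "b < n" for \<sigma> a b
    using tr[OF that(1,2), of a "b - Suc a"] that(3,4) by simp
  show ?thesis
    using finite_lessThan assms(1)
  proof (induction rule: permutes_rev_induct)
    case (swap a b p)
    show ?case
    proof (cases "a < b")
      case True
      with swap show ?thesis by (intro tr') auto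
    next
      case False
      with swap show ?thesis by (subst transpose_commute, intro tr') auto
    qed
  qed (rule assms(2))
qed

text \<open>A product of odd degrees is odd, so both signs flip under every adjacent
  exchange.\<close>

lemma koszul_sign_odd:
  assumes "\<sigma> permutes {..<length ds}" and "\<And>d. d \<in> set ds \<Longrightarrow> odd d"
  shows "koszul_sign ds \<sigma> = sign \<sigma>"
  using assms(1)
proof (induction rule: permutes_adjacent_induct)
  case id
  show ?case by (simp only: koszul_sign_id sign_id)
next
  case (swap \<sigma> i)
  have "odd (ds ! \<sigma> i * ds ! \<sigma> (Suc i))"
    using swap(2) permutes_in_image[OF swap(1), of i] permutes_in_image[OF swap(1), of "Suc i"]
    by (simp add: assms(2))
  moreover have "sign (\<sigma> \<circ> transpose i (Suc i)) = - sign \<sigma>"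
    using permutes_imp_permutation[OF finite_lessThan swap(1)]
    by (simp add: sign_compose permutation_swap_id sign_swap_id)
  ultimately show ?case
    using koszul_sign_adjacent[OF swap(1,2)] swap(3) by (simp only: if_True mult_minus1 not_False_eq_True)
qed

section \<open>The composition of cochains\<close>

lemma linear_iff_combination:
  assumes "vector_space s" and "vector_space t"
  shows "Vector_Spaces.linear s t f \<longleftrightarrow> (\<forall>c x y. f (s c x + y) = t c (f x) + f y)"
proof -
  interpret S: vector_space s by fact
  interpret T: vector_space t by fact
  interpret P: vector_space_pair s t ..
  show ?thesis
  proof
    assume l: "Vector_Spaces.linear s t f"
    then show "\<forall>c x y. f (s c x + y) = t c (f x) + f y"
      by (simp add: P.linear_add P.linear_scale)
  next
    assume *: "\<forall>c x y. f (s c x + y) = t c (f x) + f y"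
    have add: "f (x + y) = f x + f y" for x y using *[rule_format, of 1 x y] by simp
    then have 0: "f 0 = 0" by (metis add_cancel_left_right)
    have "f (s c x) = t c (f x)" for c x using *[rule_format, of c x 0] 0 by simp
    with add show "Vector_Spaces.linear s t f" using assms by (simp add: Vector_Spaces.linear_iff)
  qed
qed

text \<open>Makes no reference to a length. It agrees with \<open>wedge_multilinear\<close> on
  functions vanishing off length \<open>p\<close>, and it passes to
  \<open>\<lambda>Ys. \<phi> (X # Ys)\<close> without a change of parameters.\<close>

definition wedge_form ::
  "('k::field \<Rightarrow> 'e::ab_group_add \<Rightarrow> 'e) \<Rightarrow> ('k \<Rightarrow> 'f::ab_group_add \<Rightarrow> 'f) \<Rightarrow> (('e \<times> 'e) list \<Rightarrow> 'f) \<Rightarrow> bool"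
  where "wedge_form s t \<phi> \<longleftrightarrow> (\<forall>As Bs c x y z.
    \<phi> (As @ (s c x + y, z) # Bs) = t c (\<phi> (As @ (x, z) # Bs)) + \<phi> (As @ (y, z) # Bs) \<and>
    \<phi> (As @ (z, s c x + y) # Bs) = t c (\<phi> (As @ (z, x) # Bs)) + \<phi> (As @ (z, y) # Bs) \<and>
    \<phi> (As @ (x, x) # Bs) = 0)"

lemma wedge_multilinear_iff:
  assumes "vector_space s" and "vector_space t" and "\<And>Ys. length Ys \<noteq> p \<Longrightarrow> \<phi> Ys = 0"
  shows "wedge_multilinear s t p \<phi> \<longleftrightarrow> wedge_form s t \<phi>"
proof
  interpret T: vector_space t by fact
  assume w: "wedge_multilinear s t p \<phi>"
  have "\<phi> (As @ (s c x + y, z) # Bs) = t c (\<phi> (As @ (x, z) # Bs)) + \<phi> (As @ (y, z) # Bs) \<and>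
    \<phi> (As @ (z, s c x + y) # Bs) = t c (\<phi> (As @ (z, x) # Bs)) + \<phi> (As @ (z, y) # Bs) \<and>
    \<phi> (As @ (x, x) # Bs) = 0" for As Bs c x y z
  proof (cases "length (As @ (z, z) # Bs) = p")
    case True
    then have "length As < p" by auto
    from w[unfolded wedge_multilinear_def linear_iff_combination[OF assms(1,2)], rule_format, OF True this]
    show ?thesis by simp
  qed (simp add: assms(3))
  then show "wedge_form s t \<phi>" by (simp add: wedge_form_def)
next
  assume w: "wedge_form s t \<phi>"
  have "Xs[i := X] = take i Xs @ X # drop (Suc i) Xs" if "i < length Xs" for i X and Xs :: "('b \<times> 'b) list"
    using that by (rule upd_conv_take_nth_drop)
  with w show "wedge_multilinear s t p \<phi>"
    unfolding wedge_multilinear_def linear_iff_combination[OF assms(1,2)] wedge_form_def by simp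
qed

lemma cochains_iff:
  assumes "vector_space s" and "vector_space t"
  shows "P \<in> cochains s t p \<longleftrightarrow>
    (\<forall>Ys. length Ys \<noteq> p \<longrightarrow> fst P Ys = 0) \<and> (\<forall>Ys x. length Ys \<noteq> p \<longrightarrow> snd P Ys x = 0) \<and>
    (p = 0 \<longrightarrow> fst P = 0) \<and> wedge_form s t (fst P) \<and> (\<forall>x. wedge_form s t (\<lambda>Ys. snd P Ys x)) \<and>
    (\<forall>Ys c x y. snd P Ys (s c x + y) = t c (snd P Ys x) + snd P Ys y)"
proof -
  interpret T: vector_space t by fact
  have hom: "hom_part p P = P \<longleftrightarrow>
    (\<forall>Ys. length Ys \<noteq> p \<longrightarrow> fst P Ys = 0) \<and> (\<forall>Ys x. length Ys \<noteq> p \<longrightarrow> snd P Ys x = 0)"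
    by (auto simp: hom_part_def prod_eq_iff fun_eq_iff split: if_splits)
  show ?thesis
  proof (cases "(\<forall>Ys. length Ys \<noteq> p \<longrightarrow> fst P Ys = 0) \<and> (\<forall>Ys x. length Ys \<noteq> p \<longrightarrow> snd P Ys x = 0)")
    case True
    then have "wedge_multilinear s t p (fst P) \<longleftrightarrow> wedge_form s t (fst P)"
      "wedge_multilinear s t p (\<lambda>Ys. snd P Ys x) \<longleftrightarrow> wedge_form s t (\<lambda>Ys. snd P Ys x)" for x
      by (intro wedge_multilinear_iff assms; simp)+
    moreover have "(\<forall>Xs. length Xs = p \<longrightarrow> Vector_Spaces.linear s t (snd P Xs)) \<longleftrightarrow>
      (\<forall>Ys c x y. snd P Ys (s c x + y) = t c (snd P Ys x) + snd P Ys y)"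
      unfolding linear_iff_combination[OF assms] using True by (metis T.scale_zero_right add_0)
    moreover have "wedge_form s t (fst P)" if "fst P = 0"
      using that by (simp add: wedge_form_def)
    ultimately show ?thesis
      unfolding cochains_def mem_Collect_eq hom using True by auto
  qed (auto simp: cochains_def hom)
qed

lemma wedge_form_slot_additive:
  assumes "vector_space t" and "vector_space s" and "wedge_form s t \<phi>"
  shows "slot_additive \<phi>"
proof -
  interpret S: vector_space s by fact
  interpret T: vector_space t by fact
  show ?thesis
    using assms(3) unfolding wedge_form_def slot_additive_def by (metis S.scale_one T.scale_one)
qed

lemma parity_ofI: "(\<And>Xs. length Xs \<noteq> q \<Longrightarrow> F Xs = 0) \<Longrightarrow> parity_of (odd q) F"
  unfolding parity_of_def by metis

lemma cochains_additive:
  assumes "vector_space s" and "P \<in> cochains s s p"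
  shows "additive_cochain (odd p) P"
proof -
  interpret S: vector_space s by fact
  note P = assms(2)[unfolded cochains_iff[OF assms(1,1)]]
  then have "snd P Ys (x + y) = snd P Ys x + snd P Ys y" for Ys x y by (metis S.scale_one)
  moreover have "parity_of (odd p) (snd P)"
    by (rule parity_ofI) (use P in \<open>simp add: fun_eq_iff\<close>)
  ultimately show ?thesis
    using P wedge_form_slot_additive[OF assms(1,1)]
    by (simp add: additive_cochain_def value_additive_def)
qed

section \<open>The recursive operators as signed sums over splittings\<close>

lemma deriv_slot_zero: "slot_additive \<phi> \<Longrightarrow> deriv_slot \<phi> As (\<lambda>x. 0) X Bs = 0"
  unfolding slot_additive_def deriv_slot_def by (metis add_0 add_cancel_left_right)

lemma split_sum_sum: "split_sum par (\<lambda>S T. \<Sum>i\<in>I. F i S T) zs = (\<Sum>i\<in>I. split_sum par (F i) zs)"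
  by (induction I rule: infinite_finite_induct) (simp_all add: split_sum_0 split_sum_add)

lemma signed_sum: "signed b (\<Sum>i\<in>I. f i) = (\<Sum>i\<in>I. signed b (f i))"
  by (cases b) (simp_all add: sum_negf)

text \<open>\<open>m\<close> is the position of the pair that \<open>G\<close> hits: the entries
  before it are divided between \<open>G\<close> and \<open>\<phi>\<close>, those after it stay with
  \<open>\<phi>\<close>.\<close>

lemma insert_into_eq_sum:
  assumes "parity_of b G" and "slot_additive \<phi>"
  shows "insert_into b G \<phi> Xs = (\<Sum>m<length Xs. split_sum (\<lambda>_. True)
    (\<lambda>S T. deriv_slot \<phi> T (G S) (Xs ! m) (drop (Suc m) Xs)) (take m Xs))"
  using assms
proof (induction Xs arbitrary: b G \<phi>)
  case (Cons X Xs)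
  \<comment> \<open>\<open>split_sum\<close> counts the actual length of \<open>S\<close>, the
    recursion carries only \<open>b\<close>. Where the two disagree, \<open>G S\<close> is the zero
    map.\<close>
  have 1: "signed (odd (length S)) (deriv_slot \<phi> (X # T) (G S) Y Bs)
    = signed b (deriv_slot (\<lambda>Ys. \<phi> (X # Ys)) T (G S) Y Bs)" for S T Y Bs
  proof (cases "odd (length S) = b")
    case False
    then have "G S = (\<lambda>x. 0)" using Cons.prems(1) by (auto simp: parity_of_def)
    then show ?thesis
      using deriv_slot_zero[OF Cons.prems(2)] deriv_slot_zero[OF slot_additive_Cons[OF Cons.prems(2)]] by simp
  qed (simp add: deriv_slot_def)
  show ?case
    using Cons.IH[OF parity_of_Cons[OF Cons.prems(1), of X] Cons.prems(2)]
      Cons.IH[OF Cons.prems(1) slot_additive_Cons[OF Cons.prems(2), of X]]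
    by (simp add: sum.lessThan_Suc_shift 1 split_sum_signed signed_sum sum.distrib add.assoc del: sum.lessThan_Suc)
qed simp

lemma shuffle_eq_split_sum:
  assumes "parity_of b G" and "value_additive \<phi>"
  shows "shuffle False b G \<phi> Xs = split_sum (\<lambda>_. True) (\<lambda>S T. \<phi> T (G S)) Xs"
  using assms
proof (induction Xs arbitrary: b G \<phi>)
  case (Cons X Xs)
  have "signed (odd (length S)) (\<phi> (X # T) (G S)) = signed b (\<phi> (X # T) (G S))" for S T
    using Cons.prems by (cases "odd (length S) = b") (auto simp: parity_of_def value_additiveD)
  then show ?case
    using Cons.IH[OF parity_of_Cons[OF Cons.prems(1), of X] Cons.prems(2)]
      Cons.IH[OF Cons.prems(1) value_additive_Cons[OF Cons.prems(2), of X]]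
    by (simp add: split_sum_signed)
qed simp

text \<open>The parity \<open>b\<close> also counts \<open>Y\<close>, which \<open>G\<close>
  receives last. Every entry of \<open>T\<close> is therefore charged once more than in the
  splitting of \<open>Xs\<close> alone.\<close>

lemma half_shuffle_eq_split_sum:
  assumes "parity_of b G" and "value_additive \<phi>"
  shows "shuffle True b G \<phi> (Xs @ [Y])
    = split_sum (\<lambda>_. True) (\<lambda>S T. signed (odd (length T)) (\<phi> T (G (S @ [Y])))) Xs"
  using assms
proof (induction Xs arbitrary: b G \<phi>)
  case (Cons X Xs)
  have "signed (odd (length S)) (signed (odd (length (X # T))) (\<phi> (X # T) (G (S @ [Y]))))
     = signed b (signed (odd (length T)) (\<phi> (X # T) (G (S @ [Y]))))" for S T
    using Cons.prems
    by (cases "even (length S) = b") (auto simp: parity_of_def value_additiveD signed_def)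
  then show ?case
    using Cons.IH[OF parity_of_Cons[OF Cons.prems(1), of X] Cons.prems(2)]
      Cons.IH[OF Cons.prems(1) value_additive_Cons[OF Cons.prems(2), of X]]
    by (simp add: split_sum_signed del: length_Cons)
qed simp

lemma split_sum_Nil_left: "(\<And>S T. S \<noteq> [] \<Longrightarrow> F S T = 0) \<Longrightarrow> split_sum par F zs = F [] zs"
proof (induction zs arbitrary: F)
  case (Cons z zs)
  have "split_sum par (\<lambda>S T. F (z # S) T) zs = 0" using Cons.prems by (simp add: split_sum_0)
  moreover have "split_sum par (\<lambda>S T. signed (par z \<and> odd (length (filter par S))) (F S (z # T))) zs = F [] (z # zs)"
    by (subst Cons.IH) (simp_all add: Cons.prems)
  ultimately show ?case by simp
qed simp

lemma split_sum_Nil_right: "(\<And>S T. T \<noteq> [] \<Longrightarrow> F S T = 0) \<Longrightarrow> split_sum par F zs = F zs []"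
proof (induction zs arbitrary: F)
  case (Cons z zs)
  have "split_sum par (\<lambda>S T. signed (par z \<and> odd (length (filter par S))) (F S (z # T))) zs = 0"
    using Cons.prems by (simp add: split_sum_0)
  moreover have "split_sum par (\<lambda>S T. F (z # S) T) zs = F (z # zs) []"
    by (subst Cons.IH) (simp_all add: Cons.prems)
  ultimately show ?case by simp
qed simp

lemma (in vector_space) scale_sign: "k \<in> {1, - 1} \<Longrightarrow> scale (of_int k) x = signed (k < 0) x"
  by auto

lemma sign_values: "sign \<sigma> \<in> {1, - 1 :: int}"
  by (simp add: sign_def)

lemma (in vector_space) scale_shuffle_sign:
  "scale (of_int ((- 1) ^ m * sign \<sigma>)) x = signed (odd m) (signed (sign \<sigma> < 0) x)"
  using sign_values[of \<sigma>] by (cases "odd m") auto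

lemma pick_take:
  assumes "\<sigma> permutes {..<n}" and "j \<le> n"
  shows "pick \<sigma> i j (take n xs) = pick \<sigma> i j xs"
  unfolding pick_def using permutes_in_image[OF assms(1)] assms(2) by (auto intro!: map_cong)

text \<open>In \<open>circ\<close> the first block of the shuffle belongs to P, while the recursion
  lists the arguments of Q first. Exchanging the roles by \<open>split_sum_swap\<close> costs
  (-1)^(ij), which cancels the prefactor.\<close>

lemma sum_shuffle_perms_swap:
  assumes "length zs = i + j"
  shows "(\<Sum>\<sigma>\<in>shuffle_perms i j. signed (odd (i * j)) (signed (sign \<sigma> < 0)
      (F (pick \<sigma> 0 i zs) (pick \<sigma> i (i + j) zs))))
    = split_sum (\<lambda>_. True) (\<lambda>S T. if length T = i then F T S else 0) zs"
proof -
  have k: "koszul_sign (map (\<lambda>_. 1) zs) \<sigma> = sign \<sigma>" if "\<sigma> \<in> shuffle_perms i j" for \<sigma>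
    by (rule koszul_sign_odd) (use that assms in \<open>auto simp: shuffle_perms_def\<close>)
  have "(\<Sum>\<sigma>\<in>shuffle_perms i j. signed (odd (i * j)) (signed (sign \<sigma> < 0)
      (F (pick \<sigma> 0 i zs) (pick \<sigma> i (i + j) zs))))
    = signed (odd (i * j)) (\<Sum>\<sigma>\<in>shuffle_perms i j. signed (koszul_sign (map (\<lambda>_. 1) zs) \<sigma> < 0)
      (F (pick \<sigma> 0 i zs) (pick \<sigma> i (i + j) zs)))"
    unfolding signed_sum by (intro sum.cong refl) (simp add: k)
  also have "\<dots> = split_sum (\<lambda>_. True) (\<lambda>S T. signed (odd (i * j)) (if length S = i then F S T else 0)) zs"
    unfolding sum_shuffle_perms[OF assms] split_sum_signed by simp
  also have "\<dots> = split_sum (\<lambda>_. True) (\<lambda>S T. signed (odd (length S) \<and> odd (length T))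
      (if length S = i then F S T else 0)) zs"
    by (rule split_sum_cong) (use assms in auto)
  also have "\<dots> = split_sum (\<lambda>_. True) (\<lambda>S T. if length T = i then F T S else 0) zs"
    using split_sum_swap[of "\<lambda>_. True" "\<lambda>S T. if length T = i then F T S else 0" zs] by simp
  finally show ?thesis .
qed

text \<open>The prefactor is (-1)^(i(j+1)), but only \<open>i\<close> and \<open>j\<close> freely
  placed entries are exchanged. The difference (-1)^i is the extra sign in
  \<open>half_shuffle_eq_split_sum\<close>.\<close>

lemma sum_shuffle_perms_last_swap:
  assumes "length zs = i + j"
  shows "(\<Sum>\<sigma>\<in>{\<sigma> \<in> shuffle_perms i (Suc j). \<sigma> (i + j) = i + j}.
      signed (odd (i * Suc j)) (signed (sign \<sigma> < 0)
        (F (pick \<sigma> 0 i (zs @ [z])) (pick \<sigma> i (Suc (i + j)) (zs @ [z])))))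
    = split_sum (\<lambda>_. True) (\<lambda>S T. if length T = i then signed (odd (length T)) (F T (S @ [z])) else 0) zs"
proof -
  have k: "koszul_sign (map (\<lambda>_. 1) (zs @ [z])) \<sigma> = sign \<sigma>" if "\<sigma> \<in> shuffle_perms i (Suc j)" for \<sigma>
    by (rule koszul_sign_odd) (use that assms in \<open>auto simp: shuffle_perms_def\<close>)
  have "(\<Sum>\<sigma>\<in>{\<sigma> \<in> shuffle_perms i (Suc j). \<sigma> (i + j) = i + j}.
      signed (odd (i * Suc j)) (signed (sign \<sigma> < 0)
        (F (pick \<sigma> 0 i (zs @ [z])) (pick \<sigma> i (Suc (i + j)) (zs @ [z])))))
    = signed (odd (i * Suc j)) (\<Sum>\<sigma>\<in>{\<sigma> \<in> shuffle_perms i (Suc j). \<sigma> (i + j) = i + j}.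
      signed (koszul_sign (map (\<lambda>_. 1) (zs @ [z])) \<sigma> < 0)
        (F (pick \<sigma> 0 i (zs @ [z])) (pick \<sigma> i (Suc (i + j)) (zs @ [z]))))"
    unfolding signed_sum by (intro sum.cong refl) (simp only: mem_Collect_eq k)
  also have "\<dots> = split_sum (\<lambda>_. True)
      (\<lambda>S T. signed (odd (i * Suc j)) (if length S = i then F S (T @ [z]) else 0)) zs"
    unfolding sum_shuffle_perms_last[OF assms] split_sum_signed by simp
  also have "\<dots> = split_sum (\<lambda>_. True) (\<lambda>S T. signed (odd (length S) \<and> odd (length T))
      (if length S = i then signed (odd (length S)) (F S (T @ [z])) else 0)) zs"
    by (rule split_sum_cong) (use assms in \<open>auto simp: signed_def\<close>)
  also have "\<dots> = split_sum (\<lambda>_. True) (\<lambda>S T. if length T = i then signed (odd (length T)) (F T (S @ [z])) else 0) zs"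
    using split_sum_swap[of "\<lambda>_. True" "\<lambda>S T. if length T = i then signed (odd (length T)) (F T (S @ [z])) else 0" zs] by simp
  finally show ?thesis .
qed

lemma insert_into_eq_insertion_sum:
  assumes "vector_space s" and "\<And>Ys x. length Ys \<noteq> q \<Longrightarrow> G Ys x = 0" and "slot_additive \<phi>"
    and "length Xs = p + q"
  shows "insertion_sum s p q \<phi> G Xs = insert_into (odd q) G \<phi> Xs"
proof -
  interpret vector_space s by fact
  have G: "G Ys = (\<lambda>x. 0)" if "length Ys \<noteq> q" for Ys
    using assms(2)[OF that] by auto
  then have par: "parity_of (odd q) G" by (intro parity_ofI) (simp add: fun_eq_iff)
  let ?D = "\<lambda>m S T. deriv_slot \<phi> T (G S) (Xs ! m) (drop (Suc m) Xs)"
  have D0: "?D m S T = 0" if "length S \<noteq> q" for m S T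
    using that by (simp add: G deriv_slot_zero assms(3))
  have "insert_into (odd q) G \<phi> Xs = (\<Sum>m<p + q. split_sum (\<lambda>_. True) (?D m) (take m Xs))"
    unfolding insert_into_eq_sum[OF par assms(3)] assms(4) ..
  \<comment> \<open>\<open>G\<close> needs exactly \<open>q\<close> arguments in front of the pair
    it hits, so positions below \<open>q\<close> contribute nothing; then \<open>m = k + q\<close>,
    where \<open>k\<close> arguments are left to \<open>\<phi>\<close>.\<close>
  also have "\<dots> = (\<Sum>m\<in>{q..<p + q}. split_sum (\<lambda>_. True) (?D m) (take m Xs))"
  proof (rule sum.mono_neutral_right)
    show "\<forall>m\<in>{..<p + q} - {q..<p + q}. split_sum (\<lambda>_. True) (?D m) (take m Xs) = 0"
    proof
      fix m assume m: "m \<in> {..<p + q} - {q..<p + q}"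
      have "split_sum (\<lambda>_. True) (?D m) (take m Xs) = split_sum (\<lambda>_. True) (\<lambda>_ _. 0) (take m Xs)"
        by (rule split_sum_cong, rule D0) (use m in auto)
      then show "split_sum (\<lambda>_. True) (?D m) (take m Xs) = 0" by (simp add: split_sum_0)
    qed
  qed auto
  also have "\<dots> = (\<Sum>k<p. split_sum (\<lambda>_. True) (?D (k + q)) (take (k + q) Xs))"
    using sum.shift_bounds_nat_ivl[of "\<lambda>m. split_sum (\<lambda>_. True) (?D m) (take m Xs)" 0 q p]
    by (simp add: lessThan_atLeast0)
  also have "\<dots> = insertion_sum s p q \<phi> G Xs"
    unfolding insertion_sum_def scale_shuffle_sign
  proof (intro sum.cong refl)
    fix k assume "k \<in> {..<p}"
    then have l: "length (take (k + q) Xs) = k + q" using assms(4) by simp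
    have "split_sum (\<lambda>_. True) (?D (k + q)) (take (k + q) Xs)
      = split_sum (\<lambda>_. True) (\<lambda>S T. if length T = k then ?D (k + q) S T else 0) (take (k + q) Xs)"
      by (rule split_sum_cong) (use l D0 in auto)
    also have "\<dots> = (\<Sum>\<sigma>\<in>shuffle_perms k q. signed (odd (k * q)) (signed (sign \<sigma> < 0)
      (?D (k + q) (pick \<sigma> k (k + q) (take (k + q) Xs)) (pick \<sigma> 0 k (take (k + q) Xs)))))"
      by (rule sum_shuffle_perms_swap[OF l, symmetric])
    also have "\<dots> = (\<Sum>\<sigma>\<in>shuffle_perms k q. signed (odd (k * q)) (signed (sign \<sigma> < 0)
      (deriv_slot \<phi> (pick \<sigma> 0 k Xs) (G (pick \<sigma> k (k + q) Xs)) (Xs ! (k + q)) (drop (k + q + 1) Xs))))"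
      by (intro sum.cong refl) (simp add: shuffle_perms_def pick_take)
    finally show "split_sum (\<lambda>_. True) (?D (k + q)) (take (k + q) Xs) = \<dots>" .
  qed
  finally show ?thesis by simp
qed


text \<open>\<open>circ\<close> is cut off outside length \<open>p + q\<close> by
  \<open>hom_part\<close>, the recursion is not. Together with \<open>shuffle_degree\<close> this
  shows that the recursion vanishes there by itself.\<close>

lemma insert_into_degree:
  assumes "\<And>Ys x. length Ys \<noteq> q \<Longrightarrow> G Ys x = 0" and "slot_additive \<phi>"
    and "\<And>Ys. length Ys \<noteq> p \<Longrightarrow> \<phi> Ys = 0" and "length Xs \<noteq> p + q"
  shows "insert_into (odd q) G \<phi> Xs = 0"
proof -
  have G: "G Ys = (\<lambda>x. 0)" if "length Ys \<noteq> q" for Ys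
    using assms(1)[OF that] by auto
  then have par: "parity_of (odd q) G" by (intro parity_ofI) (simp add: fun_eq_iff)
  have "split_sum (\<lambda>_. True) (\<lambda>S T. deriv_slot \<phi> T (G S) (Xs ! m) (drop (Suc m) Xs)) (take m Xs)
    = split_sum (\<lambda>_. True) (\<lambda>S T. 0) (take m Xs)" if "m < length Xs" for m
  proof (rule split_sum_cong)
    fix S T :: "('a \<times> 'a) list" assume l: "length S + length T = length (take m Xs)"
    show "deriv_slot \<phi> T (G S) (Xs ! m) (drop (Suc m) Xs) = 0"
    proof (cases "length S = q")
      case True
      then have "length T + Suc (length Xs - Suc m) \<noteq> p" using l assms(4) that by simp
      then show ?thesis by (simp add: deriv_slot_def assms(3))
    qed (simp add: G deriv_slot_zero assms(2))
  qed
  then show ?thesis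
    unfolding insert_into_eq_sum[OF par assms(2)] by (intro sum.neutral) (simp add: split_sum_0)
qed

lemma shuffle_degree:
  fixes \<phi> :: "'x list \<Rightarrow> 'b::ab_group_add \<Rightarrow> 'a::ab_group_add"
  assumes "\<And>Ys. length Ys \<noteq> q \<Longrightarrow> G Ys = 0" and "value_additive \<phi>"
    and "\<And>Ys x. length Ys \<noteq> p \<Longrightarrow> \<phi> Ys x = 0" and "length Xs \<noteq> p + q"
  shows "shuffle h (odd q) G \<phi> Xs = 0"
proof -
  have par: "parity_of (odd q) G" by (rule parity_ofI) (rule assms(1))
  have 0: "\<phi> T (G S) = 0" if "length S + length T \<noteq> p + q" for S T
    using that assms(1)[of S] assms(3)[of T] value_additiveD(2)[OF assms(2)] by (cases "length S = q") auto
  have "split_sum (\<lambda>_. True) (\<lambda>S T. \<phi> T (G S)) Xs = split_sum (\<lambda>_. True) (\<lambda>S T. 0) Xs"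
    by (rule split_sum_cong, rule 0) (use assms(4) in simp)
  then have "shuffle False (odd q) G \<phi> Xs = 0"
    by (simp add: shuffle_eq_split_sum[OF par assms(2)] split_sum_0)
  moreover have "shuffle True (odd q) G \<phi> Xs = 0"
  proof (cases Xs rule: rev_cases)
    case (snoc Ys Y)
    have "split_sum (\<lambda>_. True) (\<lambda>S T. signed (odd (length T)) (\<phi> T (G (S @ [Y])))) Ys
      = split_sum (\<lambda>_. True) (\<lambda>S T. 0) Ys"
      by (rule split_sum_cong, subst 0) (use assms(4) snoc in auto)
    then show ?thesis by (simp add: half_shuffle_eq_split_sum[OF par assms(2)] split_sum_0 snoc)
  qed simp
  ultimately show ?thesis by (cases h) simp_all
qed

text \<open>The recursion needs no separate formulas in degree 0: for \<open>p = 0\<close> there are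
  no slots to hit and Q receives everything, for \<open>q = 0\<close> only the splittings in which Q
  receives nothing survive.\<close>

lemma circ_eq_comp:
  fixes s :: "'k::field \<Rightarrow> 'e::ab_group_add \<Rightarrow> 'e"
  assumes "vector_space s" and "P \<in> cochains s s p" and "Q \<in> cochains s s q"
  shows "circ s p q P Q = cochain_comp (odd q) P Q"
proof -
  interpret vector_space s by fact
  note P = assms(2)[unfolded cochains_iff[OF assms(1,1)]]
  note Q = assms(3)[unfolded cochains_iff[OF assms(1,1)]]
  note aP = cochains_additive[OF assms(1,2), unfolded additive_cochain_def]
  note aQ = cochains_additive[OF assms(1,3), unfolded additive_cochain_def]
  have vP: "value_additive (snd P)" and sP: "slot_additive (fst P)" "slot_additive (\<lambda>Ys. snd P Ys x)" for x
    using aP by auto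
  have P0: "fst P Ys = 0" "snd P Ys x = 0" if "length Ys \<noteq> p" for Ys x
    using P that by auto
  have Q0: "fst Q Ys = 0" "snd Q Ys x = 0" if "length Ys \<noteq> q" for Ys x
    using Q that by auto
  have pQ: "parity_of (odd q) (snd Q)" "parity_of (odd q) (fst Q)" "parity_of (odd q) (\<lambda>Ys. snd Q Ys x)" for x
    using aQ Q0 by (auto intro!: parity_ofI)
  have deg: "fst (cochain_comp (odd q) P Q) Xs = 0" "snd (cochain_comp (odd q) P Q) Xs x = 0"
    if "length Xs \<noteq> p + q" for Xs x
    using that P0 Q0 vP sP
    by (simp_all add: cochain_comp_def cochain_comp_snd_def insert_into_degree[where p = p] shuffle_degree[where p = p])
  have "fst (circ s p q P Q) Xs = fst (cochain_comp (odd q) P Q) Xs \<and>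
    snd (circ s p q P Q) Xs x = snd (cochain_comp (odd q) P Q) Xs x" if l: "length Xs = p + q" for Xs x
  proof -
    consider "p = 0" | "p \<noteq> 0" "q = 0" | "p \<noteq> 0" "q \<noteq> 0" by blast
    then show ?thesis
    proof cases
      case 1
      have "shuffle True (odd q) (fst Q) (snd P) Xs = snd P [] (fst Q Xs)"
      proof (cases Xs rule: rev_cases)
        case Nil
        then have "fst Q Xs = 0" using l Q 1 by simp
        with Nil show ?thesis by (simp add: value_additiveD(2)[OF vP])
      next
        case (snoc Ys Y)
        then show ?thesis
          using split_sum_Nil_right[of "\<lambda>S T. signed (odd (length T)) (snd P T (fst Q (S @ [Y])))" "\<lambda>_. True" Ys]
          by (simp add: half_shuffle_eq_split_sum[OF pQ(2) vP] P0 1)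
      qed
      moreover have "shuffle False (odd q) (\<lambda>Ys. snd Q Ys x) (snd P) Xs = snd P [] (snd Q Xs x)"
        using split_sum_Nil_right[of "\<lambda>S T. snd P T (snd Q S x)" "\<lambda>_. True" Xs]
        by (simp add: shuffle_eq_split_sum[OF pQ(3) vP] P0 1)
      moreover have "insert_into (odd q) (snd Q) (\<lambda>Ys. snd P Ys x) Xs = 0"
        "insert_into (odd q) (snd Q) (fst P) Xs = 0"
        using P0 1 P by (auto intro!: insert_into_eq_0)
      ultimately show ?thesis
        using 1 l by (simp add: circ_def hom_part_def cochain_comp_def cochain_comp_snd_def)
    next
      case 2
      have ins: "insert_into False (snd Q) \<phi> Xs
        = (\<Sum>k<p. deriv_slot \<phi> (take k Xs) (snd Q []) (Xs ! k) (drop (k + 1) Xs))" if "slot_additive \<phi>"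
        for \<phi> :: "('e \<times> 'e) list \<Rightarrow> 'e"
      proof -
        have "snd Q S = (\<lambda>x. 0)" if "S \<noteq> []" for S using Q0 2 that by auto
        then have "split_sum (\<lambda>_. True) (\<lambda>S T. deriv_slot \<phi> T (snd Q S) X Bs) zs
          = deriv_slot \<phi> zs (snd Q []) X Bs" for X Bs zs
          by (intro split_sum_Nil_left) (simp add: deriv_slot_zero \<open>slot_additive \<phi>\<close>)
        then show ?thesis
          using insert_into_eq_sum[OF pQ(1) \<open>slot_additive \<phi>\<close>, of Xs] 2 l by simp
      qed
      \<comment> \<open>The convention that a linear map has zero first component removes the
        half-shuffle term, which the formula for P o f does not contain.\<close>
      have "fst Q = 0" using Q 2 by simp
      then have "shuffle True False (fst Q) (snd P) Xs = 0"
        using shuffle_zero_left[OF vP] by (simp add: zero_fun_def)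
      moreover have "shuffle False False (\<lambda>Ys. snd Q Ys x) (snd P) Xs = snd P Xs (snd Q [] x)"
        using shuffle_eq_split_sum[OF pQ(3) vP, of x Xs] 2
          split_sum_Nil_left[of "\<lambda>S T. snd P T (snd Q S x)" "\<lambda>_. True" Xs]
        by (simp add: Q0 value_additiveD(2)[OF vP])
      ultimately show ?thesis
        using 2 l ins sP by (simp add: circ_def hom_part_def cochain_comp_def cochain_comp_snd_def add.commute)
    next
      case 3
      note ins = insert_into_eq_insertion_sum[OF assms(1) Q0(2) _ l]
      have "(\<Sum>\<sigma>\<in>shuffle_perms p q. s (of_int ((- 1) ^ (p * q) * sign \<sigma>))
          (snd P (pick \<sigma> 0 p Xs) (snd Q (pick \<sigma> p (p + q) Xs) x)))
        = split_sum (\<lambda>_. True) (\<lambda>S T. if length T = p then snd P T (snd Q S x) else 0) Xs"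
        unfolding scale_shuffle_sign by (rule sum_shuffle_perms_swap[OF l])
      also have "\<dots> = shuffle False (odd q) (\<lambda>Ys. snd Q Ys x) (snd P) Xs"
        unfolding shuffle_eq_split_sum[OF pQ(3) vP] by (rule split_sum_cong) (simp add: P0)
      finally have 1: "(\<Sum>\<sigma>\<in>shuffle_perms p q. s (of_int ((- 1) ^ (p * q) * sign \<sigma>))
          (snd P (pick \<sigma> 0 p Xs) (snd Q (pick \<sigma> p (p + q) Xs) x))) = \<dots>" .
      obtain j where j: "q = Suc j" using 3 by (cases q) auto
      obtain Ys Y where Y: "Xs = Ys @ [Y]" using l j by (cases Xs rule: rev_cases) auto
      have lY: "length Ys = p + j" using l Y j by simp
      have "(\<Sum>\<sigma> \<in> {\<sigma> \<in> shuffle_perms p q. \<sigma> (p + q - 1) = p + q - 1}.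
                s (of_int ((- 1) ^ (p * q) * sign \<sigma>))
                  (snd P (pick \<sigma> 0 p Xs) (fst Q (pick \<sigma> p (p + q) Xs))))
        = split_sum (\<lambda>_. True)
          (\<lambda>S T. if length T = p then signed (odd (length T)) (snd P T (fst Q (S @ [Y]))) else 0) Ys"
        using sum_shuffle_perms_last_swap[OF lY, where F = "\<lambda>S T. snd P S (fst Q T)" and z = Y]
        by (simp only: scale_shuffle_sign j Y add_Suc_right diff_Suc_1)
      also have "\<dots> = shuffle True (odd q) (fst Q) (snd P) Xs"
        unfolding Y half_shuffle_eq_split_sum[OF pQ(2) vP] by (rule split_sum_cong) (simp add: P0)
      finally show ?thesis
        using 3 l ins sP 1 by (simp add: circ_def hom_part_def cochain_comp_def cochain_comp_snd_def)
    qed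
  qed
  moreover have "fst (circ s p q P Q) Xs = 0 \<and> snd (circ s p q P Q) Xs x = 0" if "length Xs \<noteq> p + q" for Xs x
    using that by (simp add: circ_def hom_part_def)
  ultimately show ?thesis
    using deg by (auto simp: prod_eq_iff fun_eq_iff) metis+
qed


section \<open>Cochains are closed under composition\<close>

lemma wedge_form_Cons: "wedge_form s t \<phi> \<Longrightarrow> wedge_form s t (\<lambda>Ys. \<phi> (X # Ys))"
  unfolding wedge_form_def by (metis append_Cons)

context vector_space
begin

lemma wedge_formD:
  assumes "wedge_form scale scale \<phi>"
  shows "\<phi> ((scale c x + y, z) # Bs) = scale c (\<phi> ((x, z) # Bs)) + \<phi> ((y, z) # Bs)"
    and "\<phi> ((z, scale c x + y) # Bs) = scale c (\<phi> ((z, x) # Bs)) + \<phi> ((z, y) # Bs)"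
    and "\<phi> ((x, x) # Bs) = 0"
    and "\<phi> ((scale c x, z) # Bs) = scale c (\<phi> ((x, z) # Bs))"
    and "\<phi> ((z, scale c x) # Bs) = scale c (\<phi> ((z, x) # Bs))"
proof -
  have sa: "slot_additive \<phi>"
    using wedge_form_slot_additive[OF vector_space_axioms vector_space_axioms assms] .
  have 1: "\<phi> ((scale c x + y, z) # Bs) = scale c (\<phi> ((x, z) # Bs)) + \<phi> ((y, z) # Bs)"
    "\<phi> ((z, scale c x + y) # Bs) = scale c (\<phi> ((z, x) # Bs)) + \<phi> ((z, y) # Bs)"
    "\<phi> ((x, x) # Bs) = 0" for c x y z
    using assms unfolding wedge_form_def by (metis append_Nil)+
  then show "\<phi> ((scale c x + y, z) # Bs) = scale c (\<phi> ((x, z) # Bs)) + \<phi> ((y, z) # Bs)"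
    "\<phi> ((z, scale c x + y) # Bs) = scale c (\<phi> ((z, x) # Bs)) + \<phi> ((z, y) # Bs)"
    "\<phi> ((x, x) # Bs) = 0" by blast+
  show "\<phi> ((scale c x, z) # Bs) = scale c (\<phi> ((x, z) # Bs))"
    "\<phi> ((z, scale c x) # Bs) = scale c (\<phi> ((z, x) # Bs))"
    using 1(1)[of c x 0 z] 1(2)[of z c x 0] by (simp_all add: slot_additiveD[OF sa])
qed

lemma signed_scale: "signed b (scale c x) = scale c (signed b x)"
  by (simp add: signed_def)

lemma insert_into_scale_left:
  "wedge_form scale scale \<phi> \<Longrightarrow>
    insert_into b (\<lambda>Ys y. scale c (G Ys y)) \<phi> Xs = scale c (insert_into b G \<phi> Xs)"
  by (induction Xs arbitrary: b G \<phi>)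
    (simp_all add: wedge_form_Cons deriv_slot_def wedge_formD signed_scale scale_right_distrib)

lemma insert_into_scale_right:
  "insert_into b G (\<lambda>Ys. scale c (\<phi> Ys)) Xs = scale c (insert_into b G \<phi> Xs)"
  by (induction Xs arbitrary: b G \<phi>) (simp_all add: deriv_slot_def signed_scale scale_right_distrib)

lemma shuffle_scale_right:
  "shuffle h b G (\<lambda>Ys x. scale c (\<phi> Ys x)) Xs = scale c (shuffle h b G \<phi> Xs)"
  by (induction Xs arbitrary: b G \<phi>) (simp_all add: signed_scale scale_right_distrib)

lemma shuffle_scale_left:
  "(\<And>Ys c x. \<phi> Ys (scale c x) = scale c (\<phi> Ys x)) \<Longrightarrow>
    shuffle h b (\<lambda>Ys. scale c (G Ys)) \<phi> Xs = scale c (shuffle h b G \<phi> Xs)"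
  by (induction Xs arbitrary: b G \<phi>) (simp_all add: signed_scale scale_right_distrib)

text \<open>Polarization: \<open>\<phi>\<close> vanishes at the pair (x + g x, x + g x). Of the four
  terms of the expansion the two diagonal ones vanish, and the cross terms form the
  \<open>deriv_slot\<close>.\<close>

lemma deriv_slot_diag: "wedge_form scale scale \<phi> \<Longrightarrow> deriv_slot \<phi> [] g (x, x) Bs = 0"
proof -
  assume w: "wedge_form scale scale \<phi>"
  then have sa: "slot_additive \<phi>"
    using wedge_form_slot_additive[OF vector_space_axioms vector_space_axioms] by blast
  show ?thesis
  proof -
    have "0 = \<phi> ((x + g x, x + g x) # Bs)"
      by (rule wedge_formD(3)[OF w, symmetric])
    also have "\<dots> = deriv_slot \<phi> [] g (x, x) Bs"
      by (simp only: slot_additiveD(1,2)[OF sa]) (simp add: deriv_slot_def wedge_formD(3)[OF w])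
    finally show ?thesis by simp
  qed
qed

lemma wedge_formI:
  assumes "\<And>As Bs c x y z. \<phi> (As @ (scale c x + y, z) # Bs)
      = scale c (\<phi> (As @ (x, z) # Bs)) + \<phi> (As @ (y, z) # Bs) \<and>
    \<phi> (As @ (z, scale c x + y) # Bs) = scale c (\<phi> (As @ (z, x) # Bs)) + \<phi> (As @ (z, y) # Bs) \<and>
    \<phi> (As @ (x, x) # Bs) = 0"
  shows "wedge_form scale scale \<phi>"
  unfolding wedge_form_def using assms by blast

text \<open>Equations between functions, because in the recursive operators \<open>F\<close> occurs
  with its list argument fixed and its last argument still open.\<close>

lemma wedge_form_curried:
  assumes "\<And>x. wedge_form scale scale (\<lambda>Ys. F Ys x)"
  shows "F ((scale c x + y, z) # Bs) = (\<lambda>w. scale c (F ((x, z) # Bs) w) + F ((y, z) # Bs) w)"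
    and "F ((z, scale c x + y) # Bs) = (\<lambda>w. scale c (F ((z, x) # Bs) w) + F ((z, y) # Bs) w)"
    and "F ((x, x) # Bs) = (\<lambda>w. 0)"
  using wedge_formD(1-3)[OF assms] by blast+

lemma wedge_form_insert_into:
  assumes "wedge_form scale scale \<phi>" and "\<And>x. wedge_form scale scale (\<lambda>Ys. G Ys x)"
    and "\<And>Ys c x y. G Ys (scale c x + y) = scale c (G Ys x) + G Ys y"
  shows "wedge_form scale scale (insert_into b G \<phi>)"
proof (rule wedge_formI)
  fix As Bs c x y z
  note sa = wedge_form_slot_additive[OF vector_space_axioms vector_space_axioms]
  show "insert_into b G \<phi> (As @ (scale c x + y, z) # Bs)
      = scale c (insert_into b G \<phi> (As @ (x, z) # Bs)) + insert_into b G \<phi> (As @ (y, z) # Bs) \<and>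
    insert_into b G \<phi> (As @ (z, scale c x + y) # Bs)
      = scale c (insert_into b G \<phi> (As @ (z, x) # Bs)) + insert_into b G \<phi> (As @ (z, y) # Bs) \<and>
    insert_into b G \<phi> (As @ (x, x) # Bs) = 0"
    using assms
  proof (induction As arbitrary: b G \<phi>)
    case Nil
    then show ?case
      by (simp add: deriv_slot_diag wedge_form_curried insert_into_linear sa insert_into_scale_left
          insert_into_scale_right wedge_formD(3))
        (simp add: deriv_slot_def wedge_formD insert_into_linear insert_into_scale_right
          signed_add signed_scale scale_right_distrib)
  next
    case (Cons A As)
    have w: "\<phi> (X # As @ (scale c x + y, z) # Bs) = scale c (\<phi> (X # As @ (x, z) # Bs)) + \<phi> (X # As @ (y, z) # Bs)"
      "\<phi> (X # As @ (z, scale c x + y) # Bs) = scale c (\<phi> (X # As @ (z, x) # Bs)) + \<phi> (X # As @ (z, y) # Bs)"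
      "\<phi> (X # As @ (x, x) # Bs) = 0" for X
      using wedge_form_Cons[OF Cons.prems(1), of X] unfolding wedge_form_def by blast+
    show ?case
      using Cons.IH[OF Cons.prems(1) wedge_form_Cons[OF Cons.prems(2), of A] Cons.prems(3), of "\<not> b"]
        Cons.IH[OF wedge_form_Cons[OF Cons.prems(1), of A] Cons.prems(2,3), of b]
      by (simp add: deriv_slot_def w signed_add signed_scale scale_right_distrib)
  qed
qed

lemma value_linearD:
  assumes "\<And>Ys c x y. \<phi> Ys (scale c x + y) = scale c (\<phi> Ys x) + \<phi> Ys y"
  shows "value_additive \<phi>" and "\<phi> Ys (scale c x) = scale c (\<phi> Ys x)"
proof -
  show *: "value_additive \<phi>"
    using assms[of _ 1] by (simp add: value_additive_def)
  show "\<phi> Ys (scale c x) = scale c (\<phi> Ys x)"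
    using assms[of Ys c x 0] by (simp add: value_additiveD(2)[OF *])
qed

lemma wedge_form_shuffle:
  assumes "\<And>x. wedge_form scale scale (\<lambda>Ys. \<phi> Ys x)" and "wedge_form scale scale G"
    and "\<And>Ys c x y. \<phi> Ys (scale c x + y) = scale c (\<phi> Ys x) + \<phi> Ys y"
  shows "wedge_form scale scale (shuffle h b G \<phi>)"
proof (rule wedge_formI)
  fix As Bs c x y z
  show "shuffle h b G \<phi> (As @ (scale c x + y, z) # Bs)
      = scale c (shuffle h b G \<phi> (As @ (x, z) # Bs)) + shuffle h b G \<phi> (As @ (y, z) # Bs) \<and>
    shuffle h b G \<phi> (As @ (z, scale c x + y) # Bs)
      = scale c (shuffle h b G \<phi> (As @ (z, x) # Bs)) + shuffle h b G \<phi> (As @ (z, y) # Bs) \<and>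
    shuffle h b G \<phi> (As @ (x, x) # Bs) = 0"
    using assms
  proof (induction As arbitrary: b G \<phi>)
    case Nil
    show ?case
      using Nil value_linearD[where \<phi> = \<phi>, OF Nil.prems(3)]
      by (simp add: wedge_form_curried shuffle_linear shuffle_scale_left value_additiveD
          shuffle_scale_right wedge_formD signed_add signed_scale scale_right_distrib)
  next
    case (Cons A As)
    show ?case
      using Cons.IH[OF Cons.prems(1) wedge_form_Cons[OF Cons.prems(2), of A] Cons.prems(3), of "\<not> b"]
        Cons.IH[OF wedge_form_Cons[OF Cons.prems(1), where X = A] Cons.prems(2,3), of b]
      by (simp add: signed_add signed_scale scale_right_distrib)
  qed
qed

lemma wedge_form_add:
  "wedge_form scale scale F \<Longrightarrow> wedge_form scale scale G \<Longrightarrow> wedge_form scale scale (\<lambda>Ys. F Ys + G Ys)"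
  by (simp add: wedge_form_def scale_right_distrib)

lemma cochain_comp_degree:
  assumes "P \<in> cochains scale scale p" and "Q \<in> cochains scale scale q" and "length Xs \<noteq> p + q"
  shows "fst (cochain_comp (odd q) P Q) Xs = 0" and "snd (cochain_comp (odd q) P Q) Xs x = 0"
proof -
  show "fst (cochain_comp (odd q) P Q) Xs = 0" and "snd (cochain_comp (odd q) P Q) Xs x = 0"
    unfolding circ_eq_comp[OF vector_space_axioms assms(1,2), symmetric]
    using assms(3) by (simp_all add: circ_def hom_part_def)
qed

lemma cochain_comp_cochains:
  assumes "P \<in> cochains scale scale p" and "Q \<in> cochains scale scale q"
  shows "cochain_comp (odd q) P Q \<in> cochains scale scale (p + q)"
proof -
  note vs = vector_space_axioms
  have P: "p = 0 \<Longrightarrow> fst P = 0" "wedge_form scale scale (fst P)" "\<And>x. wedge_form scale scale (\<lambda>Ys. snd P Ys x)"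
    "\<And>Ys c x y. snd P Ys (scale c x + y) = scale c (snd P Ys x) + snd P Ys y"
    using assms(1) unfolding cochains_iff[OF vs vs] by blast+
  have Q: "q = 0 \<Longrightarrow> fst Q = 0" "wedge_form scale scale (fst Q)" "\<And>x. wedge_form scale scale (\<lambda>Ys. snd Q Ys x)"
    "\<And>Ys c x y. snd Q Ys (scale c x + y) = scale c (snd Q Ys x) + snd Q Ys y"
    using assms(2) unfolding cochains_iff[OF vs vs] by blast+
  note vP = value_linearD[where \<phi> = "snd P", OF P(4)]
  show ?thesis
    unfolding cochains_iff[OF vs vs]
  proof (intro conjI allI impI)
    show "fst (cochain_comp (odd q) P Q) = 0" if "p + q = 0"
      using that P(1) Q(1) shuffle_zero_left[OF vP(1)]
      by (simp add: cochain_comp_def zero_fun_def insert_into_linear)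
    show "wedge_form scale scale (fst (cochain_comp (odd q) P Q))"
      using P Q by (simp add: cochain_comp_def wedge_form_add wedge_form_shuffle wedge_form_insert_into)
    show "wedge_form scale scale (\<lambda>Ys. snd (cochain_comp (odd q) P Q) Ys x)" for x
      using P Q
      by (simp add: cochain_comp_def cochain_comp_snd_def wedge_form_add wedge_form_shuffle wedge_form_insert_into)
    show "snd (cochain_comp (odd q) P Q) Ys (scale c x + y)
      = scale c (snd (cochain_comp (odd q) P Q) Ys x) + snd (cochain_comp (odd q) P Q) Ys y" for Ys c x y
      using P(4) Q(4) vP
      by (simp add: cochain_comp_def cochain_comp_snd_def shuffle_linear shuffle_scale_left
          insert_into_linear insert_into_scale_right scale_right_distrib)
  qed (use cochain_comp_degree[OF assms] in auto)
qed

end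

section \<open>Derived brackets\<close>

lemma split_sum_additive:
  assumes "\<And>x y. f (x + y) = f x + f y"
  shows "f (split_sum par F zs) = split_sum par (\<lambda>S T. f (F S T)) zs"
proof -
  have "f 0 = 0" using assms[of 0 0] by simp
  then have "f (- x) = - f x" for x using assms[of "- x" x] by (simp add: eq_neg_iff_add_eq_0)
  then have "f (signed b x) = signed b (f x)" for b x by (simp add: signed_def)
  then show ?thesis by (induction zs arbitrary: F) (simp_all add: assms)
qed

text \<open>Voronov's data, with the degrees kept as a family of additive subgroups.
  \<open>br_jacobi\<close> says that bracketing on the right is a graded derivation;
  \<open>pr_br\<close>, together with \<open>pr_abelian\<close>, encodes the splitting into an
  abelian image and a kernel closed under brackets. \<open>no_2_torsion\<close> is for the last
  step, where the Jacobi sum appears twice.\<close>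

locale derived_brackets =
  fixes C :: "int \<Rightarrow> 'a::ab_group_add set" and br :: "'a \<Rightarrow> 'a \<Rightarrow> 'a" and pr :: "'a \<Rightarrow> 'a" and \<Delta> :: 'a
  assumes zero_closed: "0 \<in> C p"
    and add_closed: "x \<in> C p \<Longrightarrow> y \<in> C p \<Longrightarrow> x + y \<in> C p"
    and uminus_closed: "x \<in> C p \<Longrightarrow> - x \<in> C p"
    and br_closed: "x \<in> C p \<Longrightarrow> y \<in> C q \<Longrightarrow> br x y \<in> C (p + q)"
    and br_add_left: "x \<in> C p \<Longrightarrow> y \<in> C p \<Longrightarrow> z \<in> C q \<Longrightarrow> br (x + y) z = br x z + br y z"
    and br_skew: "x \<in> C p \<Longrightarrow> y \<in> C q \<Longrightarrow> br y x = signed (even p \<or> even q) (br x y)"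
    and br_jacobi: "x \<in> C p \<Longrightarrow> y \<in> C q \<Longrightarrow> z \<in> C r \<Longrightarrow>
      br (br x y) z = br x (br y z) + signed (odd q \<and> odd r) (br (br x z) y)"
    and pr_closed: "x \<in> C p \<Longrightarrow> pr x \<in> C p"
    and pr_add: "pr (x + y) = pr x + pr y"
    and pr_pr: "pr (pr x) = pr x"
    and pr_abelian: "x \<in> C p \<Longrightarrow> y \<in> C q \<Longrightarrow> br (pr x) (pr y) = 0"
    and pr_br: "x \<in> C p \<Longrightarrow> y \<in> C q \<Longrightarrow> pr (br x y) = pr (br (pr x) y) + pr (br x (pr y))"
    and Delta_degree: "\<Delta> \<in> C 1"
    and Delta_square: "br \<Delta> \<Delta> = 0"
    and no_2_torsion: "x + x = 0 \<Longrightarrow> (x :: 'a) = 0"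
begin

abbreviation par :: "int \<times> 'a \<Rightarrow> bool"
  where "par z \<equiv> odd (fst z)"

abbreviation odds :: "(int \<times> 'a) list \<Rightarrow> bool"
  where "odds S \<equiv> odd (length (filter par S))"

definition homogeneous :: "(int \<times> 'a) list \<Rightarrow> bool"
  where "homogeneous zs \<longleftrightarrow> (\<forall>(d, a) \<in> set zs. a \<in> C d)"

definition iterated :: "'a \<Rightarrow> (int \<times> 'a) list \<Rightarrow> 'a"
  where "iterated x zs = foldl br x (map snd zs)"

lemma iterated_simps [simp]: "iterated x [] = x" "iterated x (z # zs) = iterated (br x (snd z)) zs"
  by (simp_all add: iterated_def)

lemma homogeneous_simps [simp]: "homogeneous []" "homogeneous ((d, a) # zs) \<longleftrightarrow> a \<in> C d \<and> homogeneous zs"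
  by (auto simp: homogeneous_def)

lemma signed_closed: "x \<in> C p \<Longrightarrow> signed b x \<in> C p"
  by (simp add: signed_def uminus_closed)

lemma br_0_left: "z \<in> C q \<Longrightarrow> br 0 z = 0"
  using br_add_left[OF zero_closed zero_closed, of z q] by simp

lemma br_uminus_left: "x \<in> C p \<Longrightarrow> z \<in> C q \<Longrightarrow> br (- x) z = - br x z"
  using br_add_left[of "- x" p x z q] br_0_left[of z q] uminus_closed[of x p]
  by (simp add: eq_neg_iff_add_eq_0)

lemma br_signed_left: "x \<in> C p \<Longrightarrow> z \<in> C q \<Longrightarrow> br (signed b x) z = signed b (br x z)"
  by (simp add: signed_def br_uminus_left)

lemma br_0_right: "x \<in> C p \<Longrightarrow> br x 0 = 0"
  using br_skew[OF zero_closed, of x p] by (simp add: br_0_left)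

lemma pr_0: "pr 0 = 0"
  using pr_add[of 0 0] by simp

lemma pr_signed: "pr (signed b x) = signed b (pr x)"
  using pr_add[of "- x" x] by (simp add: signed_def pr_0 eq_neg_iff_add_eq_0)

lemma odd_sum_degrees: "odd (sum_list (map fst zs)) \<longleftrightarrow> odds zs"
  by (induction zs) auto

lemma iterated_closed:
  "x \<in> C p \<Longrightarrow> homogeneous zs \<Longrightarrow> iterated x zs \<in> C (p + sum_list (map fst zs))"
proof (induction zs arbitrary: x p)
  case (Cons z zs)
  obtain d a where z: "z = (d, a)" by fastforce
  with Cons.prems have a: "a \<in> C d" "homogeneous zs" by auto
  show ?case
    using Cons.IH[OF br_closed[OF Cons.prems(1) a(1)] a(2)] z by (simp add: add.assoc)
qed simp

lemma iterated_add:
  "x \<in> C p \<Longrightarrow> y \<in> C p \<Longrightarrow> homogeneous zs \<Longrightarrow> iterated (x + y) zs = iterated x zs + iterated y zs"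
proof (induction zs arbitrary: x y p)
  case (Cons z zs)
  obtain d a where z: "z = (d, a)" by fastforce
  with Cons.prems have a: "a \<in> C d" "homogeneous zs" by auto
  show ?case
    using Cons.IH[OF br_closed[OF Cons.prems(1) a(1)] br_closed[OF Cons.prems(2) a(1)] a(2)] z
    by (simp add: br_add_left[OF Cons.prems(1,2) a(1)])
qed simp

lemma iterated_signed:
  "x \<in> C p \<Longrightarrow> homogeneous zs \<Longrightarrow> iterated (signed b x) zs = signed b (iterated x zs)"
proof (induction zs arbitrary: x p)
  case (Cons z zs)
  obtain d a where z: "z = (d, a)" by fastforce
  with Cons.prems have a: "a \<in> C d" "homogeneous zs" by auto
  show ?case
    using Cons.IH[OF br_closed[OF Cons.prems(1) a(1)] a(2)] z
    by (simp add: br_signed_left[OF Cons.prems(1) a(1)])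
qed simp

lemma iterated_0: "homogeneous zs \<Longrightarrow> iterated 0 zs = 0"
  using iterated_add[OF zero_closed zero_closed, of zs] by simp

text \<open>Each right bracket acts on \<open>x\<close> or on \<open>y\<close> by the derivation
  rule; \<open>S\<close> collects those acting on \<open>x\<close>, and the sign beyond that of the
  splitting comes from moving \<open>S\<close> past \<open>y\<close>.\<close>

lemma iterated_br:
  assumes "x \<in> C p" and "y \<in> C q" and "homogeneous zs"
  shows "iterated (br x y) zs
    = split_sum par (\<lambda>S T. signed (odd q \<and> odds S) (br (iterated x S) (iterated y T))) zs"
  using assms
proof (induction zs arbitrary: x y p q)
  case (Cons z zs)
  obtain d a where z: "z = (d, a)" by fastforce
  with Cons.prems have a: "a \<in> C d" "homogeneous zs" by auto
  note x = Cons.prems(1) and y = Cons.prems(2)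
  have xy: "br x (br y a) \<in> C (p + q + d)" "br (br x a) y \<in> C (p + q + d)"
    using br_closed[OF x br_closed[OF y a(1)]] br_closed[OF br_closed[OF x a(1)] y]
    by (simp_all add: ac_simps)
  have "iterated (br x y) (z # zs)
    = iterated (br x (br y a)) zs + signed (odd q \<and> odd d) (iterated (br (br x a) y) zs)"
    using iterated_add[OF xy(1) signed_closed[OF xy(2)] a(2)] iterated_signed[OF xy(2) a(2)]
    by (simp add: z br_jacobi[OF x y a(1)])
  moreover have "iterated (br x (br y a)) zs
    = split_sum par (\<lambda>S T. signed (par z \<and> odds S) (signed (odd q \<and> odds S)
        (br (iterated x S) (iterated y (z # T))))) zs"
    unfolding Cons.IH[OF x br_closed[OF y a(1)] a(2)]
    by (intro arg_cong[where f = "\<lambda>F. split_sum par F zs"] ext) (auto simp: z signed_def)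
  moreover have "signed (odd q \<and> odd d) (iterated (br (br x a) y) zs)
    = split_sum par (\<lambda>S T. signed (odd q \<and> odds (z # S))
        (br (iterated x (z # S)) (iterated y T))) zs"
    unfolding Cons.IH[OF br_closed[OF x a(1)] y a(2)] split_sum_signed[symmetric]
    by (intro arg_cong[where f = "\<lambda>F. split_sum par F zs"] ext) (auto simp: z signed_def)
  ultimately show ?case by (simp add: add.commute)
qed simp

text \<open>\<open>h\<close> and the entries of \<open>zs\<close> lie in the abelian image of
  \<open>pr\<close>, so by the Jacobi identity the right brackets with them commute up to sign and
  \<open>h\<close> can be moved to the front.\<close>

lemma br_iterated_commute:
  assumes "x \<in> C p" and "h \<in> C e" and "pr h = h" and "homogeneous zs" and "\<forall>z\<in>set zs. pr (snd z) = snd z"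
  shows "br (iterated x zs) h = signed (odds zs \<and> odd e) (iterated (br x h) zs)"
  using assms
proof (induction zs arbitrary: x p)
  case (Cons z zs)
  obtain d a where z: "z = (d, a)" by fastforce
  with Cons.prems have a: "a \<in> C d" "homogeneous zs" "pr a = a" "\<forall>z\<in>set zs. pr (snd z) = snd z" by auto
  have "br a h = 0"
    using pr_abelian[OF a(1) Cons.prems(2)] a(3) Cons.prems(3) by simp
  then have "br (br x a) h = signed (odd d \<and> odd e) (br (br x h) a)"
    using br_jacobi[OF Cons.prems(1) a(1) Cons.prems(2)] by (simp add: br_0_right[OF Cons.prems(1)])
  moreover have "br (br x h) a \<in> C (p + e + d)"
    by (intro br_closed Cons.prems a)
  ultimately show ?case
    using Cons.IH[OF br_closed[OF Cons.prems(1) a(1)] Cons.prems(2,3) a(2,4)] z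
    by (auto simp: iterated_signed[OF _ a(2)] signed_signed intro!: arg_cong2[where f = signed])
qed simp

lemma br_swap:
  assumes "x \<in> C p" and "a \<in> C d" and "b \<in> C e" and "pr a = a" and "pr b = b"
  shows "br (br x b) a = signed (odd d \<and> odd e) (br (br x a) b)"
proof -
  have "br b a = 0" using pr_abelian[OF assms(3,2)] assms(4,5) by simp
  then show ?thesis
    using br_jacobi[OF assms(1,3,2)] by (simp add: br_0_right[OF assms(1)] conj_commute)
qed

lemma pick_adjacent:
  assumes "Suc i < n"
  shows "pick \<sigma> 0 n zs = pick \<sigma> 0 i zs @ zs ! \<sigma> i # zs ! \<sigma> (Suc i) # pick \<sigma> (Suc (Suc i)) n zs"
    and "pick (\<sigma> \<circ> transpose i (Suc i)) 0 n zs
      = pick \<sigma> 0 i zs @ zs ! \<sigma> (Suc i) # zs ! \<sigma> i # pick \<sigma> (Suc (Suc i)) n zs"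
proof -
  have u: "[0..<n] = [0..<i] @ i # Suc i # [Suc (Suc i)..<n]"
    using assms upt_add_eq_append[of 0 i "n - i"] by (simp add: upt_conv_Cons)
  show "pick \<sigma> 0 n zs = pick \<sigma> 0 i zs @ zs ! \<sigma> i # zs ! \<sigma> (Suc i) # pick \<sigma> (Suc (Suc i)) n zs"
    unfolding pick_def u by simp
  have "pick (\<sigma> \<circ> transpose i (Suc i)) 0 i zs = pick \<sigma> 0 i zs"
    "pick (\<sigma> \<circ> transpose i (Suc i)) (Suc (Suc i)) n zs = pick \<sigma> (Suc (Suc i)) n zs"
    by (auto simp: pick_def transpose_def intro!: map_cong)
  then show "pick (\<sigma> \<circ> transpose i (Suc i)) 0 n zs
      = pick \<sigma> 0 i zs @ zs ! \<sigma> (Suc i) # zs ! \<sigma> i # pick \<sigma> (Suc (Suc i)) n zs"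
    unfolding pick_def u by simp
qed

lemma iterated_append: "iterated x (S @ T) = iterated (iterated x S) T"
  by (simp add: iterated_def)

text \<open>Adjacent exchanges suffice, and for these \<open>br_swap\<close> and
  \<open>koszul_sign_adjacent\<close> produce the same sign.\<close>

lemma iterated_pick:
  assumes "\<sigma> permutes {..<length zs}" and "x \<in> C p" and "homogeneous zs"
    and "\<forall>z\<in>set zs. pr (snd z) = snd z"
  shows "iterated x (pick \<sigma> 0 (length zs) zs) = signed (koszul_sign (map fst zs) \<sigma> < 0) (iterated x zs)"
  using assms(1)
proof (induction rule: permutes_adjacent_induct)
  case id
  have "pick id 0 (length zs) zs = zs" by (simp add: pick_def map_nth)
  then show ?case by (simp only: koszul_sign_id) simp
next
  case (swap \<sigma> i)
  have nth: "zs ! \<sigma> j \<in> set zs" if "j < length zs" for j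
    using permutes_in_image[OF swap(1), of j] that by simp
  obtain d a where a: "zs ! \<sigma> i = (d, a)" by fastforce
  obtain e b where b: "zs ! \<sigma> (Suc i) = (e, b)" by fastforce
  have ab: "a \<in> C d" "pr a = a" "b \<in> C e" "pr b = b"
    using nth[of i] nth[of "Suc i"] swap(2) a b assms(3,4) by (auto simp: homogeneous_def)
  have hom: "homogeneous (pick \<sigma> j k zs)" if "k \<le> length zs" for j k
    using nth that assms(3) by (fastforce simp: homogeneous_def pick_def)
  obtain r where y: "iterated x (pick \<sigma> 0 i zs) \<in> C r"
    using iterated_closed[OF assms(2) hom[of i 0]] swap(2) by auto
  let ?y = "iterated x (pick \<sigma> 0 i zs)" and ?T = "pick \<sigma> (Suc (Suc i)) (length zs) zs"
  have "iterated x (pick (\<sigma> \<circ> transpose i (Suc i)) 0 (length zs) zs) = iterated (br (br ?y b) a) ?T"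
    unfolding pick_adjacent(2)[OF swap(2)] by (simp add: iterated_append a b)
  also have "\<dots> = signed (odd d \<and> odd e) (iterated (br (br ?y a) b) ?T)"
    unfolding br_swap[OF y ab(1,3,2,4)]
    by (rule iterated_signed[OF br_closed[OF br_closed[OF y ab(1)] ab(3)] hom]) simp
  also have "iterated (br (br ?y a) b) ?T = iterated x (pick \<sigma> 0 (length zs) zs)"
    unfolding pick_adjacent(1)[OF swap(2)] by (simp add: iterated_append a b)
  finally have 1: "iterated x (pick (\<sigma> \<circ> transpose i (Suc i)) 0 (length zs) zs)
    = signed (odd d \<and> odd e) (signed (koszul_sign (map fst zs) \<sigma> < 0) (iterated x zs))"
    unfolding swap(3) .
  have "map fst zs ! \<sigma> i = d" "map fst zs ! \<sigma> (Suc i) = e"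
    using permutes_in_image[OF swap(1), of i] permutes_in_image[OF swap(1), of "Suc i"] swap(2) a b
    by simp_all
  then have "koszul_sign (map fst zs) (\<sigma> \<circ> transpose i (Suc i))
      = (if odd (d * e) then - 1 else 1) * koszul_sign (map fst zs) \<sigma>"
    using koszul_sign_adjacent[of \<sigma> "map fst zs" i] swap(1,2) by (simp only: length_map)
  moreover have "koszul_sign (map fst zs) \<sigma> \<in> {1, - 1}" by (rule koszul_sign_values)
  ultimately show ?case
    unfolding 1 signed_signed by (intro arg_cong2[where f = signed] refl) (auto simp del: comp_apply)
qed

text \<open>Voronov: apply \<open>pr\<close> to the Leibniz expansion of the iterated bracket of \<open>[\<Delta>, \<Delta>] = 0\<close>.\<close>

theorem derived_jacobi:
  assumes hom: "homogeneous zs" and zs: "\<forall>z\<in>set zs. pr (snd z) = snd z"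
  shows "split_sum par (\<lambda>S T. pr (iterated (br \<Delta> (pr (iterated \<Delta> S))) T)) zs = 0"
proof -
  let ?L = "\<lambda>S T. pr (iterated (br \<Delta> (pr (iterated \<Delta> S))) T)"
  let ?N = "iterated \<Delta>"
  have sub: "homogeneous S" "\<forall>z\<in>set S. pr (snd z) = snd z" if "set S \<subseteq> set zs" for S
    using that hom zs by (auto simp: homogeneous_def)
  have N: "?N S \<in> C (1 + sum_list (map fst S))" if "set S \<subseteq> set zs" for S
    using iterated_closed[OF Delta_degree sub(1)[OF that]] .
  have comm: "br (?N T) (pr (?N S)) = signed (odds T \<and> \<not> odds S) (iterated (br \<Delta> (pr (?N S))) T)"
    if "set S \<subseteq> set zs" "set T \<subseteq> set zs" for S T
    using br_iterated_commute[OF Delta_degree pr_closed[OF N[OF that(1)]] pr_pr sub[OF that(2)]]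
    by (simp add: odd_sum_degrees)
  \<comment> \<open>\<open>pr_br\<close> splits the bracket of two iterated brackets into two Jacobi
    terms, the second with \<open>S\<close> and \<open>T\<close> exchanged. The sign (-1)^|S|, which
    comes from moving \<open>S\<close> past the odd \<Delta>, is exactly what leaves the first term
    unsigned.\<close>
  have expand: "pr (signed (odds S) (br (?N S) (?N T))) = ?L S T + signed (odds S \<and> odds T) (?L T S)"
    if S: "set S \<subseteq> set zs" and T: "set T \<subseteq> set zs" for S T
  proof -
    have "br (pr (?N S)) (?N T) = signed (odds S \<or> odds T) (br (?N T) (pr (?N S)))"
      using br_skew[OF N[OF T] pr_closed[OF N[OF S]]]
      by (cases "odds S"; cases "odds T") (simp_all add: odd_sum_degrees)
    then show ?thesis
      unfolding pr_signed pr_br[OF N[OF S] N[OF T]] comm[OF S T] comm[OF T S]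
      by (auto simp: pr_signed[of True, simplified] signed_add signed_def)
  qed
  have "0 = pr (iterated (br \<Delta> \<Delta>) zs)"
    using hom by (simp add: Delta_square iterated_0 pr_0)
  also have "\<dots> = split_sum par (\<lambda>S T. pr (signed (odds S) (br (?N S) (?N T)))) zs"
    unfolding iterated_br[OF Delta_degree Delta_degree hom] split_sum_additive[of pr, OF pr_add] by simp
  also have "\<dots> = split_sum par (\<lambda>S T. ?L S T + signed (odds S \<and> odds T) (?L T S)) zs"
    by (rule split_sum_cong) (rule expand)
  \<comment> \<open>The exchanged terms carry the sign required by \<open>split_sum_swap\<close>, so
    they reproduce the same sum.\<close>
  also have "\<dots> = split_sum par ?L zs + split_sum par ?L zs"
    by (simp add: split_sum_add split_sum_swap)
  finally show ?thesis using no_2_torsion by metis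
qed

end

section \<open>The graded Lie algebra of cochains\<close>

lemma vector_space_cochain_scale:
  assumes "vector_space t"
  shows "vector_space (cochain_scale t)"
proof -
  interpret vector_space t by fact
  show ?thesis
    by unfold_locales (auto simp: cochain_scale_def prod_eq_iff fun_eq_iff scale_right_distrib scale_left_distrib)
qed

lemma wedge_form_combination:
  assumes "vector_space t" and "wedge_form s t F" and "wedge_form s t G"
  shows "wedge_form s t (\<lambda>Ys. t c (F Ys) + G Ys)"
proof -
  interpret vector_space t by fact
  show ?thesis
    using assms(2,3) by (simp add: wedge_form_def scale_right_distrib scale_left_commute add_ac)
qed

lemma cochains_combination:
  assumes "vector_space s" and "vector_space t" and "P \<in> cochains s t p" and "Q \<in> cochains s t p"
  shows "cochain_scale t c P + Q \<in> cochains s t p"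
proof -
  interpret vector_space t by fact
  note P = assms(3)[unfolded cochains_iff[OF assms(1,2)]] and Q = assms(4)[unfolded cochains_iff[OF assms(1,2)]]
  show ?thesis
    unfolding cochains_iff[OF assms(1,2)]
    using P Q wedge_form_combination[OF assms(2), of s]
    by (simp add: cochain_scale_def plus_fun_def zero_fun_def scale_right_distrib scale_left_commute add_ac)
qed

lemma cochains_zero: "vector_space s \<Longrightarrow> vector_space t \<Longrightarrow> 0 \<in> cochains s t p"
proof -
  assume vs: "vector_space s" "vector_space t"
  interpret vector_space t by fact
  show ?thesis unfolding cochains_iff[OF vs] by (simp add: wedge_form_def)
qed

lemma cochains_subspace:
  assumes "vector_space s" and "vector_space t"
  shows "module.subspace (cochain_scale t) (cochains s t p)"
proof -
  interpret vector_space t by fact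
  interpret L: vector_space "cochain_scale t" by (rule vector_space_cochain_scale) fact
  show ?thesis
    unfolding L.subspace_def
    using cochains_zero[OF assms] cochains_combination[OF assms, of _ p _ 1] cochains_combination[OF assms, of _ p 0]
    by fastforce
qed

lemma C_star_subspace:
  assumes "vector_space s" and "vector_space t"
  shows "module.subspace (cochain_scale t) (C_star s t k)"
proof -
  interpret L: vector_space "cochain_scale t" by (rule vector_space_cochain_scale) fact
  show ?thesis
    using cochains_subspace[OF assms] by (simp add: C_star_def L.subspace_single_0)
qed

text \<open>Inhomogeneous cochains with no bound on the number of nonzero components. The set
  contains the total space and is closed under \<open>LieY\<close>, so multilinearity can be proved
  on it degree by degree.\<close>

definition all_cochains :: "('k::field \<Rightarrow> 'e::ab_group_add \<Rightarrow> 'e) \<Rightarrow> ('k \<Rightarrow> 'f::ab_group_add \<Rightarrow> 'f)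
    \<Rightarrow> ('e, 'f) cochain set"
  where "all_cochains s t = {P. \<forall>p. hom_part p P \<in> cochains s t p}"

lemma hom_part_combination:
  assumes "vector_space t"
  shows "hom_part p (cochain_scale t c P + Q) = cochain_scale t c (hom_part p P) + hom_part p Q"
proof -
  interpret vector_space t by fact
  show ?thesis by (auto simp: hom_part_def cochain_scale_def prod_eq_iff fun_eq_iff)
qed

lemma all_cochains_combination:
  "vector_space s \<Longrightarrow> vector_space t \<Longrightarrow> P \<in> all_cochains s t \<Longrightarrow> Q \<in> all_cochains s t
    \<Longrightarrow> cochain_scale t c P + Q \<in> all_cochains s t"
  by (simp add: all_cochains_def hom_part_combination cochains_combination)

lemma hom_part_cochains: "P \<in> cochains s t p \<Longrightarrow> hom_part q P = (if q = p then P else 0)"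
  using hom_part_hom_part[of q p P] by (auto simp: cochains_def)

lemma cochains_all_cochains:
  "vector_space s \<Longrightarrow> vector_space t \<Longrightarrow> P \<in> cochains s t p \<Longrightarrow> P \<in> all_cochains s t"
  by (simp add: all_cochains_def hom_part_cochains cochains_zero)

context vector_space
begin

lemma cochain_scale_sign:
  "cochain_scale scale ((- 1) ^ (p * q)) X = signed (odd p \<and> odd q) X"
proof -
  have "(- 1) ^ (p * q) = (if odd p \<and> odd q then - 1 else (1::'a))" by simp
  then show ?thesis by (auto simp: cochain_scale_def prod_eq_iff fun_eq_iff)
qed

lemma LieY_hom_eq:
  assumes "P \<in> cochains scale scale p" and "Q \<in> cochains scale scale q"
  shows "LieY_hom scale p q P Q
    = cochain_comp (odd q) P Q - signed (odd p \<and> odd q) (cochain_comp (odd p) Q P)"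
  unfolding LieY_hom_def circ_eq_comp[OF vector_space_axioms assms]
    circ_eq_comp[OF vector_space_axioms assms(2,1)] cochain_scale_sign ..

lemma LieY_eq:
  assumes "P \<in> cochains scale scale p" and "Q \<in> cochains scale scale q"
  shows "LieY scale P Q
    = cochain_comp (odd q) P Q - signed (odd p \<and> odd q) (cochain_comp (odd p) Q P)"
  unfolding LieY_homogeneous[OF vector_space_axioms assms] LieY_hom_eq[OF assms] ..

lemma cochains_signed: "P \<in> cochains scale scale p \<Longrightarrow> signed b P \<in> cochains scale scale p"
proof -
  interpret L: vector_space "cochain_scale scale"
    by (rule vector_space_cochain_scale) (rule vector_space_axioms)
  show "P \<in> cochains scale scale p \<Longrightarrow> signed b P \<in> cochains scale scale p"
    using L.subspace_neg[OF cochains_subspace[OF vector_space_axioms vector_space_axioms]]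
    by (simp add: signed_def)
qed

lemma cochains_diff:
  "P \<in> cochains scale scale p \<Longrightarrow> Q \<in> cochains scale scale p \<Longrightarrow> P - Q \<in> cochains scale scale p"
proof -
  interpret L: vector_space "cochain_scale scale"
    by (rule vector_space_cochain_scale) (rule vector_space_axioms)
  show "P \<in> cochains scale scale p \<Longrightarrow> Q \<in> cochains scale scale p \<Longrightarrow> P - Q \<in> cochains scale scale p"
    by (rule L.subspace_diff[OF cochains_subspace[OF vector_space_axioms vector_space_axioms]])
qed

lemma LieY_hom_cochains:
  assumes "P \<in> cochains scale scale p" and "Q \<in> cochains scale scale q"
  shows "LieY_hom scale p q P Q \<in> cochains scale scale (p + q)"
  unfolding LieY_hom_eq[OF assms]
  using cochain_comp_cochains[OF assms] cochain_comp_cochains[OF assms(2,1)]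
  by (intro cochains_diff cochains_signed) (simp_all add: add.commute)

lemma LieY_cochains:
  assumes "P \<in> cochains scale scale p" and "Q \<in> cochains scale scale q"
  shows "LieY scale P Q \<in> cochains scale scale (p + q)"
  unfolding LieY_homogeneous[OF vector_space_axioms assms] by (rule LieY_hom_cochains[OF assms])

lemma LieY_skew:
  assumes "P \<in> cochains scale scale p" and "Q \<in> cochains scale scale q"
  shows "LieY scale Q P = signed (even p \<or> even q) (LieY scale P Q)"
  unfolding LieY_eq[OF assms] LieY_eq[OF assms(2,1)]
  by (cases "odd p"; cases "odd q") simp_all

text \<open>The commutator of a graded pre-Lie product is a graded Lie bracket. The twelve
  compositions are grouped by their leftmost factor, hence one pre-Lie instance for each of P, Q and
  R.\<close>

lemma LieY_jacobi:
  assumes "P \<in> cochains scale scale p" and "Q \<in> cochains scale scale q" and "R \<in> cochains scale scale r"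
  shows "LieY scale (LieY scale P Q) R
    = LieY scale P (LieY scale Q R) + signed (odd q \<and> odd r) (LieY scale (LieY scale P R) Q)"
proof -
  note closed = LieY_cochains
  note additive = cochains_additive[OF vector_space_axioms]
  note aP = additive[OF assms(1)] and aQ = additive[OF assms(2)] and aR = additive[OF assms(3)]
  have pre: "cochain_comp c (cochain_comp b P Q) R
    = signed (b \<and> c) (cochain_comp b (cochain_comp c P R) Q - cochain_comp (b \<noteq> c) P (cochain_comp b R Q))
      + cochain_comp (b \<noteq> c) P (cochain_comp c Q R)"
    if "additive_cochain a P" "additive_cochain b Q" "additive_cochain c R" for a b c P Q and R :: "('b, 'b) cochain"
    using cochain_comp_pre_Lie[OF that] by (simp add: diff_eq_eq)
  note pre1 = pre[OF aP aQ aR] and pre2 = pre[OF aQ aP aR] and pre3 = pre[OF aR aP aQ]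
  note lin = cochain_comp_add_left cochain_comp_diff_left cochain_comp_uminus_left
    cochain_comp_add_right[OF aP] cochain_comp_add_right[OF aQ] cochain_comp_add_right[OF aR]
    cochain_comp_uminus_right[OF aP] cochain_comp_uminus_right[OF aQ] cochain_comp_uminus_right[OF aR]
    cochain_comp_diff_right[OF aP] cochain_comp_diff_right[OF aQ] cochain_comp_diff_right[OF aR]
  have "LieY scale (LieY scale P Q) R = cochain_comp (odd r) (LieY scale P Q) R
     - signed (odd (p + q) \<and> odd r) (cochain_comp (odd (p + q)) R (LieY scale P Q))"
    by (rule LieY_eq[OF closed[OF assms(1,2)] assms(3)])
  moreover have "LieY scale P (LieY scale Q R) = cochain_comp (odd (q + r)) P (LieY scale Q R)
     - signed (odd p \<and> odd (q + r)) (cochain_comp (odd p) (LieY scale Q R) P)"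
    by (rule LieY_eq[OF assms(1) closed[OF assms(2,3)]])
  moreover have "LieY scale (LieY scale P R) Q = cochain_comp (odd q) (LieY scale P R) Q
     - signed (odd (p + r) \<and> odd q) (cochain_comp (odd (p + r)) Q (LieY scale P R))"
    by (rule LieY_eq[OF closed[OF assms(1,3)] assms(2)])
  ultimately show ?thesis
    unfolding LieY_eq[OF assms(1,2)] LieY_eq[OF assms(2,3)] LieY_eq[OF assms(1,3)]
    using pre1 pre2 pre3
    by (cases "odd p"; cases "odd q"; cases "odd r")
      (simp_all add: lin diff_conv_add_uminus ac_simps del: add_uminus_conv_diff uminus_add_conv_diff)
qed

lemma cochain_comp_scale_left:
  "cochain_comp b (cochain_scale scale c P) Q = cochain_scale scale c (cochain_comp b P Q)"
  by (simp add: cochain_comp_def cochain_comp_snd_def[abs_def] cochain_scale_def shuffle_scale_right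
      insert_into_scale_right scale_right_distrib)

lemma cochain_comp_scale_right:
  assumes "P \<in> cochains scale scale p"
  shows "cochain_comp b P (cochain_scale scale c Q) = cochain_scale scale c (cochain_comp b P Q)"
proof -
  have P: "wedge_form scale scale (fst P)" "\<And>x. wedge_form scale scale (\<lambda>Ys. snd P Ys x)"
    "\<And>Ys c x y. snd P Ys (scale c x + y) = scale c (snd P Ys x) + snd P Ys y"
    using assms unfolding cochains_iff[OF vector_space_axioms vector_space_axioms] by blast+
  note vP = value_linearD(2)[where \<phi> = "snd P", OF P(3)]
  show ?thesis
    using P vP
    by (simp add: cochain_comp_def cochain_comp_snd_def[abs_def] cochain_scale_def shuffle_scale_left
        insert_into_scale_left scale_right_distrib)
qed

lemma cochain_scale_right_distrib:
  "cochain_scale scale c (P + Q) = cochain_scale scale c P + cochain_scale scale c Q"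
  "cochain_scale scale c (P - Q) = cochain_scale scale c P - cochain_scale scale c Q"
  "cochain_scale scale c (signed b P) = signed b (cochain_scale scale c P)"
  by (cases b; simp add: cochain_scale_def prod_eq_iff fun_eq_iff scale_right_distrib scale_right_diff_distrib)+

lemma LieY_hom_combination:
  assumes "P \<in> cochains scale scale p" "P' \<in> cochains scale scale p" "Q \<in> cochains scale scale q"
  shows "LieY_hom scale p q (cochain_scale scale c P + P') Q
      = cochain_scale scale c (LieY_hom scale p q P Q) + LieY_hom scale p q P' Q"
    and "LieY_hom scale q p Q (cochain_scale scale c P + P')
      = cochain_scale scale c (LieY_hom scale q p Q P) + LieY_hom scale q p Q P'"
proof -
  note PP = cochains_combination[OF vector_space_axioms vector_space_axioms assms(1,2), of c]
  note Q = cochains_additive[OF vector_space_axioms assms(3)]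
  show "LieY_hom scale p q (cochain_scale scale c P + P') Q
      = cochain_scale scale c (LieY_hom scale p q P Q) + LieY_hom scale p q P' Q"
    "LieY_hom scale q p Q (cochain_scale scale c P + P')
      = cochain_scale scale c (LieY_hom scale q p Q P) + LieY_hom scale q p Q P'"
    unfolding LieY_hom_eq[OF PP assms(3)] LieY_hom_eq[OF assms(3) PP] LieY_hom_eq[OF assms(1,3)]
      LieY_hom_eq[OF assms(2,3)] LieY_hom_eq[OF assms(3,1)] LieY_hom_eq[OF assms(3,2)]
    by (simp_all add: cochain_comp_add_left cochain_comp_add_right[OF Q] cochain_comp_scale_left
        cochain_comp_scale_right[OF assms(3)] cochain_scale_right_distrib signed_add)
qed

lemma cochain_eqI: "(\<And>n. hom_part n P = hom_part n Q) \<Longrightarrow> P = Q"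
  for P Q :: "('e, 'f::zero) cochain"
  unfolding hom_part_def prod_eq_iff fun_eq_iff fst_conv snd_conv by (metis)

lemma hom_part_sum: "hom_part n (\<Sum>i\<in>I. F i) = (\<Sum>i\<in>I. hom_part n (F i))"
  for F :: "'i \<Rightarrow> ('e, 'f::ab_group_add) cochain"
proof (induction I rule: infinite_finite_induct)
  case (insert i I)
  have "hom_part n (P + Q) = hom_part n P + hom_part n Q" for P Q :: "('e, 'f) cochain"
    by (auto simp: hom_part_def prod_eq_iff fun_eq_iff)
  with insert show ?case by simp
qed (auto simp: hom_part_def prod_eq_iff fun_eq_iff)

lemma hom_part_LieY:
  assumes "P \<in> all_cochains scale scale" and "Q \<in> all_cochains scale scale"
  shows "hom_part n (LieY scale P Q) = (\<Sum>p\<le>n. LieY_hom scale p (n - p) (hom_part p P) (hom_part (n - p) Q))"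
proof -
  let ?S = "\<Sum>p\<le>n. LieY_hom scale p (n - p) (hom_part p P) (hom_part (n - p) Q)"
  have "hom_part n (LieY scale P Q) = hom_part n ?S"
    by (auto simp: LieY_def Let_def hom_part_def prod_eq_iff fun_eq_iff)
  also have "\<dots> = (\<Sum>p\<le>n. hom_part n (LieY_hom scale p (n - p) (hom_part p P) (hom_part (n - p) Q)))"
    by (rule hom_part_sum)
  also have "\<dots> = ?S"
  proof (intro sum.cong refl)
    fix p assume "p \<in> {..n}"
    then show "hom_part n (LieY_hom scale p (n - p) (hom_part p P) (hom_part (n - p) Q))
      = LieY_hom scale p (n - p) (hom_part p P) (hom_part (n - p) Q)"
      using LieY_hom_cochains[of "hom_part p P" p "hom_part (n - p) Q" "n - p"] assms
      by (simp add: all_cochains_def hom_part_cochains)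
  qed
  finally show ?thesis .
qed

lemma LieY_all_cochains:
  assumes "P \<in> all_cochains scale scale" and "Q \<in> all_cochains scale scale"
  shows "LieY scale P Q \<in> all_cochains scale scale"
proof -
  interpret L: vector_space "cochain_scale scale"
    by (rule vector_space_cochain_scale) (rule vector_space_axioms)
  have "(\<Sum>p\<le>n. LieY_hom scale p (n - p) (hom_part p P) (hom_part (n - p) Q)) \<in> cochains scale scale n" for n
  proof (rule L.subspace_sum[OF cochains_subspace[OF vector_space_axioms vector_space_axioms]])
    fix p assume "p \<in> {..n}"
    then show "LieY_hom scale p (n - p) (hom_part p P) (hom_part (n - p) Q) \<in> cochains scale scale n"
      using LieY_hom_cochains[of "hom_part p P" p "hom_part (n - p) Q" "n - p"] assms
      by (simp add: all_cochains_def)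
  qed
  then show ?thesis
    using hom_part_LieY[OF assms] by (simp add: all_cochains_def)
qed

lemma LieY_combination:
  assumes "P \<in> all_cochains scale scale" "P' \<in> all_cochains scale scale" "Q \<in> all_cochains scale scale"
  shows "LieY scale (cochain_scale scale c P + P') Q
      = cochain_scale scale c (LieY scale P Q) + LieY scale P' Q"
    and "LieY scale Q (cochain_scale scale c P + P')
      = cochain_scale scale c (LieY scale Q P) + LieY scale Q P'"
proof -
  interpret L: vector_space "cochain_scale scale"
    by (rule vector_space_cochain_scale) (rule vector_space_axioms)
  note PP = all_cochains_combination[OF vector_space_axioms vector_space_axioms assms(1,2), of c]
  have 1: "LieY_hom scale p (n - p) (cochain_scale scale c (hom_part p P) + hom_part p P') (hom_part (n - p) Q)
    = cochain_scale scale c (LieY_hom scale p (n - p) (hom_part p P) (hom_part (n - p) Q))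
      + LieY_hom scale p (n - p) (hom_part p P') (hom_part (n - p) Q)" for p n
    by (rule LieY_hom_combination(1)) (use assms in \<open>simp_all add: all_cochains_def\<close>)
  have 2: "LieY_hom scale p (n - p) (hom_part p Q) (cochain_scale scale c (hom_part (n - p) P) + hom_part (n - p) P')
    = cochain_scale scale c (LieY_hom scale p (n - p) (hom_part p Q) (hom_part (n - p) P))
      + LieY_hom scale p (n - p) (hom_part p Q) (hom_part (n - p) P')" for p n
    by (rule LieY_hom_combination(2)) (use assms in \<open>simp_all add: all_cochains_def\<close>)
  show "LieY scale (cochain_scale scale c P + P') Q
      = cochain_scale scale c (LieY scale P Q) + LieY scale P' Q"
    by (rule cochain_eqI) (simp add: hom_part_combination[OF vector_space_axioms] hom_part_LieY PP assms 1
        sum.distrib L.scale_sum_right)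
  show "LieY scale Q (cochain_scale scale c P + P')
      = cochain_scale scale c (LieY scale Q P) + LieY scale Q P'"
    by (rule cochain_eqI) (simp add: hom_part_combination[OF vector_space_axioms] hom_part_LieY PP assms 2
        sum.distrib L.scale_sum_right)
qed

end

section \<open>The semidirect product\<close>

context lie_yamaguti_representation
begin

abbreviation scale_sum (infixr \<open>*\<^sub>E\<close> 75)
  where "scale_sum \<equiv> module_prod.scale scale scaleV"

abbreviation D where "D \<equiv> LY_D br \<rho> \<mu>"
abbreviation \<Delta> where "\<Delta> \<equiv> Delta br tri \<rho> \<mu>"

lemma scale_sum_eq: "c *\<^sub>E x = (scale c (fst x), scaleV c (snd x))"
proof -
  interpret vector_space_prod scale scaleV ..
  show ?thesis by (simp add: scale_def)
qed

lemma vector_space_sum: "vector_space scale_sum"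
proof -
  interpret vector_space_prod scale scaleV ..
  show ?thesis by (rule p.vector_space_axioms)
qed

sublocale E: vector_space scale_sum
  by (rule vector_space_sum)

lemmas cochains_sum_iff = cochains_iff[OF vector_space_sum vector_space_sum]
lemmas cochains_V_iff = cochains_iff[OF V.vector_space_axioms vector_space_axioms]

lemma linear_simps:
  "Vector_Spaces.linear s t f \<Longrightarrow> f (x + y) = f x + f y"
  "Vector_Spaces.linear s t f \<Longrightarrow> f (x - y) = f x - f y"
  "Vector_Spaces.linear s t f \<Longrightarrow> f (- x) = - f x"
  "Vector_Spaces.linear s t f \<Longrightarrow> f 0 = 0"
  "Vector_Spaces.linear s t f \<Longrightarrow> f (s c x) = t c (f x)"
  unfolding linear_iff_module_hom
  by (auto simp: module_hom.add module_hom.diff module_hom.neg module_hom.zero module_hom.scale)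

lemmas br_simps = linear_simps[OF br_linear1] linear_simps[OF br_linear2]
lemmas tri_simps = linear_simps[OF tri_linear1] linear_simps[OF tri_linear2] linear_simps[OF tri_linear3]
lemmas rho_simps = linear_simps[OF rho_linear1] linear_simps[OF rho_linear2]
lemmas mu_simps = linear_simps[OF mu_linear1] linear_simps[OF mu_linear2] linear_simps[OF mu_linear3]

lemma D_simps:
  "D (x + x') y u = D x y u + D x' y u" "D x (y + y') u = D x y u + D x y' u"
  "D x y (u + u') = D x y u + D x y u'" "D x y (u - u') = D x y u - D x y u'"
  "D (scale c x) y u = scaleV c (D x y u)" "D x (scale c y) u = scaleV c (D x y u)"
  "D x y (scaleV c u) = scaleV c (D x y u)"
  "D 0 y u = 0" "D x 0 u = 0" "D x y 0 = 0" "D x x u = 0"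
  by (simp_all add: LY_D_def br_simps rho_simps mu_simps br_alt V.scale_right_distrib V.scale_right_diff_distrib)

text \<open>\<open>D z p\<close> is assembled from \<mu>, \<rho> and \<open>br z p\<close>. By
  \<open>rep5\<close>, \<open>rep3\<close> and \<open>LY3\<close>, commuting \<open>D x y\<close>
  with each of these acts on the arguments as the derivation \<open>tri x y\<close>, hence also for
  \<open>D z p\<close>.\<close>

lemma D_tri: "D x y (D z p s) = D (tri x y z) p s + D z (tri x y p) s + D z p (D x y s)"
proof -
  have r: "\<rho> (br (tri x y z) p) s + \<rho> (br z (tri x y p)) s = D x y (\<rho> (br z p) s) - \<rho> (br z p) (D x y s)"
    using rep3[of x y "br z p" s] by (simp add: LY3 rho_simps)
  have m: "\<mu> (tri x y z) w u + \<mu> z (tri x y w) u = D x y (\<mu> z w u) - \<mu> z w (D x y u)" for z w u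
    by (rule rep5)
  have "D (tri x y z) p s + D z (tri x y p) s
    = (\<mu> (tri x y p) z s + \<mu> p (tri x y z) s) - (\<mu> (tri x y z) p s + \<mu> z (tri x y p) s)
      + (\<rho> (tri x y z) (\<rho> p s) - \<rho> p (\<rho> (tri x y z) s) + \<rho> z (\<rho> (tri x y p) s) - \<rho> (tri x y p) (\<rho> z s))
      - (\<rho> (br (tri x y z) p) s + \<rho> (br z (tri x y p)) s)"
    by (simp add: LY_D_def)
  also have "\<dots> = D x y (D z p s) - D z p (D x y s)"
    unfolding m r rep3 by (simp add: LY_D_def[of br \<rho> \<mu> z p] D_simps rho_simps)
  finally show ?thesis by simp
qed

definition bracket_sum :: "'g \<times> 'v \<Rightarrow> 'g \<times> 'v \<Rightarrow> 'g \<times> 'v"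
  where "bracket_sum e f = (br (fst e) (fst f), \<rho> (fst e) (snd f) - \<rho> (fst f) (snd e))"

definition triple_sum :: "'g \<times> 'v \<Rightarrow> 'g \<times> 'v \<Rightarrow> 'g \<times> 'v \<Rightarrow> 'g \<times> 'v"
  where "triple_sum e f g = (tri (fst e) (fst f) (fst g),
    D (fst e) (fst f) (snd g) + \<mu> (fst f) (fst g) (snd e) - \<mu> (fst e) (fst g) (snd f))"

text \<open>In the V-component \<open>rep3\<close> moves D past \<rho>, and \<open>rep2\<close>
  expands \<mu> at a bracket.\<close>

lemma semidirect_LY3:
  "triple_sum e f (bracket_sum g h) = bracket_sum (triple_sum e f g) h + bracket_sum g (triple_sum e f h)"
proof -
  have 2: "\<mu> x (br y z) u = \<rho> y (\<mu> x z u) - \<rho> z (\<mu> x y u)" for x y z u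
    using rep2[of x y z u] by (simp add: algebra_simps)
  show ?thesis
    by (simp add: triple_sum_def bracket_sum_def LY3 2 rep3 D_simps rho_simps algebra_simps)
qed

text \<open>Compare the terms in each vector part: that of \<open>k\<close> gives
  \<open>D_tri\<close>, those of \<open>g\<close> and \<open>h\<close> give \<open>rep5\<close>,
  those of \<open>e\<close> and \<open>f\<close> give \<open>rep4\<close>.\<close>

lemma semidirect_LY4:
  "triple_sum e f (triple_sum g h k) = triple_sum (triple_sum e f g) h k
    + triple_sum g (triple_sum e f h) k + triple_sum g h (triple_sum e f k)"
proof -
  have 4: "\<mu> x (tri y z w) u = \<mu> z w (\<mu> x y u) - \<mu> y w (\<mu> x z u) + D y z (\<mu> x w u)" for x y z w u
    using rep4[of z w x y u] by (simp add: algebra_simps)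
  have 5: "D x y (\<mu> z w u) = \<mu> (tri x y z) w u + \<mu> z (tri x y w) u + \<mu> z w (D x y u)" for x y z w u
    using rep5[of x y z w u] by (simp add: algebra_simps)
  show ?thesis
    by (simp add: triple_sum_def LY4[of "fst e" "fst f" "fst g"] D_tri[of "fst e" "fst f" "fst g"]
        4[of _ "fst g" "fst h" "fst k"] 5[of "fst e" "fst f"] D_simps mu_simps)
qed

lemma Delta_simps:
  "fst \<Delta> [X] = bracket_sum (fst X) (snd X)" "snd \<Delta> [X] z = triple_sum (fst X) (snd X) z"
  "length Xs \<noteq> 1 \<Longrightarrow> fst \<Delta> Xs = 0" "length Xs \<noteq> 1 \<Longrightarrow> snd \<Delta> Xs z = 0"
  by (auto simp: Delta_def bracket_sum_def triple_sum_def zero_prod_def split: list.splits prod.splits)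

lemma bracket_sum_linear:
  "bracket_sum (c *\<^sub>E x + y) z = c *\<^sub>E bracket_sum x z + bracket_sum y z"
  "bracket_sum z (c *\<^sub>E x + y) = c *\<^sub>E bracket_sum z x + bracket_sum z y"
  "bracket_sum x x = 0"
  by (simp_all add: bracket_sum_def scale_sum_eq br_simps rho_simps br_alt zero_prod_def
      V.scale_right_diff_distrib)

lemma triple_sum_linear:
  "triple_sum (c *\<^sub>E x + y) z w = c *\<^sub>E triple_sum x z w + triple_sum y z w"
  "triple_sum z (c *\<^sub>E x + y) w = c *\<^sub>E triple_sum z x w + triple_sum z y w"
  "triple_sum z w (c *\<^sub>E x + y) = c *\<^sub>E triple_sum z w x + triple_sum z w y"
  "triple_sum x x w = 0"
  by (simp_all add: triple_sum_def scale_sum_eq tri_simps mu_simps tri_alt D_simps zero_prod_def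
      V.scale_right_diff_distrib V.scale_right_distrib)

lemma scale_sum_0: "c *\<^sub>E 0 = 0"
  by (simp add: scale_sum_eq zero_prod_def)

lemma Delta_wedge:
  "wedge_form scale_sum scale_sum (fst \<Delta>)" "wedge_form scale_sum scale_sum (\<lambda>Ys. snd \<Delta> Ys w)"
  unfolding wedge_form_def
proof safe
  fix As Bs :: "(('g \<times> 'v) \<times> ('g \<times> 'v)) list" and c and x y z w :: "'g \<times> 'v"
  note simps = Delta_simps bracket_sum_linear triple_sum_linear scale_sum_0
  show "fst \<Delta> (As @ (c *\<^sub>E x + y, z) # Bs) = c *\<^sub>E fst \<Delta> (As @ (x, z) # Bs) + fst \<Delta> (As @ (y, z) # Bs)"
    "fst \<Delta> (As @ (z, c *\<^sub>E x + y) # Bs) = c *\<^sub>E fst \<Delta> (As @ (z, x) # Bs) + fst \<Delta> (As @ (z, y) # Bs)"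
    "fst \<Delta> (As @ (x, x) # Bs) = 0"
    "snd \<Delta> (As @ (c *\<^sub>E x + y, z) # Bs) w = c *\<^sub>E snd \<Delta> (As @ (x, z) # Bs) w + snd \<Delta> (As @ (y, z) # Bs) w"
    "snd \<Delta> (As @ (z, c *\<^sub>E x + y) # Bs) w = c *\<^sub>E snd \<Delta> (As @ (z, x) # Bs) w + snd \<Delta> (As @ (z, y) # Bs) w"
    "snd \<Delta> (As @ (x, x) # Bs) w = 0"
    by (cases As; cases Bs; simp add: simps)+
qed

text \<open>The two components are also recorded as separate cochains because they have different
  weights.\<close>

lemma Delta_parts_cochains:
  "(fst \<Delta>, 0) \<in> cochains scale_sum scale_sum 1" "(0, snd \<Delta>) \<in> cochains scale_sum scale_sum 1"
  "\<Delta> \<in> cochains scale_sum scale_sum 1"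
proof -
  have lin: "snd \<Delta> Ys (c *\<^sub>E x + y) = c *\<^sub>E snd \<Delta> Ys x + snd \<Delta> Ys y" for Ys c x y
  proof (cases "length Ys = 1")
    case True
    then obtain X where "Ys = [X]" by (auto simp: length_Suc_conv)
    then show ?thesis by (simp add: Delta_simps triple_sum_linear)
  qed (simp add: Delta_simps scale_sum_0)
  have 0: "wedge_form scale_sum scale_sum (\<lambda>Ys. 0)" "wedge_form scale_sum scale_sum 0"
    by (simp_all add: wedge_form_def scale_sum_0)
  show "(fst \<Delta>, 0) \<in> cochains scale_sum scale_sum 1" "(0, snd \<Delta>) \<in> cochains scale_sum scale_sum 1"
    "\<Delta> \<in> cochains scale_sum scale_sum 1"
    unfolding cochains_sum_iff
    using lin 0 Delta_wedge by (auto simp: Delta_simps scale_sum_0)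
qed

lemma Delta_square: "LieY scale_sum \<Delta> \<Delta> = 0"
proof -
  note d = Delta_parts_cochains(3)
  have z: "bracket_sum 0 x = 0" "bracket_sum x 0 = 0" "triple_sum 0 x y = 0" "triple_sum x 0 y = 0"
    "triple_sum x y 0 = 0" for x y
    by (simp_all add: bracket_sum_def triple_sum_def zero_prod_def br_simps rho_simps tri_simps mu_simps D_simps)
  have "fst (cochain_comp True \<Delta> \<Delta>) Xs = 0 \<and> snd (cochain_comp True \<Delta> \<Delta>) Xs w = 0" for Xs w
  proof (cases "length Xs = 2")
    case True
    \<comment> \<open>At two pairs X, Y the two components of \<Delta> o \<Delta> are, up to sign,
      the defects of \<open>semidirect_LY3\<close> and \<open>semidirect_LY4\<close> with X as the
      acting pair.\<close>
    then obtain X Y where Xs: "Xs = [X, Y]" by (auto simp: length_Suc_conv numeral_2_eq_2)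
    show ?thesis
      by (simp add: Xs cochain_comp_def cochain_comp_snd_def Delta_simps deriv_slot_def z)
        (simp add: semidirect_LY3[of "fst X" "snd X"] semidirect_LY4[of "fst X" "snd X"])
  next
    case False
    then show ?thesis using E.cochain_comp_degree[OF d d, of Xs] by simp
  qed
  then have "cochain_comp True \<Delta> \<Delta> = 0" by (simp add: prod_eq_iff fun_eq_iff)
  then show ?thesis using E.LieY_eq[OF d d] by simp
qed

end

section \<open>The projection to \<open>C\<^sup>*(V, \<gg>)\<close>\<close>

lemma insert_into_killed:
  assumes "\<And>As x y Zs Bs. \<phi> (As @ (x, G Zs y) # Bs) = 0" and "\<And>As x y Zs Bs. \<phi> (As @ (G Zs x, y) # Bs) = 0"
  shows "insert_into b G \<phi> Xs = 0"
  using assms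
proof (induction Xs arbitrary: b G \<phi>)
  case (Cons X Xs)
  have "insert_into b G (\<lambda>Ys. \<phi> (X # Ys)) Xs = 0" for b
    by (rule Cons.IH) (use Cons.prems[of "X # _"] in auto)
  moreover have "insert_into b (\<lambda>Ys. G (X # Ys)) \<phi> Xs = 0" for b
    by (rule Cons.IH) (use Cons.prems in auto)
  ultimately show ?case
    using Cons.prems[of "[]"] by (simp add: deriv_slot_def)
qed simp

lemma shuffle_killed:
  "(\<And>Ys Zs. \<phi> Ys (G Zs) = 0) \<Longrightarrow> shuffle h b G \<phi> Xs = 0"
  by (induction Xs arbitrary: b G \<phi>) simp_all

lemma hom_part_embed_V: "hom_part p (embed_V P) = embed_V (hom_part p P)"
  by (auto simp: hom_part_def embed_V_def prod_eq_iff fun_eq_iff)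

lemma pr_g_embed_V: "pr_g (embed_V P) = P"
  by (auto simp: pr_g_def embed_V_def prod_eq_iff fun_eq_iff o_def map_prod_def split_beta)

lemma pr_g_add: "pr_g (P + Q) = pr_g P + pr_g Q"
  by (auto simp: pr_g_def prod_eq_iff fun_eq_iff)

lemma embed_V_add:
  fixes P Q :: "('v::ab_group_add, 'g::ab_group_add) cochain"
  shows "embed_V (P + Q) = embed_V P + embed_V Q"
  by (auto simp: embed_V_def prod_eq_iff fun_eq_iff)

abbreviation vlist :: "('v \<times> 'v) list \<Rightarrow> (('g::zero \<times> 'v) \<times> ('g \<times> 'v)) list"
  where "vlist \<equiv> map (map_prod (Pair 0) (Pair 0))"

lemma insert_into_vlist:
  fixes \<phi> :: "(('g::ab_group_add \<times> 'v::ab_group_add) \<times> ('g \<times> 'v)) list \<Rightarrow> 'g \<times> 'v"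
  assumes "\<And>Ys. fst (\<phi> (vlist Ys)) = 0" and "\<And>Ys v. fst (G (vlist Ys) (0, v)) = 0"
  shows "fst (insert_into b G \<phi> (vlist Xs)) = 0"
  using assms
proof (induction Xs arbitrary: b G \<phi>)
  case (Cons X Xs)
  have G: "G [] (0, v) = (0, snd (G [] (0, v)))" for v
    using Cons.prems(2)[of "[]" v] by (simp add: prod_eq_iff)
  have "fst (deriv_slot \<phi> [] (G []) (map_prod (Pair 0) (Pair 0) X) (vlist Xs)) = 0"
    using Cons.prems(1)[of "(fst X, snd (G [] (0, snd X))) # Xs"] Cons.prems(1)[of "(snd (G [] (0, fst X)), snd X) # Xs"]
    by (simp add: deriv_slot_def flip: G)
  moreover have "fst (insert_into b G (\<lambda>Ys. \<phi> (map_prod (Pair 0) (Pair 0) X # Ys)) (vlist Xs)) = 0" for b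
    by (rule Cons.IH) (use Cons.prems(1)[of "X # _"] Cons.prems(2) in auto)
  moreover have "fst (insert_into b (\<lambda>Ys. G (map_prod (Pair 0) (Pair 0) X # Ys)) \<phi> (vlist Xs)) = 0" for b
    by (rule Cons.IH) (use Cons.prems(2)[of "X # _"] Cons.prems(1) in auto)
  ultimately show ?case by (simp add: signed_def)
qed simp

lemma shuffle_vlist:
  fixes \<phi> :: "(('g::ab_group_add \<times> 'v::ab_group_add) \<times> ('g \<times> 'v)) list \<Rightarrow> 'g \<times> 'v \<Rightarrow> 'g \<times> 'v"
    and G :: "(('g \<times> 'v) \<times> ('g \<times> 'v)) list \<Rightarrow> 'g \<times> 'v"
  assumes "\<And>Ys v. fst (\<phi> (vlist Ys) (0, v)) = 0" and "\<And>Ys. fst (G (vlist Ys)) = 0"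
  shows "fst (shuffle h b G \<phi> (vlist Xs)) = 0"
proof -
  have G: "G (vlist Ys) = (0, snd (G (vlist Ys)))" if "\<And>Ys. fst (G (vlist Ys)) = 0"
    for G :: "(('g \<times> 'v) \<times> ('g \<times> 'v)) list \<Rightarrow> 'g \<times> 'v" and Ys
    using that by (simp add: prod_eq_iff)
  have GC: "fst (\<phi> [] (G (vlist Ys))) = 0"
    if "\<And>Ys v. fst (\<phi> (vlist Ys) (0, v)) = 0" "\<And>Ys. fst (G (vlist Ys)) = 0"
    for \<phi> :: "(('g \<times> 'v) \<times> ('g \<times> 'v)) list \<Rightarrow> 'g \<times> 'v \<Rightarrow> 'g \<times> 'v"
      and G :: "(('g \<times> 'v) \<times> ('g \<times> 'v)) list \<Rightarrow> 'g \<times> 'v" and Ys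
    using that(1)[of "[]" "snd (G (vlist Ys))"] G[of G Ys, OF that(2)] by simp
  show "fst (shuffle h b G \<phi> (vlist Xs)) = 0"
    using assms
  proof (induction Xs arbitrary: b G \<phi>)
    case Nil
    then show ?case using GC[of \<phi> G "[]"] by simp
  next
    case (Cons X Xs)
    have "fst (shuffle h b G (\<lambda>Ys. \<phi> (map_prod (Pair 0) (Pair 0) X # Ys)) (vlist Xs)) = 0" for b
      by (rule Cons.IH) (use Cons.prems(1)[of "X # _"] Cons.prems(2) in auto)
    moreover have "fst (shuffle h b (\<lambda>Ys. G (map_prod (Pair 0) (Pair 0) X # Ys)) \<phi> (vlist Xs)) = 0" for b
      by (rule Cons.IH) (use Cons.prems(2)[of "X # _"] Cons.prems(1) in auto)
    ultimately show ?case using GC[of \<phi> G "[X]"] Cons.prems by (simp add: signed_def)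
  qed
qed

text \<open>The kernel of \<open>pr_g\<close> consists of the cochains that send arguments from V
  into V, and such maps compose.\<close>

lemma pr_g_cochain_comp_eq_0:
  assumes "pr_g P = 0" and "pr_g Q = (0 :: ('v::ab_group_add, 'g::ab_group_add) cochain)"
  shows "pr_g (cochain_comp b P Q) = 0"
proof -
  have P: "fst (fst P (vlist Ys)) = 0" "fst (snd P (vlist Ys) (0, v)) = 0"
    and Q: "fst (fst Q (vlist Ys)) = 0" "fst (snd Q (vlist Ys) (0, v)) = 0" for Ys v
    using assms by (auto simp: pr_g_def prod_eq_iff fun_eq_iff)
  have "fst (fst (cochain_comp b P Q) (vlist Xs)) = 0" for Xs
    using shuffle_vlist[of "snd P" "fst Q", OF P(2) Q(1)] insert_into_vlist[of "fst P" "snd Q", OF P(1) Q(2)]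
    by (simp add: cochain_comp_def)
  moreover have "fst (snd (cochain_comp b P Q) (vlist Xs) (0, v)) = 0" for Xs v
    using shuffle_vlist[of "snd P" "\<lambda>Ys. snd Q Ys (0, v)", OF P(2) Q(2)]
      insert_into_vlist[of "\<lambda>Ys. snd P Ys (0, v)" "snd Q", OF P(2) Q(2)]
    by (simp add: cochain_comp_def cochain_comp_snd_def)
  ultimately show ?thesis
    by (auto simp: pr_g_def prod_eq_iff fun_eq_iff)
qed

context lie_yamaguti_representation
begin

lemma embed_V_scale: "embed_V (cochain_scale scale c P) = cochain_scale scale_sum c (embed_V P)"
  by (auto simp: embed_V_def cochain_scale_def scale_sum_eq prod_eq_iff fun_eq_iff)

lemma pr_g_scale: "pr_g (cochain_scale scale_sum c P) = cochain_scale scale c (pr_g P)"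
  by (auto simp: pr_g_def cochain_scale_def scale_sum_eq prod_eq_iff fun_eq_iff)

lemma embed_V_cochains:
  assumes "P \<in> cochains scaleV scale p"
  shows "embed_V P \<in> cochains scale_sum scale_sum p"
proof -
  note P = assms[unfolded cochains_V_iff]
  show ?thesis
    unfolding cochains_sum_iff
    using P by (simp add: embed_V_def wedge_form_def scale_sum_eq zero_prod_def zero_fun_def)
qed

lemma pr_g_cochains:
  assumes "P \<in> cochains scale_sum scale_sum p"
  shows "pr_g P \<in> cochains scaleV scale p"
proof -
  note P = assms[unfolded cochains_sum_iff]
  have pair: "(0, scaleV c x + y) = c *\<^sub>E (0, x) + (0, y)" for c x y
    by (simp add: scale_sum_eq)
  show ?thesis
    unfolding cochains_V_iff
    using P by (simp add: pr_g_def wedge_form_def pair zero_fun_def) (simp add: scale_sum_eq)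
qed

text \<open>Embedded cochains have values without V-component and see only the V-components of their
  arguments, so every composite of two of them is evaluated at a 0.\<close>

lemma embed_V_abelian:
  assumes "P \<in> cochains scaleV scale p" and "Q \<in> cochains scaleV scale q"
  shows "LieY scale_sum (embed_V P) (embed_V Q) = 0"
proof -
  have comp0: "cochain_comp b (embed_V P) (embed_V Q) = 0"
    if "P \<in> cochains scaleV scale p" "Q \<in> cochains scaleV scale q" for b P Q p q
  proof -
    note P = that(1)[unfolded cochains_V_iff]
    have w: "wedge_form scaleV scale (fst P)" "\<And>x. wedge_form scaleV scale (\<lambda>Ys. snd P Ys x)" using P by auto
    have sa: "\<phi> (As @ (0, y) # Bs) = 0 \<and> \<phi> (As @ (y, 0) # Bs) = 0" if "wedge_form scaleV scale \<phi>" for \<phi> As Bs y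
      using wedge_form_slot_additive[OF vector_space_axioms V.vector_space_axioms that]
      unfolding slot_additive_def by (metis add_0 add_cancel_left_right)
    have lin: "snd P Ys 0 = 0" for Ys
    proof -
      have "snd P Ys (scaleV 1 0 + 0) = scale 1 (snd P Ys 0) + snd P Ys 0" using P by blast
      then show ?thesis by simp
    qed
    have "insert_into b (snd (embed_V Q)) (fst (embed_V P)) Xs = 0" for Xs
      by (rule insert_into_killed) (simp_all add: embed_V_def sa[OF w(1)] zero_prod_def)
    moreover have "insert_into b (snd (embed_V Q)) (\<lambda>Ys. snd (embed_V P) Ys x) Xs = 0" for Xs x
      by (rule insert_into_killed) (simp_all add: embed_V_def sa[OF w(2)] zero_prod_def)
    moreover have "shuffle False b (\<lambda>Ys. snd (embed_V Q) Ys x) (snd (embed_V P)) Xs = 0" for Xs x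
      by (rule shuffle_killed) (simp add: embed_V_def lin zero_prod_def)
    moreover have "shuffle True b (fst (embed_V Q)) (snd (embed_V P)) Xs = 0" for Xs
      by (rule shuffle_killed) (simp add: embed_V_def lin zero_prod_def)
    ultimately show ?thesis
      by (simp add: cochain_comp_def cochain_comp_snd_def prod_eq_iff fun_eq_iff)
  qed
  show ?thesis
    unfolding E.LieY_eq[OF embed_V_cochains[OF assms(1)] embed_V_cochains[OF assms(2)]]
    by (simp add: comp0[OF assms] comp0[OF assms(2,1)])
qed

text \<open>Split P = P0 + P1 and Q = Q0 + Q1 into kernel part and embedded part. [P0, Q0] dies
  under the projection and [P1, Q1] is 0, so on both sides only the mixed brackets are left.\<close>

lemma pr_g_LieY:
  assumes "P \<in> cochains scale_sum scale_sum p" and "Q \<in> cochains scale_sum scale_sum q"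
  shows "pr_g (LieY scale_sum P Q)
    = pr_g (LieY scale_sum (embed_V (pr_g P)) Q) + pr_g (LieY scale_sum P (embed_V (pr_g Q)))"
proof -
  interpret L: vector_space "cochain_scale scale_sum"
    by (rule vector_space_cochain_scale) (rule vector_space_sum)
  note all = cochains_all_cochains[OF vector_space_sum vector_space_sum]
  define P1 where "P1 = embed_V (pr_g P)"
  define Q1 where "Q1 = embed_V (pr_g Q)"
  have P1: "P1 \<in> cochains scale_sum scale_sum p" and Q1: "Q1 \<in> cochains scale_sum scale_sum q"
    using assms by (simp_all add: P1_def Q1_def embed_V_cochains pr_g_cochains)
  have P0: "P - P1 \<in> cochains scale_sum scale_sum p" and Q0: "Q - Q1 \<in> cochains scale_sum scale_sum q"
    using E.cochains_diff assms P1 Q1 by blast+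
  have pr_diff: "pr_g (P - Q) = pr_g P - pr_g Q" for P Q :: "('g \<times> 'v, 'g \<times> 'v) cochain"
    by (auto simp: pr_g_def prod_eq_iff fun_eq_iff)
  have pr0: "pr_g (P - P1) = 0" "pr_g (Q - Q1) = 0"
    by (simp_all add: pr_diff P1_def Q1_def pr_g_embed_V)
  have "pr_g (- X) = - pr_g X" for X :: "('g \<times> 'v, 'g \<times> 'v) cochain"
    by (auto simp: pr_g_def prod_eq_iff fun_eq_iff)
  then have "pr_g (LieY scale_sum (P - P1) (Q - Q1)) = 0"
    unfolding E.LieY_eq[OF P0 Q0]
    by (simp only: pr_diff[of "cochain_comp _ _ _"] pr_g_cochain_comp_eq_0[OF pr0] signed_def
        pr_g_cochain_comp_eq_0[OF pr0(2,1)] if_distrib[of pr_g] minus_zero diff_zero if_cancel)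
  moreover have "LieY scale_sum P1 Q1 = 0"
    unfolding P1_def Q1_def by (rule embed_V_abelian[OF pr_g_cochains pr_g_cochains]) fact+
  moreover have "LieY scale_sum P Q = LieY scale_sum (P - P1) Q + LieY scale_sum P1 Q"
    using E.LieY_combination(1)[OF all[OF P0] all[OF P1] all[OF assms(2)], of 1] by simp
  moreover have "LieY scale_sum (P - P1) Q = LieY scale_sum (P - P1) (Q - Q1) + LieY scale_sum (P - P1) Q1"
    using E.LieY_combination(2)[OF all[OF Q0] all[OF Q1] all[OF P0], of 1] by simp
  moreover have "LieY scale_sum P Q1 = LieY scale_sum (P - P1) Q1 + LieY scale_sum P1 Q1"
    using E.LieY_combination(1)[OF all[OF P0] all[OF P1] all[OF Q1], of 1] by simp
  ultimately show ?thesis by (simp add: pr_g_add P1_def Q1_def)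
qed

section \<open>Weights of cochains\<close>

text \<open>Weights are detected by one automorphism of the direct sum rather than by decomposing
  cochains: weight \<open>w\<close> becomes the factor 2^w. The powers of 2 are pairwise distinct in
  characteristic 0.\<close>

definition dilate :: "'g \<times> 'v \<Rightarrow> 'g \<times> 'v"
  where "dilate x = (scale 2 (fst x), snd x)"

text \<open>
  \<open>c = 2\<^sup>w\<close>, where the weight \<open>w\<close> counts the arguments from \<open>\<gg>\<close> minus the outputs in \<open>\<gg>\<close>.
\<close>

definition dilates :: "'k \<Rightarrow> ('g \<times> 'v, 'g \<times> 'v) cochain \<Rightarrow> bool"
  where "dilates c P \<longleftrightarrow>
    (\<forall>Xs. fst P (map (map_prod dilate dilate) Xs) = c *\<^sub>E dilate (fst P Xs)) \<and>
    (\<forall>Xs x. snd P (map (map_prod dilate dilate) Xs) (dilate x) = c *\<^sub>E dilate (snd P Xs x))"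

lemma dilate_simps:
  "dilate (x + y) = dilate x + dilate y" "dilate (- x) = - dilate x" "dilate 0 = 0"
  "dilate (x - y) = dilate x - dilate y"
  "dilate (c *\<^sub>E x) = c *\<^sub>E dilate x"
  by (simp_all add: dilate_def scale_sum_eq scale_right_distrib scale_right_diff_distrib zero_prod_def
      scale_left_commute)

end

context vector_space
begin

text \<open>Insertion is compatible with applying \<open>g\<close> to all arguments and to the
  value, so the factors of the two cochains multiply.\<close>

lemma insert_into_equivariant:
  assumes g: "\<And>x y. g (x + y) = g x + g y" "\<And>x. g (- x) = - g x" "g 0 = 0"
    and "wedge_form scale scale \<phi>'" and "\<And>Ys. \<phi>' (map (map_prod g g) Ys) = scale c (g (\<phi> Ys))"
    and "\<And>Ys x. G' (map (map_prod g g) Ys) (g x) = scale d (g (G Ys x))"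
  shows "insert_into b G' \<phi>' (map (map_prod g g) Xs) = scale (c * d) (g (insert_into b G \<phi> Xs))"
  using assms(4-6)
proof (induction Xs arbitrary: b G G' \<phi> \<phi>')
  case Nil
  then show ?case by (simp add: g)
next
  case (Cons X Xs)
  have s: "signed b (scale c (g x)) = scale c (g (signed b x))" for b c x
    by (simp add: signed_def g)
  have "insert_into b' (\<lambda>Ys. G' (map_prod g g X # Ys)) \<phi>' (map (map_prod g g) Xs)
    = scale (c * d) (g (insert_into b' (\<lambda>Ys. G (X # Ys)) \<phi> Xs))" for b'
    by (rule Cons.IH) (use Cons.prems Cons.prems(3)[of "X # _"] in auto)
  moreover have "insert_into b' G' (\<lambda>Ys. \<phi>' (map_prod g g X # Ys)) (map (map_prod g g) Xs)
    = scale (c * d) (g (insert_into b' G (\<lambda>Ys. \<phi> (X # Ys)) Xs))" for b'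
    by (rule Cons.IH) (use Cons.prems Cons.prems(2)[of "X # _"] in \<open>auto simp: wedge_form_Cons\<close>)
  moreover have "deriv_slot \<phi>' [] (G' []) (map_prod g g X) (map (map_prod g g) Xs)
    = scale (c * d) (g (deriv_slot \<phi> [] (G []) X Xs))"
    using Cons.prems(2)[of "(fst X, G [] (snd X)) # Xs"] Cons.prems(2)[of "(G [] (fst X), snd X) # Xs"]
      Cons.prems(3)[of "[]"]
    by (simp add: deriv_slot_def wedge_formD[OF Cons.prems(1)] g scale_right_distrib mult.commute)
  ultimately show ?case
    by (simp add: s g scale_right_distrib)
qed

lemma shuffle_equivariant:
  assumes g: "\<And>x y. g (x + y) = g x + g y" "\<And>x. g (- x) = - g x"
    and "\<And>Ys a x. \<phi>' Ys (scale a x) = scale a (\<phi>' Ys x)"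
    and "\<And>Ys x. \<phi>' (map f Ys) (g x) = scale c (g (\<phi> Ys x))"
    and "\<And>Ys. G' (map f Ys) = scale d (g (G Ys))"
  shows "shuffle h b G' \<phi>' (map f Xs) = scale (c * d) (g (shuffle h b G \<phi> Xs))"
proof -
  have s: "signed b (scale c (g x)) = scale c (g (signed b x))" for b c x
    by (simp add: signed_def g)
  have g0: "g 0 = 0" using g(1)[of 0 0] by simp
  show "shuffle h b G' \<phi>' (map f Xs) = scale (c * d) (g (shuffle h b G \<phi> Xs))"
    using assms(3-5)
  proof (induction Xs arbitrary: b G G' \<phi> \<phi>')
    case Nil
    show ?case using Nil(1) Nil(2)[of "[]"] Nil(3)[of "[]"] by (simp add: mult.commute g0)
  next
    case (Cons X Xs)
    have "shuffle h b' (\<lambda>Ys. G' (f X # Ys)) \<phi>' (map f Xs)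
      = scale (c * d) (g (shuffle h b' (\<lambda>Ys. G (X # Ys)) \<phi> Xs))" for b'
      by (rule Cons.IH) (use Cons.prems Cons.prems(3)[of "X # _"] in auto)
    moreover have "shuffle h b' G' (\<lambda>Ys. \<phi>' (f X # Ys)) (map f Xs)
      = scale (c * d) (g (shuffle h b' G (\<lambda>Ys. \<phi> (X # Ys)) Xs))" for b'
      by (rule Cons.IH) (use Cons.prems Cons.prems(2)[of "X # _"] in auto)
    moreover have "\<phi>' [] (G' [f X]) = scale (c * d) (g (\<phi> [] (G [X])))"
      using Cons.prems(1) Cons.prems(2)[of "[]"] Cons.prems(3)[of "[X]"] by (simp add: mult.commute)
    ultimately show ?case by (simp add: s g g0 scale_right_distrib)
  qed
qed

end

context lie_yamaguti_representation
begin

lemma dilates_cochain_comp: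
  assumes "P \<in> cochains scale_sum scale_sum p" and "dilates c P" and "dilates d Q"
  shows "dilates (c * d) (cochain_comp b P Q)"
proof -
  have P: "wedge_form scale_sum scale_sum (fst P)" "\<And>x. wedge_form scale_sum scale_sum (\<lambda>Ys. snd P Ys x)"
    "\<And>Ys c x y. snd P Ys (c *\<^sub>E x + y) = c *\<^sub>E snd P Ys x + snd P Ys y"
    using assms(1) unfolding cochains_sum_iff by blast+
  note vP = E.value_linearD(2)[where \<phi> = "snd P", OF P(3)]
  have cP: "fst P (map (map_prod dilate dilate) Ys) = c *\<^sub>E dilate (fst P Ys)"
    "snd P (map (map_prod dilate dilate) Ys) (dilate x) = c *\<^sub>E dilate (snd P Ys x)" for Ys x
    using assms(2) unfolding dilates_def by blast+
  have dQ: "fst Q (map (map_prod dilate dilate) Ys) = d *\<^sub>E dilate (fst Q Ys)"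
    "snd Q (map (map_prod dilate dilate) Ys) (dilate x) = d *\<^sub>E dilate (snd Q Ys x)" for Ys x
    using assms(3) unfolding dilates_def by blast+
  show ?thesis
    unfolding dilates_def cochain_comp_def cochain_comp_snd_def fst_conv snd_conv
    using E.insert_into_equivariant[where g = dilate and \<phi> = "fst P" and G = "snd Q" and b = b,
        OF dilate_simps(1-3) P(1) cP(1) dQ(2)]
      E.insert_into_equivariant[where g = dilate and \<phi> = "\<lambda>Ys. snd P Ys x" and \<phi>' = "\<lambda>Ys. snd P Ys (dilate x)"
        and G = "snd Q" and b = b for x, OF dilate_simps(1-3) P(2) cP(2) dQ(2)]
      E.shuffle_equivariant[where g = dilate and \<phi> = "snd P" and b = b
        and G = "\<lambda>Ys. snd Q Ys x" and G' = "\<lambda>Ys. snd Q Ys (dilate x)" for x,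
        OF dilate_simps(1,2) vP cP(2) dQ(2)]
      E.shuffle_equivariant[where g = dilate and \<phi> = "snd P" and b = b and G = "fst Q",
        OF dilate_simps(1,2) vP cP(2) dQ(1)]
    by (simp add: dilate_simps E.scale_right_distrib)
qed

lemma dilates_diff: "dilates c P \<Longrightarrow> dilates c Q \<Longrightarrow> dilates c (P - Q)"
  by (simp add: dilates_def dilate_simps scale_sum_eq prod_eq_iff scale_right_diff_distrib V.scale_right_diff_distrib)

lemma dilates_signed: "dilates c P \<Longrightarrow> dilates c (signed b P)"
  by (cases b) (simp_all add: dilates_def dilate_simps scale_sum_eq prod_eq_iff)

lemma dilates_LieY:
  assumes "P \<in> cochains scale_sum scale_sum p" and "Q \<in> cochains scale_sum scale_sum q"
    and "dilates c P" and "dilates d Q"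
  shows "dilates (c * d) (LieY scale_sum P Q)"
proof -
  show ?thesis
    unfolding E.LieY_eq[OF assms(1,2)]
    using dilates_cochain_comp[OF assms(1,3,4)] dilates_cochain_comp[OF assms(2,4,3)]
    by (intro dilates_diff dilates_signed) (simp_all add: mult.commute)
qed

end

text \<open>Only the scalar type changes. Characteristic 0 separates the powers of 2, excludes
  2-torsion, and allows the factors 2 and 6 in \<open>l2_map\<close> and \<open>l3_map\<close> to be
  cancelled.\<close>

locale lie_yamaguti_representation_char_0 = lie_yamaguti_representation scale br tri scaleV \<rho> \<mu>
  for scale :: "'k::field_char_0 \<Rightarrow> 'g::ab_group_add \<Rightarrow> 'g" and br tri
    and scaleV :: "'k \<Rightarrow> 'v::ab_group_add \<Rightarrow> 'v" and \<rho> \<mu>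
begin

lemma dilates_Delta: "dilates 2 (fst \<Delta>, 0)" "dilates 4 (0, snd \<Delta>)"
proof -
  have b: "bracket_sum (dilate e) (dilate f) = 2 *\<^sub>E dilate (bracket_sum e f)" for e f
    by (simp add: bracket_sum_def dilate_def scale_sum_eq br_simps rho_simps V.scale_right_diff_distrib)
  have t: "triple_sum (dilate e) (dilate f) (dilate g) = 4 *\<^sub>E dilate (triple_sum e f g)" for e f g
    by (simp add: triple_sum_def dilate_def scale_sum_eq tri_simps D_simps mu_simps
        V.scale_right_diff_distrib V.scale_right_distrib)
  have "fst \<Delta> (map (map_prod dilate dilate) Xs) = 2 *\<^sub>E dilate (fst \<Delta> Xs)" for Xs
    by (cases "length Xs = 1") (auto simp: length_Suc_conv Delta_simps b dilate_simps scale_sum_0)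
  then show "dilates 2 (fst \<Delta>, 0)"
    by (simp add: dilates_def dilate_simps scale_sum_0)
  have "snd \<Delta> (map (map_prod dilate dilate) Xs) (dilate x) = 4 *\<^sub>E dilate (snd \<Delta> Xs x)" for Xs x
    by (cases "length Xs = 1") (auto simp: length_Suc_conv Delta_simps t dilate_simps scale_sum_0)
  then show "dilates 4 (0, snd \<Delta>)"
    by (simp add: dilates_def dilate_simps scale_sum_0)
qed

lemma dilates_embed_V: "dilates (1 / 2) (embed_V P)"
proof -
  have "map (map_prod snd snd) (map (map_prod dilate dilate) Xs) = map (map_prod snd snd) Xs" for Xs
    by (auto simp: dilate_def)
  then show ?thesis
    unfolding dilates_def embed_V_def fst_conv snd_conv by (simp add: dilate_def scale_sum_eq del: map_map)
qed

lemma pr_g_dilates: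
  assumes "dilates c P" and "2 * c \<noteq> 1"
  shows "pr_g P = 0"
proof -
  have v: "map (map_prod dilate dilate) (vlist Xs) = (vlist Xs :: (('g \<times> 'v) \<times> ('g \<times> 'v)) list)" for Xs
    by (auto simp: dilate_def)
  have 0: "x = 0" if "x = scale c (scale 2 x)" for x
  proof -
    have "scale (1 - 2 * c) x = 0" using that by (simp add: scale_left_diff_distrib mult.commute)
    with assms(2) show ?thesis by auto
  qed
  have "fst (fst P (vlist Xs)) = 0" for Xs
  proof (rule 0)
    have "fst P (vlist Xs) = c *\<^sub>E dilate (fst P (vlist Xs))"
      using assms(1) unfolding dilates_def by (metis v)
    then show "fst (fst P (vlist Xs)) = scale c (scale 2 (fst (fst P (vlist Xs))))"
      by (simp add: scale_sum_eq dilate_def prod_eq_iff)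
  qed
  moreover have "fst (snd P (vlist Xs) (0, x)) = 0" for Xs x
  proof (rule 0)
    have "dilate (0, x) = (0, x)" by (simp add: dilate_def)
    then have "snd P (vlist Xs) (0, x) = c *\<^sub>E dilate (snd P (vlist Xs) (0, x))"
      using assms(1) unfolding dilates_def by (metis v)
    then show "fst (snd P (vlist Xs) (0, x)) = scale c (scale 2 (fst (snd P (vlist Xs) (0, x))))"
      by (simp add: scale_sum_eq dilate_def prod_eq_iff)
  qed
  ultimately show ?thesis by (auto simp: pr_g_def prod_eq_iff fun_eq_iff)
qed

end

section \<open>The \<open>L\<^sub>\<infinity>\<close>-algebra\<close>

text \<open>Integer degrees come with zero spaces below 0, so facts about natural degrees carry over
  once the element 0 is treated apart.\<close>

lemma C_star_cases:
  assumes "x \<in> C_star s t d"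
  obtains "x = 0" | p where "d = int p" "x \<in> cochains s t p"
  using assms by (auto simp: C_star_def split: if_splits intro: that(2)[of "nat d"])

lemma C_star_int: "C_star s t (int p) = cochains s t p"
  by (simp add: C_star_def)

lemma C_star_all_cochains:
  "vector_space s \<Longrightarrow> vector_space t \<Longrightarrow> x \<in> C_star s t d \<Longrightarrow> x \<in> all_cochains s t"
  using cochains_all_cochains[of s t x] cochains_zero[of s t]
  by (auto simp: C_star_def split: if_splits intro: cochains_all_cochains[OF _ _ cochains_zero])

lemma hom_part_0: "hom_part n 0 = (0 :: ('e, 'f::zero) cochain)"
  by (auto simp: hom_part_def prod_eq_iff fun_eq_iff)

context vector_space
begin

lemma LieY_0:
  assumes "Q \<in> all_cochains scale scale"
  shows "LieY scale 0 Q = 0" and "LieY scale Q 0 = 0"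
proof -
  have 0: "0 \<in> all_cochains scale scale"
    using cochains_all_cochains[OF vector_space_axioms vector_space_axioms cochains_zero] vector_space_axioms by blast
  interpret L: vector_space "cochain_scale scale"
    by (rule vector_space_cochain_scale) (rule vector_space_axioms)
  show "LieY scale 0 Q = 0" "LieY scale Q 0 = 0"
    using LieY_combination[OF 0 0 assms, of 1] by simp_all
qed

lemma LieY_C_star:
  assumes "x \<in> C_star scale scale p" and "y \<in> C_star scale scale q"
  shows "LieY scale x y \<in> C_star scale scale (p + q)"
    and "LieY scale y x = signed (even p \<or> even q) (LieY scale x y)"
proof -
  interpret L: vector_space "cochain_scale scale"
    by (rule vector_space_cochain_scale) (rule vector_space_axioms)
  note sub = C_star_subspace[OF vector_space_axioms vector_space_axioms]
  have all: "x \<in> all_cochains scale scale" "y \<in> all_cochains scale scale"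
    using C_star_all_cochains[OF vector_space_axioms vector_space_axioms] assms by blast+
  have "0 \<in> all_cochains scale scale"
    using C_star_all_cochains[OF vector_space_axioms vector_space_axioms] L.subspace_0[OF sub] by blast
  note 0 = LieY_0[OF this] LieY_0[OF all(1)] LieY_0[OF all(2)] L.subspace_0[OF sub]
  show "LieY scale x y \<in> C_star scale scale (p + q)"
    using assms
    by (elim C_star_cases) (auto simp: 0 C_star_int LieY_cochains simp flip: of_nat_add)
  show "LieY scale y x = signed (even p \<or> even q) (LieY scale x y)"
    using assms(1)
  proof (cases rule: C_star_cases)
    case (2 m)
    note m = this
    show ?thesis
      using assms(2)
    proof (cases rule: C_star_cases)
      case (2 n)
      then show ?thesis using LieY_skew[OF m(2) 2(2)] m by simp
    qed (simp add: 0)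
  qed (simp add: 0)
qed

lemma LieY_jacobi_C_star:
  assumes "x \<in> C_star scale scale p" and "y \<in> C_star scale scale q" and "z \<in> C_star scale scale r"
  shows "LieY scale (LieY scale x y) z
    = LieY scale x (LieY scale y z) + signed (odd q \<and> odd r) (LieY scale (LieY scale x z) y)"
proof -
  have all: "x \<in> all_cochains scale scale" "y \<in> all_cochains scale scale" "z \<in> all_cochains scale scale"
    using C_star_all_cochains[OF vector_space_axioms vector_space_axioms] assms by blast+
  note 0 = LieY_0[OF all(1)] LieY_0[OF all(2)] LieY_0[OF all(3)] LieY_0[OF LieY_all_cochains] all
  show ?thesis
    using assms(1)
  proof (cases rule: C_star_cases)
    case (2 l)
    note l = this
    show ?thesis
      using assms(2)
    proof (cases rule: C_star_cases)
      case (2 m)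
      note m = this
      show ?thesis
        using assms(3)
      proof (cases rule: C_star_cases)
        case (2 n)
        then show ?thesis using LieY_jacobi[OF l(2) m(2) 2(2)] m by simp
      qed (simp add: 0)
    qed (simp add: 0)
  qed (simp add: 0)
qed

end

context lie_yamaguti_representation_char_0
begin

abbreviation CE where "CE \<equiv> C_star scale_sum scale_sum"
abbreviation CV where "CV \<equiv> C_star scaleV scale"
abbreviation LY where "LY \<equiv> LieY scale_sum"
abbreviation pr :: "('g \<times> 'v, 'g \<times> 'v) cochain \<Rightarrow> ('g \<times> 'v, 'g \<times> 'v) cochain"
  where "pr \<equiv> \<lambda>P. embed_V (pr_g P)"

sublocale LE: vector_space "cochain_scale scale_sum"
  by (rule vector_space_cochain_scale) (rule vector_space_sum)

sublocale LV: vector_space "cochain_scale scale"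
  by (rule vector_space_cochain_scale) (rule vector_space_axioms)

lemmas CE_subspace = C_star_subspace[OF vector_space_sum vector_space_sum]
lemmas CV_subspace = C_star_subspace[OF V.vector_space_axioms vector_space_axioms]
lemmas CE_all = C_star_all_cochains[OF vector_space_sum vector_space_sum]
lemmas CV_all = C_star_all_cochains[OF V.vector_space_axioms vector_space_axioms]

lemma embed_V_0: "embed_V 0 = (0 :: ('g \<times> 'v, 'g \<times> 'v) cochain)"
  by (auto simp: embed_V_def prod_eq_iff fun_eq_iff)

lemma pr_g_0: "pr_g 0 = (0 :: ('v, 'g) cochain)"
  by (auto simp: pr_g_def prod_eq_iff fun_eq_iff)

lemma embed_V_C_star: "P \<in> CV d \<Longrightarrow> embed_V P \<in> CE d"
  by (auto simp: C_star_def embed_V_cochains embed_V_0 split: if_splits)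

lemma pr_g_C_star: "P \<in> CE d \<Longrightarrow> pr_g P \<in> CV d"
  by (auto simp: C_star_def pr_g_cochains pr_g_0 split: if_splits)

text \<open>The abstract setting asks for an endomorphism, so \<open>pr\<close> is the projection
  followed by the embedding.\<close>

sublocale derived_brackets CE LY pr \<Delta>
proof
  show "0 \<in> CE p" for p by (rule LE.subspace_0[OF CE_subspace])
  show "x + y \<in> CE p" if "x \<in> CE p" "y \<in> CE p" for x y p by (rule LE.subspace_add[OF CE_subspace that])
  show "- x \<in> CE p" if "x \<in> CE p" for x p by (rule LE.subspace_neg[OF CE_subspace that])
  show "LY x y \<in> CE (p + q)" "LY y x = signed (even p \<or> even q) (LY x y)"
    if "x \<in> CE p" "y \<in> CE q" for x y p q
    using E.LieY_C_star[OF that] by blast+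
  show "LY (x + y) z = LY x z + LY y z" if "x \<in> CE p" "y \<in> CE p" "z \<in> CE q" for x y z p q
    using E.LieY_combination(1)[OF that[THEN CE_all], of 1] by simp
  show "LY (LY x y) z = LY x (LY y z) + signed (odd q \<and> odd r) (LY (LY x z) y)"
    if "x \<in> CE p" "y \<in> CE q" "z \<in> CE r" for x y z p q r
    by (rule E.LieY_jacobi_C_star[OF that])
  show "pr x \<in> CE p" if "x \<in> CE p" for x p
    by (rule embed_V_C_star[OF pr_g_C_star[OF that]])
  show "pr (x + y) = pr x + pr y" "pr (pr x) = pr x" for x y
    by (simp_all add: pr_g_add embed_V_add pr_g_embed_V)
  have all0: "0 \<in> all_cochains scale_sum scale_sum" using CE_all LE.subspace_0[OF CE_subspace] by blast
  show "LY (pr x) (pr y) = 0" if "x \<in> CE p" "y \<in> CE q" for x y p q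
    using pr_g_C_star[OF that(1)]
  proof (cases rule: C_star_cases)
    case 1
    then show ?thesis
      using E.LieY_0(1)[OF CE_all[OF embed_V_C_star[OF pr_g_C_star[OF that(2)]]]] by (simp add: embed_V_0)
  next
    case (2 m)
    note m = this
    show ?thesis
      using pr_g_C_star[OF that(2)]
    proof (cases rule: C_star_cases)
      case 1
      then show ?thesis
        using E.LieY_0(2)[OF CE_all[OF embed_V_C_star[OF pr_g_C_star[OF that(1)]]]] by (simp add: embed_V_0)
    qed (rule embed_V_abelian[OF m(2)])
  qed
  show "pr (LY x y) = pr (LY (pr x) y) + pr (LY x (pr y))" if "x \<in> CE p" "y \<in> CE q" for x y p q
  proof -
    have "pr_g (LY x y) = pr_g (LY (pr x) y) + pr_g (LY x (pr y))"
      using that(1)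
    proof (cases rule: C_star_cases)
      case 1
      then show ?thesis
        using E.LieY_0(1)[OF CE_all] that(2) CE_all[OF embed_V_C_star[OF pr_g_C_star[OF that(2)]]]
        by (simp add: E.LieY_0 embed_V_0 pr_g_0)
    next
      case (2 m)
      note m = this
      show ?thesis
        using that(2)
      proof (cases rule: C_star_cases)
        case 1
        then show ?thesis
          using E.LieY_0(2)[OF CE_all] that(1) CE_all[OF embed_V_C_star[OF pr_g_C_star[OF that(1)]]]
          by (simp add: E.LieY_0 embed_V_0 pr_g_0)
      qed (rule pr_g_LieY[OF m(2)])
    qed
    then show ?thesis by (simp add: embed_V_add)
  qed
  show "\<Delta> \<in> CE 1" using Delta_parts_cochains(3) by (simp add: C_star_def)
  show "LY \<Delta> \<Delta> = 0" by (rule Delta_square)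
  show "x = 0" if "x + x = 0" for x :: "('g \<times> 'v, 'g \<times> 'v) cochain"
  proof -
    have "cochain_scale scale_sum 2 x = x + x"
      using LE.scale_left_distrib[of 1 1 x] by simp
    then show ?thesis using that LE.scale_eq_0_iff[of 2 x] by simp
  qed
qed

lemma dilates_LieY_C_star:
  assumes "P \<in> CE p" and "Q \<in> CE q" and "dilates c P" and "dilates d Q"
  shows "dilates (c * d) (LY P Q)"
proof -
  have d0: "dilates c 0" for c by (simp add: dilates_def dilate_simps scale_sum_0)
  show ?thesis
    using assms(1)
  proof (cases rule: C_star_cases)
    case 1
    then show ?thesis using E.LieY_0(1)[OF CE_all[OF assms(2)]] d0 by simp
  next
    case (2 m)
    note m = this
    show ?thesis
      using assms(2)
    proof (cases rule: C_star_cases)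
      case 1
      then show ?thesis using E.LieY_0(2)[OF CE_all[OF assms(1)]] d0 by simp
    qed (rule dilates_LieY[OF m(2) _ assms(3,4)])
  qed
qed

text \<open>The degrees are attached explicitly because a cochain need not determine its degree: 0
  has every degree.\<close>

definition embedded :: "int list \<Rightarrow> ('v, 'g) cochain list \<Rightarrow> (int \<times> ('g \<times> 'v, 'g \<times> 'v) cochain) list"
  where "embedded ds Ps = zip ds (map embed_V Ps)"

lemma dilates_iterated:
  assumes "x \<in> CE p" and "dilates c x" and "homogeneous zs" and "\<forall>z\<in>set zs. snd z \<in> range embed_V"
  shows "dilates (c * (1 / 2) ^ length zs) (iterated x zs)"
  using assms
proof (induction zs arbitrary: x p c)
  case (Cons z zs)
  obtain d a where z: "z = (d, a)" by (cases z)
  with Cons.prems have a: "a \<in> CE d" "homogeneous zs" "dilates (1 / 2) a" using dilates_embed_V by auto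
  show ?case
    using Cons.IH[OF br_closed[OF Cons.prems(1) a(1)] dilates_LieY_C_star[OF Cons.prems(1) a(1) Cons.prems(2) a(3)] a(2)]
      Cons.prems(4) z by (simp add: mult.assoc)
qed simp

text \<open>Each bracket halves the factor under \<open>dilate\<close>, which starts at 2 for the
  binary and at 4 for the ternary part of \<Delta>. Only the factor 1/2 survives
  \<open>pr_g\<close>, and it is reached after 2 and 3 brackets respectively.\<close>

lemma pr_g_iterated_eq_0:
  assumes "homogeneous zs" and "\<forall>z\<in>set zs. snd z \<in> range embed_V" and "length zs \<noteq> 2" and "length zs \<noteq> 3"
  shows "pr_g (iterated \<Delta> zs) = 0"
proof -
  have parts: "(fst \<Delta>, 0) \<in> CE 1" "(0, snd \<Delta>) \<in> CE 1"
    using Delta_parts_cochains by (simp_all add: C_star_def)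
  have "\<Delta> = (fst \<Delta>, 0) + (0, snd \<Delta>)" by (simp add: prod_eq_iff)
  then have it: "iterated \<Delta> zs = iterated (fst \<Delta>, 0) zs + iterated (0, snd \<Delta>) zs"
    using iterated_add[OF parts assms(1)] by simp
  have pow: "(2::'k) ^ length zs \<noteq> 2 ^ m" if "length zs \<noteq> m" for m
  proof -
    have "(2::nat) ^ length zs \<noteq> 2 ^ m" using that by simp
    then have "of_nat (2 ^ length zs) \<noteq> (of_nat (2 ^ m) :: 'k)" using of_nat_eq_iff by blast
    then show ?thesis by simp
  qed
  have "pr_g (iterated (fst \<Delta>, 0) zs) = 0"
    by (rule pr_g_dilates[OF dilates_iterated[OF parts(1) dilates_Delta(1) assms(1,2)]])
      (use pow[OF assms(3)] in \<open>simp add: power_one_over field_simps\<close>)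
  moreover have "pr_g (iterated (0, snd \<Delta>) zs) = 0"
    by (rule pr_g_dilates[OF dilates_iterated[OF parts(2) dilates_Delta(2) assms(1,2)]])
      (use pow[OF assms(4)] in \<open>simp add: power_one_over field_simps\<close>)
  ultimately show ?thesis by (simp add: it pr_g_add)
qed

section \<open>The brackets as derived brackets\<close>

abbreviation l where "l \<equiv> rrb_brackets scale scaleV br tri \<rho> \<mu>"

lemma embedded_homogeneous:
  assumes "length Ps = length ds" and "\<And>i. i < length Ps \<Longrightarrow> Ps ! i \<in> CV (ds ! i)"
  shows "homogeneous (embedded ds Ps)" and "\<forall>z\<in>set (embedded ds Ps). snd z \<in> range embed_V"
    and "\<forall>z\<in>set (embedded ds Ps). pr (snd z) = snd z" and "length (embedded ds Ps) = length Ps"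
    and "map fst (embedded ds Ps) = ds" and "map snd (embedded ds Ps) = map embed_V Ps"
proof -
  have *: "\<exists>i<length Ps. z = (ds ! i, embed_V (Ps ! i))" if "z \<in> set (embedded ds Ps)" for z
    using that assms(1) by (auto simp: embedded_def set_zip)
  show "homogeneous (embedded ds Ps)"
    unfolding homogeneous_def
  proof
    fix z assume "z \<in> set (embedded ds Ps)"
    from *[OF this] obtain i where "i < length Ps" "z = (ds ! i, embed_V (Ps ! i))" by blast
    then show "case z of (d, a) \<Rightarrow> a \<in> CE d"
      using embed_V_C_star[OF assms(2)[of i]] by simp
  qed
  show "\<forall>z\<in>set (embedded ds Ps). snd z \<in> range embed_V"
    "\<forall>z\<in>set (embedded ds Ps). pr (snd z) = snd z"
    by (auto dest!: * simp: pr_g_embed_V simp del: split_paired_All)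
qed (use assms(1) in \<open>simp_all add: embedded_def\<close>)

text \<open>Replaces the definition by cases with one formula for all \<open>k\<close>: where the
  bracket is declared to be 0, the derived bracket vanishes by weight. Degree, symmetry and Jacobi
  relations then come from the abstract setting.\<close>

lemma brackets_eq:
  assumes "length Ps = length ds" and "\<And>i. i < length Ps \<Longrightarrow> Ps ! i \<in> CV (ds ! i)"
  shows "l (length Ps) Ps = pr_g (iterated \<Delta> (embedded ds Ps))"
proof -
  note e = embedded_homogeneous[of Ps ds, OF assms]
  consider "length Ps = 2" | "length Ps = 3" | "length Ps \<noteq> 2" "length Ps \<noteq> 3" by blast
  then show ?thesis
  proof cases
    case 1
    then obtain P Q where "Ps = [P, Q]" by (auto simp: length_Suc_conv numeral_2_eq_2)
    with 1 e(6) show ?thesis by (simp add: iterated_def rrb_brackets_def l2_def Let_def)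
  next
    case 2
    then obtain P Q R where "Ps = [P, Q, R]" by (auto simp: length_Suc_conv numeral_3_eq_3)
    with 2 e(6) show ?thesis by (simp add: iterated_def rrb_brackets_def l3_def Let_def)
  next
    case 3
    then show ?thesis using pr_g_iterated_eq_0[OF e(1,2)] e(4) by (simp add: rrb_brackets_def)
  qed
qed

lemma brackets_C_star:
  assumes "length Ps = length ds" and "\<And>i. i < length Ps \<Longrightarrow> Ps ! i \<in> CV (ds ! i)"
  shows "l (length Ps) Ps \<in> CV (sum_list ds + 1)"
proof -
  have e: "homogeneous (embedded ds Ps)" "map fst (embedded ds Ps) = ds"
    by (rule embedded_homogeneous[OF assms(1)], erule assms(2))+
  have "pr_g (iterated \<Delta> (embedded ds Ps)) \<in> CV (1 + sum_list ds)"
    using pr_g_C_star[OF iterated_closed[OF Delta_degree e(1)]] unfolding e(2) .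
  then show ?thesis by (simp only: brackets_eq[OF assms] add.commute)
qed

lemma pick_embedded:
  assumes "length Ps = length ds" and "\<sigma> permutes {..<length Ps}" and "j \<le> length Ps"
  shows "pick \<sigma> i j (embedded ds Ps) = embedded (pick \<sigma> i j ds) (pick \<sigma> i j Ps)"
proof (rule nth_equalityI)
  fix m assume m: "m < length (pick \<sigma> i j (embedded ds Ps))"
  then have "\<sigma> (i + m) < length Ps"
    using permutes_in_image[OF assms(2), of "i + m"] assms(3) by (simp add: length_pick)
  with m show "pick \<sigma> i j (embedded ds Ps) ! m = embedded (pick \<sigma> i j ds) (pick \<sigma> i j Ps) ! m"
    using assms(1) by (simp add: pick_def embedded_def)
qed (simp add: embedded_def length_pick)

lemma pick_C_star:
  assumes "length Ps = length ds" and "\<And>i. i < length Ps \<Longrightarrow> Ps ! i \<in> CV (ds ! i)"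
    and "\<sigma> permutes {..<length Ps}" and "j \<le> length Ps" and "m < length (pick \<sigma> i j Ps)"
  shows "pick \<sigma> i j Ps ! m \<in> CV (pick \<sigma> i j ds ! m)"
  using assms(1,4,5) assms(2)[of "\<sigma> (i + m)"] permutes_in_image[OF assms(3), of "i + m"]
  by (simp add: pick_def)

lemma scale_sign_cochain: "k \<in> {1, - 1} \<Longrightarrow> cochain_scale scale (of_int k) P = signed (k < 0) P"
  by (rule LV.scale_sign)

lemma brackets_symmetric:
  assumes "length Ps = length ds" and "\<And>i. i < length Ps \<Longrightarrow> Ps ! i \<in> CV (ds ! i)"
    and "\<sigma> permutes {..<length Ps}"
  shows "l (length Ps) (pick \<sigma> 0 (length Ps) Ps)
    = cochain_scale scale (of_int (koszul_sign ds \<sigma>)) (l (length Ps) Ps)"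
proof -
  note e = embedded_homogeneous[of Ps ds, OF assms(1,2)]
  have "l (length (pick \<sigma> 0 (length Ps) Ps)) (pick \<sigma> 0 (length Ps) Ps)
    = pr_g (iterated \<Delta> (embedded (pick \<sigma> 0 (length Ps) ds) (pick \<sigma> 0 (length Ps) Ps)))"
    by (rule brackets_eq) (use pick_C_star[OF assms] in \<open>auto simp: length_pick\<close>)
  also have "\<dots> = pr_g (iterated \<Delta> (pick \<sigma> 0 (length (embedded ds Ps)) (embedded ds Ps)))"
    using pick_embedded[OF assms(1,3)] e(4) by simp
  also have "\<dots> = pr_g (signed (koszul_sign ds \<sigma> < 0) (iterated \<Delta> (embedded ds Ps)))"
    using iterated_pick[of \<sigma> "embedded ds Ps" \<Delta> 1] assms(3) e Delta_degree by simp
  also have "\<dots> = signed (koszul_sign ds \<sigma> < 0) (pr_g (iterated \<Delta> (embedded ds Ps)))"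
    by (auto simp: signed_def pr_g_def prod_eq_iff fun_eq_iff)
  finally show ?thesis
    using brackets_eq[OF assms(1,2)] koszul_sign_values[of ds \<sigma>] by (simp add: scale_sign_cochain length_pick)
qed

lemma brackets_jacobi:
  assumes "length Ps = length ds" and "\<And>i. i < length Ps \<Longrightarrow> Ps ! i \<in> CV (ds ! i)"
  shows "(\<Sum>i = 1..length Ps. \<Sum>\<sigma> \<in> shuffle_perms i (length Ps - i).
     cochain_scale scale (of_int (koszul_sign ds \<sigma>))
       (l (length Ps - i + 1) (l i (pick \<sigma> 0 i Ps) # pick \<sigma> i (length Ps) Ps))) = 0"
proof -
  let ?n = "length Ps"
  define zs where "zs = embedded ds Ps"
  note e = embedded_homogeneous[of Ps ds, OF assms, folded zs_def]
  define F where "F = (\<lambda>S T. pr_g (iterated (LY \<Delta> (pr (iterated \<Delta> S))) T))"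
  have summand: "l (?n - i + 1) (l i (pick \<sigma> 0 i Ps) # pick \<sigma> i ?n Ps) = F (pick \<sigma> 0 i zs) (pick \<sigma> i ?n zs)"
    if i: "i \<in> {1..?n}" and s: "\<sigma> \<in> shuffle_perms i (?n - i)" for i \<sigma>
  proof -
    have p: "\<sigma> permutes {..<?n}" using i s by (simp add: shuffle_perms_def)
    note C = pick_C_star[OF assms p]
    let ?S = "pick \<sigma> 0 i Ps" and ?T = "pick \<sigma> i ?n Ps" and ?d = "pick \<sigma> 0 i ds" and ?e = "pick \<sigma> i ?n ds"
    have S: "length ?S = length ?d" "\<And>m. m < length ?S \<Longrightarrow> ?S ! m \<in> CV (?d ! m)"
      using i C by (simp_all add: length_pick)
    have lS: "l i ?S = pr_g (iterated \<Delta> (pick \<sigma> 0 i zs))" "l i ?S \<in> CV (sum_list ?d + 1)"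
      using brackets_eq[OF S] brackets_C_star[OF S] pick_embedded[OF assms(1) p, of i 0] i
      by (simp_all add: length_pick zs_def)
    have T: "length (l i ?S # ?T) = length ((sum_list ?d + 1) # ?e)"
      "\<And>m. m < length (l i ?S # ?T) \<Longrightarrow> (l i ?S # ?T) ! m \<in> CV (((sum_list ?d + 1) # ?e) ! m)"
      using lS(2) C[of ?n _ i] by (auto simp: length_pick nth_Cons split: nat.split)
    have "l (?n - i + 1) (l i ?S # ?T) = l (length (l i ?S # ?T)) (l i ?S # ?T)"
      by (simp add: length_pick)
    also have "\<dots> = pr_g (iterated \<Delta> (embedded ((sum_list ?d + 1) # ?e) (l i ?S # ?T)))"
      by (rule brackets_eq[OF T])
    also have "embedded ((sum_list ?d + 1) # ?e) (l i ?S # ?T)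
      = (sum_list ?d + 1, embed_V (l i ?S)) # pick \<sigma> i ?n zs"
      using pick_embedded[OF assms(1) p, of ?n i] by (simp add: embedded_def zs_def)
    finally show ?thesis by (simp add: F_def lS(1))
  qed
  have "(\<Sum>i = 1..?n. \<Sum>\<sigma> \<in> shuffle_perms i (?n - i).
     cochain_scale scale (of_int (koszul_sign ds \<sigma>))
       (l (?n - i + 1) (l i (pick \<sigma> 0 i Ps) # pick \<sigma> i ?n Ps)))
    = (\<Sum>i = 1..?n. \<Sum>\<sigma> \<in> shuffle_perms i (?n - i).
        signed (koszul_sign (map fst zs) \<sigma> < 0) (F (pick \<sigma> 0 i zs) (pick \<sigma> i (i + (?n - i)) zs)))"
  proof (intro sum.cong refl)
    fix i \<sigma> assume i: "i \<in> {1..?n}" "\<sigma> \<in> shuffle_perms i (?n - i)"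
    then have "i + (?n - i) = ?n" by simp
    then show "cochain_scale scale (of_int (koszul_sign ds \<sigma>))
        (l (?n - i + 1) (l i (pick \<sigma> 0 i Ps) # pick \<sigma> i ?n Ps))
      = signed (koszul_sign (map fst zs) \<sigma> < 0) (F (pick \<sigma> 0 i zs) (pick \<sigma> i (i + (?n - i)) zs))"
      by (simp only: scale_sign_cochain[OF koszul_sign_values] summand[OF i] e(5))
  qed
  also have "\<dots> = (\<Sum>i = 1..?n. split_sum par (\<lambda>S T. if length S = i then F S T else 0) zs)"
    by (intro sum.cong refl sum_shuffle_perms) (simp add: e(4))
  also have "\<dots> = split_sum par (\<lambda>S T. \<Sum>i = 1..?n. if length S = i then F S T else 0) zs"
    by (rule split_sum_sum[symmetric])
  also have "\<dots> = split_sum par F zs"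
  proof (rule split_sum_cong)
    fix S T :: "(int \<times> ('g \<times> 'v, 'g \<times> 'v) cochain) list"
    assume ST: "length S + length T = length zs" "set T \<subseteq> set zs"
    have "homogeneous T" using ST(2) e(1) by (auto simp: homogeneous_def)
    \<comment> \<open>The L-infinity sum starts at \<open>i = 1\<close>, the splitting sum at
      \<open>S = []\<close>. The extra term vanishes since \<Delta> itself projects to 0, so there
      is no curvature.\<close>
    moreover have "pr_g \<Delta> = 0" using pr_g_iterated_eq_0[of "[]"] by simp
    ultimately have "F [] T = 0"
      using br_0_right[OF Delta_degree] by (simp add: F_def embed_V_0 iterated_0 pr_g_0)
    then show "(\<Sum>i = 1..?n. if length S = i then F S T else 0) = F S T"
      using ST(1) e(4) by (cases S) auto
  qed
  also have "\<dots> = split_sum par (\<lambda>S T. pr_g (pr (iterated (LY \<Delta> (pr (iterated \<Delta> S))) T))) zs"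
    by (simp add: F_def pr_g_embed_V)
  also have "\<dots> = pr_g (split_sum par (\<lambda>S T. pr (iterated (LY \<Delta> (pr (iterated \<Delta> S))) T)) zs)"
    by (rule split_sum_additive[symmetric]) (rule pr_g_add)
  also have "\<dots> = 0"
    using derived_jacobi[OF e(1,3)] by (simp add: pr_g_0)
  finally show ?thesis .
qed

lemma all_cochains_subspace:
  assumes "vector_space s" and "vector_space t"
  shows "module.subspace (cochain_scale t) (all_cochains s t)"
proof -
  interpret t: vector_space t by fact
  interpret L: vector_space "cochain_scale t" by (rule vector_space_cochain_scale) fact
  have 0: "0 \<in> all_cochains s t"
    by (rule cochains_all_cochains[OF assms cochains_zero[OF assms]])
  show ?thesis
    unfolding L.subspace_def
    using 0 all_cochains_combination[OF assms, of _ _ 1] all_cochains_combination[OF assms _ 0] by simp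
qed

abbreviation AE where "AE \<equiv> all_cochains scale_sum scale_sum"
abbreviation AV where "AV \<equiv> all_cochains scaleV scale"

lemma embed_V_all: "P \<in> AV \<Longrightarrow> embed_V P \<in> AE"
  by (simp add: all_cochains_def hom_part_embed_V embed_V_cochains)

lemma Delta_all: "\<Delta> \<in> AE"
  by (rule CE_all[OF Delta_degree])

lemma brackets_combination:
  assumes "length Ps = k" and "set Ps \<subseteq> AV" and "i < k" and "x \<in> AV" and "y \<in> AV"
  shows "l k (Ps[i := cochain_scale scale c x + y])
    = cochain_scale scale c (l k (Ps[i := x])) + l k (Ps[i := y])"
proof -
  have xy: "embed_V x \<in> AE" "embed_V y \<in> AE" using assms(4,5) by (simp_all add: embed_V_all)
  note simps = embed_V_add embed_V_scale pr_g_add pr_g_scale E.LieY_combination E.LieY_all_cochains Delta_all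
    embed_V_all xy less_Suc_eq numeral_2_eq_2 numeral_3_eq_3
  consider "k = 2" | "k = 3" | "k \<noteq> 2" "k \<noteq> 3" by blast
  then show ?thesis
  proof cases
    case 1
    with assms(1) obtain P Q where Ps: "Ps = [P, Q]" by (auto simp: length_Suc_conv numeral_2_eq_2)
    have "i = 0 \<or> i = 1" using assms(3) 1 by auto
    then show ?thesis
      using assms(2,4,5) by (auto simp: Ps 1 rrb_brackets_def l2_def Let_def simps)
  next
    case 2
    with assms(1) obtain P Q R where Ps: "Ps = [P, Q, R]" by (auto simp: length_Suc_conv numeral_3_eq_3)
    have "i = 0 \<or> i = 1 \<or> i = 2" using assms(3) 2 by auto
    then show ?thesis
      using assms(2,4,5) by (auto simp: Ps 2 rrb_brackets_def l3_def Let_def simps)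
  qed (simp add: rrb_brackets_def)
qed

text \<open>Cochains of different degrees live on lists of different lengths, so
  \<open>hom_part n\<close> isolates one summand.\<close>

lemma C_star_independent:
  assumes "finite I" and "\<And>j. j \<in> I \<Longrightarrow> x j \<in> CV j" and "(\<Sum>j\<in>I. x j) = 0" and "i \<in> I"
  shows "x i = 0"
  using assms(2)[OF assms(4)]
proof (cases rule: C_star_cases)
  case (2 n)
  have h: "hom_part n (x j) = (if j = i then x j else 0)" if "j \<in> I" for j
    using assms(2)[OF that]
  proof (cases rule: C_star_cases)
    case 1
    then show ?thesis by (auto simp: hom_part_0)
  next
    case (2 m)
    then show ?thesis using hom_part_cochains[OF 2(2), of n] \<open>i = int n\<close> by auto
  qed
  have "0 = hom_part n (\<Sum>j\<in>I. x j)" unfolding assms(3) by (simp add: hom_part_0)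
  also have "\<dots> = (\<Sum>j\<in>I. if j = i then x j else 0)"
    unfolding hom_part_sum by (intro sum.cong refl h)
  finally show ?thesis using assms(1,4) by simp
qed

theorem L_infinity: "L_infinity_algebra (cochain_scale scale) CV l"
proof -
  interpret G: graded_vector_space "cochain_scale scale" CV
    by unfold_locales (rule CV_subspace, rule C_star_independent)
  have "(\<Union>i. CV i) \<subseteq> AV" using CV_all by blast
  then have total: "G.total \<subseteq> AV"
    unfolding G.total_def
    by (rule LV.span_minimal) (rule all_cochains_subspace[OF V.vector_space_axioms vector_space_axioms])
  have zero: "0 \<in> AV"
    using LV.subspace_0[OF all_cochains_subspace[OF V.vector_space_axioms vector_space_axioms]] .
  show ?thesis
  proof
    fix k xs i x y c
    assume *: "k \<ge> 1" "length xs = k" "set xs \<subseteq> G.total" "i < k" "x \<in> G.total"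
    then have AV: "set xs \<subseteq> AV" "x \<in> AV" using total by auto
    note comb = brackets_combination[OF *(2) AV(1) *(4)]
    show "l k (xs[i := x + y]) = l k (xs[i := x]) + l k (xs[i := y])" if "y \<in> G.total"
      using comb[of x y 1] AV that total by auto
    \<comment> \<open>Homogeneity is the combined law with second summand 0, whose value must be
      known to vanish first.\<close>
    have "l k (xs[i := 0]) = 0" using comb[OF zero zero, of 1] by simp
    then show "l k (xs[i := cochain_scale scale c x]) = cochain_scale scale c (l k (xs[i := x]))"
      using comb[OF AV(2) zero, of c] by simp
  next
    fix k xs and ds :: "int list"
    assume "k \<ge> 1" "length xs = k" "length ds = k" "\<And>i. i < k \<Longrightarrow> xs ! i \<in> CV (ds ! i)"
    then show "l k xs \<in> CV (sum_list ds + 1)" using brackets_C_star[of xs ds] by auto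
  next
    fix n xs and ds :: "int list" and \<sigma>
    assume "n \<ge> 1" "length xs = n" "length ds = n" "\<And>i. i < n \<Longrightarrow> xs ! i \<in> CV (ds ! i)" "\<sigma> permutes {..<n}"
    then show "l n (pick \<sigma> 0 n xs) = cochain_scale scale (of_int (koszul_sign ds \<sigma>)) (l n xs)"
      using brackets_symmetric[of xs ds \<sigma>] by auto
  next
    fix n xs and ds :: "int list"
    assume "n \<ge> 1" "length xs = n" "length ds = n" "\<And>i. i < n \<Longrightarrow> xs ! i \<in> CV (ds ! i)"
    then show "(\<Sum>i = 1..n. \<Sum>\<sigma> \<in> shuffle_perms i (n - i).
        cochain_scale scale (of_int (koszul_sign ds \<sigma>)) (l (n - i + 1) (l i (pick \<sigma> 0 i xs) # pick \<sigma> i n xs))) = 0"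
      using brackets_jacobi[of xs ds] by auto
  qed
qed

subsection \<open>Maurer-Cartan elements\<close>

lemma cochain_of_map_cochains:
  assumes "Vector_Spaces.linear scaleV scale T"
  shows "cochain_of_map T \<in> cochains scaleV scale 0"
  using assms
  unfolding cochains_V_iff
    linear_iff_combination[OF V.vector_space_axioms vector_space_axioms]
  by (auto simp: cochain_of_map_def wedge_form_def)

lemma cochains_0_of_map:
  assumes "\<alpha> \<in> cochains scaleV scale 0"
  obtains T where "Vector_Spaces.linear scaleV scale T" and "\<alpha> = cochain_of_map T"
proof
  note \<alpha> = assms[unfolded cochains_V_iff]
  show "Vector_Spaces.linear scaleV scale (snd \<alpha> [])"
    unfolding linear_iff_combination[OF V.vector_space_axioms vector_space_axioms] using \<alpha> by blast
  show "\<alpha> = cochain_of_map (snd \<alpha> [])"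
    using \<alpha> by (auto simp: cochain_of_map_def prod_eq_iff fun_eq_iff)
qed

context
  fixes T :: "'v \<Rightarrow> 'g"
  assumes T: "Vector_Spaces.linear scaleV scale T"
begin

abbreviation T\<^sub>E :: "'g \<times> 'v \<Rightarrow> 'g \<times> 'v"
  where "T\<^sub>E x \<equiv> (T (snd x), 0)"

abbreviation T\<^sub>C where "T\<^sub>C \<equiv> embed_V (cochain_of_map T)"

text \<open>T has degree 0, so the bracket is an unsigned commutator: T is put into each argument of
  X in turn, and T applied to the value is subtracted.\<close>

lemma LieY_map:
  assumes "X \<in> cochains scale_sum scale_sum 1"
  shows "fst (LY X T\<^sub>C) [A] = fst X [(fst A, T\<^sub>E (snd A))] + fst X [(T\<^sub>E (fst A), snd A)] - T\<^sub>E (fst X [A])"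
    and "snd (LY X T\<^sub>C) [A] z = snd X [A] (T\<^sub>E z) + snd X [(fst A, T\<^sub>E (snd A))] z
      + snd X [(T\<^sub>E (fst A), snd A)] z - T\<^sub>E (snd X [A] z)"
    and "LY X T\<^sub>C \<in> cochains scale_sum scale_sum 1"
proof -
  have TC: "T\<^sub>C \<in> cochains scale_sum scale_sum 0"
    by (rule embed_V_cochains[OF cochain_of_map_cochains[OF T]])
  note X = assms[unfolded cochains_sum_iff]
  have X0: "fst X [] = 0" "snd X [] z = 0" for z using X by (simp_all del: split_paired_All)
  have z: "snd X [B] 0 = 0" for B
    using cochains_additive[OF vector_space_sum assms] by (simp add: additive_cochain_def value_additiveD(2))
  have sa: "slot_additive (fst X)" "slot_additive (\<lambda>Ys. snd X Ys x)" for x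
    using cochains_additive[OF vector_space_sum assms] unfolding additive_cochain_def by blast+
  have T0: "T 0 = 0" by (rule linear_simps(4)[OF T])
  have TC_simps: "fst T\<^sub>C Ys = 0" "snd T\<^sub>C [] x = T\<^sub>E x" "snd T\<^sub>C (A # Ys) x = 0" for Ys A x
    by (simp_all add: embed_V_def cochain_of_map_def zero_prod_def)
  note eq = E.LieY_eq[OF assms TC]
  show "fst (LY X T\<^sub>C) [A] = fst X [(fst A, T\<^sub>E (snd A))] + fst X [(T\<^sub>E (fst A), snd A)] - T\<^sub>E (fst X [A])"
    unfolding eq
    by (simp add: cochain_comp_def deriv_slot_def TC_simps X0 z T0 slot_additiveD[OF sa(1)] flip: zero_prod_def)
  show "snd (LY X T\<^sub>C) [A] z = snd X [A] (T\<^sub>E z) + snd X [(fst A, T\<^sub>E (snd A))] z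
      + snd X [(T\<^sub>E (fst A), snd A)] z - T\<^sub>E (snd X [A] z)"
    unfolding eq
    by (simp add: cochain_comp_def cochain_comp_snd_def deriv_slot_def TC_simps X0 \<open>\<And>B. snd X [B] 0 = 0\<close> T0
        slot_additiveD[OF sa(2)] flip: zero_prod_def)
  show "LY X T\<^sub>C \<in> cochains scale_sum scale_sum 1"
    using E.LieY_cochains[OF assms TC] by simp
qed

lemmas T_simps = linear_simps[OF T]

text \<open>The factor 2 counts the orders of the two copies of T: both fill arguments, or one fills
  an argument and the other acts on the value. Two copies on the value compose to 0.\<close>

lemma l2_map:
  "fst (pr_g (LY (LY \<Delta> T\<^sub>C) T\<^sub>C)) [(u, v)] = scale 2 (br (T u) (T v) - T (\<rho> (T u) v - \<rho> (T v) u))"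
  "snd (pr_g (LY (LY \<Delta> T\<^sub>C) T\<^sub>C)) [(u, v)] w = 0"
proof -
  note d = Delta_parts_cochains(3)
  have two: "scale 2 x = x + x" for x using scale_left_distrib[of 1 1 x] by simp
  note simps = pr_g_def LieY_map(1,2)[OF d] LieY_map(1,2)[OF LieY_map(3)[OF d]] Delta_simps
    bracket_sum_def triple_sum_def T_simps br_simps tri_simps rho_simps mu_simps D_simps
  show "fst (pr_g (LY (LY \<Delta> T\<^sub>C) T\<^sub>C)) [(u, v)] = scale 2 (br (T u) (T v) - T (\<rho> (T u) v - \<rho> (T v) u))"
    by (simp add: simps two)
  show "snd (pr_g (LY (LY \<Delta> T\<^sub>C) T\<^sub>C)) [(u, v)] w = 0"
    by (simp add: simps)
qed

text \<open>The factor 6 = 3! counts the orders of three copies: all fill arguments, or two fill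
  arguments and one acts on the value.\<close>

lemma l3_map:
  "fst (pr_g (LY (LY (LY \<Delta> T\<^sub>C) T\<^sub>C) T\<^sub>C)) [(u, v)] = 0"
  "snd (pr_g (LY (LY (LY \<Delta> T\<^sub>C) T\<^sub>C) T\<^sub>C)) [(u, v)] w
    = scale 6 (tri (T u) (T v) (T w) - T (D (T u) (T v) w + \<mu> (T v) (T w) u - \<mu> (T u) (T w) v))"
proof -
  note d = Delta_parts_cochains(3)
  have six: "scale 6 x = x + x + x + x + x + x" for x
    using scale_left_distrib[of 1 1 x] scale_left_distrib[of 2 1 x] scale_left_distrib[of 3 3 x] by simp
  note simps = pr_g_def LieY_map(1,2)[OF d] LieY_map(1,2)[OF LieY_map(3)[OF d]]
    LieY_map(1,2)[OF LieY_map(3)[OF LieY_map(3)[OF d]]] Delta_simps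
    bracket_sum_def triple_sum_def T_simps br_simps tri_simps rho_simps mu_simps D_simps
  show "fst (pr_g (LY (LY (LY \<Delta> T\<^sub>C) T\<^sub>C) T\<^sub>C)) [(u, v)] = 0"
    by (simp add: simps)
  show "snd (pr_g (LY (LY (LY \<Delta> T\<^sub>C) T\<^sub>C) T\<^sub>C)) [(u, v)] w
    = scale 6 (tri (T u) (T v) (T w) - T (D (T u) (T v) w + \<mu> (T v) (T w) u - \<mu> (T u) (T w) v))"
    by (simp add: simps six)
qed

lemma cochain_1_eq_0_iff:
  assumes "P \<in> cochains scaleV scale 1"
  shows "P = 0 \<longleftrightarrow> (\<forall>u v. fst P [(u, v)] = 0) \<and> (\<forall>u v w. snd P [(u, v)] w = 0)"
proof
  assume *: "(\<forall>u v. fst P [(u, v)] = 0) \<and> (\<forall>u v w. snd P [(u, v)] w = 0)"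
  have "fst P Xs = 0 \<and> snd P Xs w = 0" for Xs w
  proof (cases "length Xs = 1")
    case True
    then obtain A where "Xs = [A]" by (auto simp: length_Suc_conv)
    then show ?thesis using * by (cases A) simp
  next
    case False
    then show ?thesis
      using assms unfolding cochains_V_iff by simp
  qed
  then show "P = 0" by (simp add: prod_eq_iff fun_eq_iff)
qed simp

lemma strict_maurer_cartan_map:
  "strict_maurer_cartan (cochain_scale scale) CV l (cochain_of_map T)
    \<longleftrightarrow> relative_rota_baxter scale scaleV br tri \<rho> \<mu> T"
proof -
  let ?\<alpha> = "cochain_of_map T"
  have \<alpha>: "?\<alpha> \<in> CV 0"
    using cochain_of_map_cochains[OF T] by (simp add: C_star_def)
  have smc: "strict_maurer_cartan (cochain_scale scale) CV l ?\<alpha> \<longleftrightarrow> (\<forall>k\<ge>1. l k (replicate k ?\<alpha>) = 0)"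
  proof -
    \<comment> \<open>If every bracket vanishes, the Maurer-Cartan sum runs over the empty set, so
      the equation and its finiteness condition hold at once.\<close>
    have e: "{k. k \<ge> 1 \<and> l k (replicate k ?\<alpha>) \<noteq> 0} = {}" if "\<forall>k\<ge>1. l k (replicate k ?\<alpha>) = 0"
      using that by blast
    have "maurer_cartan (cochain_scale scale) CV l ?\<alpha>" if "\<forall>k\<ge>1. l k (replicate k ?\<alpha>) = 0"
      unfolding maurer_cartan_def e[OF that] using \<alpha> by simp
    then show ?thesis
      unfolding strict_maurer_cartan_def by (intro iffI) (erule conjunct2, rule conjI, assumption+)
  qed
  have l2: "l 2 (replicate 2 ?\<alpha>) = pr_g (LY (LY \<Delta> T\<^sub>C) T\<^sub>C)"
    by (simp add: rrb_brackets_def l2_def Let_def numeral_2_eq_2)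
  have l3: "l 3 (replicate 3 ?\<alpha>) = pr_g (LY (LY (LY \<Delta> T\<^sub>C) T\<^sub>C) T\<^sub>C)"
    by (simp add: rrb_brackets_def l3_def Let_def numeral_3_eq_3)
  note LY1 = LieY_map(3)[OF Delta_parts_cochains(3)]
  note LY2 = LieY_map(3)[OF LY1]
  note LY3 = LieY_map(3)[OF LY2]
  have c2: "l 2 (replicate 2 ?\<alpha>) = 0 \<longleftrightarrow> (\<forall>u v. br (T u) (T v) = T (\<rho> (T u) v - \<rho> (T v) u))"
    unfolding l2 cochain_1_eq_0_iff[OF pr_g_cochains[OF LY2]] l2_map by simp
  have c3: "l 3 (replicate 3 ?\<alpha>) = 0 \<longleftrightarrow>
    (\<forall>u v w. tri (T u) (T v) (T w) = T (D (T u) (T v) w + \<mu> (T v) (T w) u - \<mu> (T u) (T w) v))"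
    unfolding l3 cochain_1_eq_0_iff[OF pr_g_cochains[OF LY3]] l3_map by simp
  have "l k (replicate k ?\<alpha>) = 0" if "k \<noteq> 2" "k \<noteq> 3" for k
    using that by (simp add: rrb_brackets_def)
  then have "(\<forall>k\<ge>1. l k (replicate k ?\<alpha>) = 0) \<longleftrightarrow> l 2 (replicate 2 ?\<alpha>) = 0 \<and> l 3 (replicate 3 ?\<alpha>) = 0"
    by (metis one_le_numeral)
  then show ?thesis
    unfolding smc relative_rota_baxter_def c2 c3 using T by simp
qed

end

theorem strict_maurer_cartan_eq:
  "{\<alpha>. strict_maurer_cartan (cochain_scale scale) CV l \<alpha>}
    = cochain_of_map ` {T. relative_rota_baxter scale scaleV br tri \<rho> \<mu> T}"
proof (intro equalityI subsetI)
  fix \<alpha> assume "\<alpha> \<in> {\<alpha>. strict_maurer_cartan (cochain_scale scale) CV l \<alpha>}"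
  then have smc: "strict_maurer_cartan (cochain_scale scale) CV l \<alpha>" by simp
  then have "\<alpha> \<in> cochains scaleV scale 0"
    by (simp add: strict_maurer_cartan_def maurer_cartan_def C_star_def)
  then obtain T where T: "Vector_Spaces.linear scaleV scale T" "\<alpha> = cochain_of_map T"
    by (rule cochains_0_of_map)
  with smc strict_maurer_cartan_map[OF T(1)]
  show "\<alpha> \<in> cochain_of_map ` {T. relative_rota_baxter scale scaleV br tri \<rho> \<mu> T}" by blast
next
  fix \<alpha> assume "\<alpha> \<in> cochain_of_map ` {T. relative_rota_baxter scale scaleV br tri \<rho> \<mu> T}"
  then obtain T where T: "relative_rota_baxter scale scaleV br tri \<rho> \<mu> T" "\<alpha> = cochain_of_map T" by blast
  then have "Vector_Spaces.linear scaleV scale T" by (simp add: relative_rota_baxter_def)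
  from strict_maurer_cartan_map[OF this] T
  show "\<alpha> \<in> {\<alpha>. strict_maurer_cartan (cochain_scale scale) CV l \<alpha>}" by simp
qed

end

theorem theorem4p6:
  fixes sg :: "'k::field_char_0 \<Rightarrow> 'g::ab_group_add \<Rightarrow> 'g"
    and sv :: "'k \<Rightarrow> 'v::ab_group_add \<Rightarrow> 'v"
    and \<pi> :: "'g \<Rightarrow> 'g \<Rightarrow> 'g"
    and \<omega> :: "'g \<Rightarrow> 'g \<Rightarrow> 'g \<Rightarrow> 'g"
    and \<rho> :: "'g \<Rightarrow> 'v \<Rightarrow> 'v"
    and \<mu> :: "'g \<Rightarrow> 'g \<Rightarrow> 'v \<Rightarrow> 'v"
  assumes "lie_yamaguti_algebra sg \<pi> \<omega>"
    and "lie_yamaguti_representation sg \<pi> \<omega> sv \<rho> \<mu>"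
  shows "L_infinity_algebra (cochain_scale sg) (C_star sv sg) (rrb_brackets sg sv \<pi> \<omega> \<rho> \<mu>) \<and>
    {\<alpha>. strict_maurer_cartan (cochain_scale sg) (C_star sv sg) (rrb_brackets sg sv \<pi> \<omega> \<rho> \<mu>) \<alpha>}
      = cochain_of_map ` {T. relative_rota_baxter sg sv \<pi> \<omega> \<rho> \<mu> T}"
proof -
  interpret lie_yamaguti_representation_char_0 sg \<pi> \<omega> sv \<rho> \<mu>
    using assms(2) by (simp add: lie_yamaguti_representation_char_0_def)
  show ?thesis using L_infinity strict_maurer_cartan_eq by blast
qed

end
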